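(* Let $\mathcal{R}\subset\mathbb{R}^N\setminus\{0\}$ be a reduced root system with a non-negative multiplicity function $k$, and let $a>0$. Suppose $a+2\langle k\rangle+N-2>0$. Then: 1) $\Delta_{k,a}=\|x\|^{2-a}\Delta_k-\|x\|^a$ extends to a self-adjoint operator on $L^2(\mathbb{R}^N,\vartheta_{k,a}(x)dx)$. 2) There is no continuous spectrum of $\Delta_{k,a}$. 3) All the discrete spectra of $\Delta_{k,a}$ are negative.
   Context: Let $N\ge1$, $\langle\cdot,\cdot\rangle$ the standard inner product on $\mathbb{R}^N$, $\|x\|=\langle x,x\rangle^{1/2}$, and for $\alpha\neq0$ let $r_\alpha(x)=x-2\frac{\langle\alpha,x\rangle}{\|\alpha\|^2}\alpha$. A (reduced) root system is a finite set $\mathcal{R}\subset\mathbb{R}^N\setminus\{0\}$ with $r_\alpha(\mathcal{R})=\mathcal{R}$ and $\mathcal{R}\cap\mathbb{R}\alpha=\{\pm\alpha\}$ for all $\alpha\in\mathcal{R}$ (no crystallographic or spanning condition). $\mathfrak{C}$ is the finite Coxeter group generated by $\{r_\alpha\}$, $\mathcal{R}^+$ a positive subsystem. A multiplicity function is a $\mathfrak{C}$-invariant function $k=(k_\alpha)$ on $\mathcal{R}$; non-negative means $k_\alpha\ge0$ for all $\alpha$. Put $\langle k\rangle=\sum_{\alpha\in\mathcal{R}^+}k_\alpha$. The Dunkl operators are $T_\xi(k)f(x)=\partial_\xi f(x)+\sum_{\alpha\in\mathcal{R}^+}k_\alpha\langle\alpha,\xi\rangle\frac{f(x)-f(r_\alpha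 x)}{\langle\alpha,x\rangle}$, and the Dunkl Laplacian is $\Delta_k=\sum_{j=1}^NT_{\xi_j}(k)^2$ for an orthonormal basis $\xi_1,\dots,\xi_N$. The density is $\vartheta_{k,a}(x)=\|x\|^{a-2}\prod_{\alpha\in\mathcal{R}}|\langle\alpha,x\rangle|^{k_\alpha}$. Let $\mathcal{H}_k^m(\mathbb{R}^N)$ be the space of homogeneous polynomials $p$ of degree $m$ with $\Delta_kp=0$, $\lambda_{k,a,m}=\frac{2m+2\langle k\rangle+N-2}{a}$, $L_\ell^{(\lambda)}(t)=\sum_{j=0}^\ell\frac{(-1)^j\Gamma(\lambda+\ell+1)}{(\ell-j)!\,\Gamma(\lambda+j+1)}\frac{t^j}{j!}$ the Laguerre polynomial, and $\Phi_\ell^{(a)}(p,x)=p(x)L_\ell^{(\lambda_{k,a,m})}(\frac2a\|x\|^a)\exp(-\frac1a\|x\|^a)$ for $p\in\mathcal{H}_k^m(\mathbb{R}^N)$. The operator $\Delta_{k,a}$ is regarded as a densely defined operator with domain $W_{k,a}(\mathbb{R}^N)$, the complex span of all $\Phi_\ell^{(a)}(p,\cdot)$ with $\ell,m\in\mathbb{N}=\{0,1,2,\dots\}$, $p\in\mathcal{H}_k^m(\mathbb{R}^N)$; the spectral statements refer to its self-adjoint extension. "Discrete spectra" means eigenvalues. *)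

theory Defs
  imports "HOL-Analysis.Analysis"
begin

section \<open>Root systems and multiplicity functions\<close>

definition reflection :: "real ^ 'n \<Rightarrow> real ^ 'n \<Rightarrow> real ^ 'n" where
  "reflection \<alpha> x = x - (2 * (\<alpha> \<bullet> x) / (norm \<alpha>)\<^sup>2) *\<^sub>R \<alpha>"

definition reduced_root_system :: "(real ^ 'n) set \<Rightarrow> bool" where
  "reduced_root_system R \<longleftrightarrow>
     finite R \<and> 0 \<notin> R \<and>
     (\<forall>\<alpha>\<in>R. reflection \<alpha> ` R = R) \<and>
     (\<forall>\<alpha>\<in>R. R \<inter> span {\<alpha>} = {\<alpha>, - \<alpha>})"

definition positive_subsystem :: "(real ^ 'n) set \<Rightarrow> (real ^ 'n) set \<Rightarrow> bool" where
  "positive_subsystem R Rp \<longleftrightarrow>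
     (\<exists>\<beta>. (\<forall>\<alpha>\<in>R. \<alpha> \<bullet> \<beta> \<noteq> 0) \<and> Rp = {\<alpha> \<in> R. \<alpha> \<bullet> \<beta> > 0})"

text \<open>Reflections are involutions, so the monoid they generate is already a group.\<close>

inductive_set coxeter_group :: "(real ^ 'n) set \<Rightarrow> (real ^ 'n \<Rightarrow> real ^ 'n) set"
  for R :: "(real ^ 'n) set" where
  coxeter_id: "id \<in> coxeter_group R"
| coxeter_step: "\<alpha> \<in> R \<Longrightarrow> g \<in> coxeter_group R \<Longrightarrow> reflection \<alpha> \<circ> g \<in> coxeter_group R"

definition multiplicity_function :: "(real ^ 'n) set \<Rightarrow> (real ^ 'n \<Rightarrow> real) \<Rightarrow> bool" where
  "multiplicity_function R k \<longleftrightarrow> (\<forall>g\<in>coxeter_group R. \<forall>\<alpha>\<in>R. k (g \<alpha>) = k \<alpha>)"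

definition mult_index :: "(real ^ 'n) set \<Rightarrow> (real ^ 'n \<Rightarrow> real) \<Rightarrow> real" where
  "mult_index Rp k = (\<Sum>\<alpha>\<in>Rp. k \<alpha>)"


section \<open>Dunkl operators\<close>

text \<open>
  On the hyperplane orthogonal to \<open>\<alpha>\<close> the quotient
  \<open>(f x - f (reflection \<alpha> x)) / (\<alpha> \<bullet> x)\<close> is read as its continuous extension, which for
  differentiable \<open>f\<close> is \<open>2 / (norm \<alpha>)\<^sup>2\<close> times the derivative of \<open>f\<close> in direction \<open>\<alpha>\<close>.
\<close>

definition dunkl_quotient ::
    "real ^ 'n \<Rightarrow> (real ^ 'n \<Rightarrow> complex) \<Rightarrow> real ^ 'n \<Rightarrow> complex" where
  "dunkl_quotient \<alpha> f x =
     (if \<alpha> \<bullet> x = 0 then (2 / (norm \<alpha>)\<^sup>2) *\<^sub>R frechet_derivative f (at x) \<alpha>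
      else (f x - f (reflection \<alpha> x)) /\<^sub>R (\<alpha> \<bullet> x))"

definition dunkl_operator ::
    "(real ^ 'n) set \<Rightarrow> (real ^ 'n \<Rightarrow> real) \<Rightarrow> real ^ 'n \<Rightarrow>
     (real ^ 'n \<Rightarrow> complex) \<Rightarrow> real ^ 'n \<Rightarrow> complex" where
  "dunkl_operator Rp k \<xi> f x =
     frechet_derivative f (at x) \<xi> +
     (\<Sum>\<alpha>\<in>Rp. (k \<alpha> * (\<alpha> \<bullet> \<xi>)) *\<^sub>R dunkl_quotient \<alpha> f x)"

definition dunkl_laplacian ::
    "(real ^ 'n) set \<Rightarrow> (real ^ 'n \<Rightarrow> real) \<Rightarrow>
     (real ^ 'n \<Rightarrow> complex) \<Rightarrow> real ^ 'n \<Rightarrow> complex" where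
  "dunkl_laplacian Rp k f x =
     (\<Sum>\<xi>\<in>Basis. dunkl_operator Rp k \<xi> (dunkl_operator Rp k \<xi> f) x)"

definition Delta_ka ::
    "(real ^ 'n) set \<Rightarrow> (real ^ 'n \<Rightarrow> real) \<Rightarrow> real \<Rightarrow>
     (real ^ 'n \<Rightarrow> complex) \<Rightarrow> real ^ 'n \<Rightarrow> complex" where
  "Delta_ka Rp k a f x =
     (norm x powr (2 - a)) *\<^sub>R dunkl_laplacian Rp k f x - (norm x powr a) *\<^sub>R f x"


section \<open>The domain \<open>W\<close>\<close>

text \<open>
  For polynomial functions over the reals, homogeneity of degree \<open>m\<close> as a polynomial is the
  same as homogeneity as a function.
\<close>

definition dunkl_harmonics ::
    "(real ^ 'n) set \<Rightarrow> (real ^ 'n \<Rightarrow> real) \<Rightarrow> nat \<Rightarrow> (real ^ 'n \<Rightarrow> complex) set" where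
  "dunkl_harmonics Rp k m =
     {p. polynomial_function p \<and>
         (\<forall>c x. p (c *\<^sub>R x) = (c ^ m) *\<^sub>R p x) \<and>
         (\<forall>x. dunkl_laplacian Rp k p x = 0)}"

definition lambda_kam ::
    "(real ^ 'n) set \<Rightarrow> (real ^ 'n \<Rightarrow> real) \<Rightarrow> real \<Rightarrow> nat \<Rightarrow> real" where
  "lambda_kam Rp k a m = (2 * real m + 2 * mult_index Rp k + real CARD('n) - 2) / a"

definition laguerre :: "nat \<Rightarrow> real \<Rightarrow> real \<Rightarrow> real" where
  "laguerre l \<nu> t =
     (\<Sum>j\<le>l. (- 1) ^ j * Gamma (\<nu> + real l + 1) / (fact (l - j) * Gamma (\<nu> + real j + 1))
            * (t ^ j / fact j))"

definition Phi ::
    "(real ^ 'n) set \<Rightarrow> (real ^ 'n \<Rightarrow> real) \<Rightarrow> real \<Rightarrow> nat \<Rightarrow> nat \<Rightarrow>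
     (real ^ 'n \<Rightarrow> complex) \<Rightarrow> real ^ 'n \<Rightarrow> complex" where
  "Phi Rp k a l m p x =
     p x * complex_of_real (laguerre l (lambda_kam Rp k a m) (2 / a * norm x powr a)
                            * exp (- (1 / a) * norm x powr a))"

definition W_ka ::
    "(real ^ 'n) set \<Rightarrow> (real ^ 'n \<Rightarrow> real) \<Rightarrow> real \<Rightarrow> (real ^ 'n \<Rightarrow> complex) set" where
  "W_ka Rp k a =
     {(\<lambda>x. \<Sum>\<phi>\<in>S. c \<phi> * \<phi> x) | S c.
        finite S \<and> S \<subseteq> {Phi Rp k a l m p | l m p. p \<in> dunkl_harmonics Rp k m}}"


section \<open>The weighted measure\<close>

text \<open>
  Since \<open>0 powr s = 0\<close> for every \<open>s\<close>, the weight is \<open>0\<close> at the origin and on all root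
  hyperplanes, even where the multiplicity vanishes; this only affects a Lebesgue null set.
\<close>

definition dunkl_weight ::
    "(real ^ 'n) set \<Rightarrow> (real ^ 'n \<Rightarrow> real) \<Rightarrow> real \<Rightarrow> real ^ 'n \<Rightarrow> real" where
  "dunkl_weight R k a x = norm x powr (a - 2) * (\<Prod>\<alpha>\<in>R. \<bar>\<alpha> \<bullet> x\<bar> powr k \<alpha>)"

definition dunkl_measure ::
    "(real ^ 'n) set \<Rightarrow> (real ^ 'n \<Rightarrow> real) \<Rightarrow> real \<Rightarrow> (real ^ 'n) measure" where
  "dunkl_measure R k a = density lebesgue (\<lambda>x. ennreal (dunkl_weight R k a x))"


section \<open>Unbounded operators on \<open>L\<^sup>2\<close>\<close>

text \<open>
  Elements of the complex Hilbert space \<open>L\<^sup>2(M)\<close> are represented by square-integrable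
  functions, with equality meaning equality almost everywhere. An operator is represented by
  its graph, a set of pairs of representatives that is required to be closed under almost
  everywhere equality, so that such graphs correspond to graphs of operators on the quotient.
\<close>

definition L2 :: "'a measure \<Rightarrow> ('a \<Rightarrow> complex) set" where
  "L2 M = {f. f \<in> borel_measurable M \<and> integrable M (\<lambda>x. (cmod (f x))\<^sup>2)}"

definition L2_inner :: "'a measure \<Rightarrow> ('a \<Rightarrow> complex) \<Rightarrow> ('a \<Rightarrow> complex) \<Rightarrow> complex" where
  "L2_inner M f g = (LINT x|M. f x * cnj (g x))"

definition L2_norm :: "'a measure \<Rightarrow> ('a \<Rightarrow> complex) \<Rightarrow> real" where
  "L2_norm M f = sqrt (LINT x|M. (cmod (f x))\<^sup>2)"

definition L2_dense :: "'a measure \<Rightarrow> ('a \<Rightarrow> complex) set \<Rightarrow> bool" where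
  "L2_dense M D \<longleftrightarrow>
     D \<subseteq> L2 M \<and> (\<forall>f\<in>L2 M. \<forall>\<epsilon>>0. \<exists>u\<in>D. L2_norm M (\<lambda>x. f x - u x) < \<epsilon>)"

definition L2_operator ::
    "'a measure \<Rightarrow> (('a \<Rightarrow> complex) \<times> ('a \<Rightarrow> complex)) set \<Rightarrow> bool" where
  "L2_operator M A \<longleftrightarrow>
     A \<subseteq> L2 M \<times> L2 M \<and>
     ((\<lambda>x. 0), (\<lambda>x. 0)) \<in> A \<and>
     (\<forall>f g f' g'. (f, g) \<in> A \<longrightarrow> (f', g') \<in> A \<longrightarrow>
        ((\<lambda>x. f x + f' x), (\<lambda>x. g x + g' x)) \<in> A) \<and>
     (\<forall>f g c. (f, g) \<in> A \<longrightarrow> ((\<lambda>x. c * f x), (\<lambda>x. c * g x)) \<in> A) \<and>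
     (\<forall>f g f' g'. (f, g) \<in> A \<longrightarrow> f' \<in> L2 M \<longrightarrow> g' \<in> L2 M \<longrightarrow>
        (AE x in M. f' x = f x) \<longrightarrow> (AE x in M. g' x = g x) \<longrightarrow> (f', g') \<in> A) \<and>
     (\<forall>f g g'. (f, g) \<in> A \<longrightarrow> (f, g') \<in> A \<longrightarrow> (AE x in M. g x = g' x))"

definition L2_adjoint ::
    "'a measure \<Rightarrow> (('a \<Rightarrow> complex) \<times> ('a \<Rightarrow> complex)) set \<Rightarrow>
     (('a \<Rightarrow> complex) \<times> ('a \<Rightarrow> complex)) set" where
  "L2_adjoint M A =
     {(u, w). u \<in> L2 M \<and> w \<in> L2 M \<and> (\<forall>(f, g)\<in>A. L2_inner M g u = L2_inner M f w)}"

definition self_adjoint ::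
    "'a measure \<Rightarrow> (('a \<Rightarrow> complex) \<times> ('a \<Rightarrow> complex)) set \<Rightarrow> bool" where
  "self_adjoint M A \<longleftrightarrow>
     L2_operator M A \<and> L2_dense M (Domain A) \<and> L2_adjoint M A = A"

definition shifted_range ::
    "(('a \<Rightarrow> complex) \<times> ('a \<Rightarrow> complex)) set \<Rightarrow> complex \<Rightarrow> ('a \<Rightarrow> complex) set" where
  "shifted_range A z = {(\<lambda>x. g x - z * f x) | f g. (f, g) \<in> A}"

definition point_spectrum ::
    "'a measure \<Rightarrow> (('a \<Rightarrow> complex) \<times> ('a \<Rightarrow> complex)) set \<Rightarrow> complex set" where
  "point_spectrum M A =
     {z. \<exists>f. (f, (\<lambda>x. z * f x)) \<in> A \<and> \<not> (AE x in M. f x = 0)}"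

text \<open>
  \<open>A - z\<close> is injective with dense range but not surjective. For a closed operator, in
  particular a self-adjoint one, this says that \<open>A - z\<close> has a densely defined, unbounded
  inverse.
\<close>

definition continuous_spectrum ::
    "'a measure \<Rightarrow> (('a \<Rightarrow> complex) \<times> ('a \<Rightarrow> complex)) set \<Rightarrow> complex set" where
  "continuous_spectrum M A =
     {z. z \<notin> point_spectrum M A \<and> L2_dense M (shifted_range A z) \<and> shifted_range A z \<noteq> L2 M}"

definition self_adjoint_extension ::
    "(real ^ 'n) set \<Rightarrow> (real ^ 'n) set \<Rightarrow> (real ^ 'n \<Rightarrow> real) \<Rightarrow> real \<Rightarrow>
     ((real ^ 'n \<Rightarrow> complex) \<times> (real ^ 'n \<Rightarrow> complex)) set \<Rightarrow> bool" where
  "self_adjoint_extension R Rp k a A \<longleftrightarrow>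
     self_adjoint (dunkl_measure R k a) A \<and>
     (\<forall>f\<in>W_ka Rp k a. (f, Delta_ka Rp k a f) \<in> A)"

end

theory Submission
  imports Defs
begin

text \<open>
  The operator is diagonalised explicitly. For \<open>p\<close> harmonic of degree \<open>m\<close> and \<open>t = \<parallel>x\<parallel>^a\<close>, the
  Dunkl Laplacian of \<open>p(x) f(t)\<close> contains no reflection terms any more, and \<open>\<Delta>\<^sub>k\<^sub>,\<^sub>a\<close> maps
  \<open>p(x) f(t)\<close> to \<open>p(x)\<close> times an ordinary differential operator applied to \<open>f\<close>
  (\<open>\<Delta>_separated\<close>). On \<open>f(t) = Q(t) exp(-t/a)\<close> this is Laguerre's operator on the polynomial
  \<open>Q\<close>; hence the functions \<open>\<Phi>\<close> are eigenfunctions with eigenvalue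
  \<open>-a (2 l + \<lambda>\<^sub>m + 1)\<close> (\<open>\<Delta>_\<Phi>\<close>). The assumption on the index means that \<open>\<lambda>\<^sub>m > -1\<close> for all
  \<open>m\<close>, which makes the eigenvalues negative and the functions square-integrable. Bounded sets
  contain only finitely many eigenvalues.

  Eigenfunctions for different \<open>(l, m)\<close> are orthogonal (\<open>\<Phi>_orthogonal\<close>). Polar coordinates
  split the inner product into a radial and an angular factor. The radial one
  vanishes for equal \<open>m\<close> because Laguerre's operator is symmetric for the weight
  \<open>t^\<lambda> exp(-2t/a)\<close>; the argument uses only the recursion of the moments. The angular one is expressed by an
  integral over the unit ball and vanishes for different \<open>m\<close> by a Green identity: with the
  additional factor \<open>1 - \<parallel>x\<parallel>\<^sup>2\<close> the Dunkl operators are skew-adjoint on the ball up to an explicit term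
  (\<open>T_skew_adjoint\<close>), so the symmetric Dirichlet form of two harmonic polynomials is governed by the degree of either
  (\<open>harmonics_orthogonal\<close>). The skew-adjointness rests on the divergence theorem for the weight,
  whose derivative is integrable but possibly unbounded along the root hyperplanes.

  The span of the eigenfunctions is dense (\<open>approx_all\<close>). The Laguerre polynomials span all
  polynomials; the exponential rate \<open>1/a\<close> can be changed to any positive rate by
  exponential series that converge dominatedly; polynomials in \<open>exp(-t)\<close> approximate every compactly
  supported radial factor by Weierstrass' theorem; the Fischer decomposition of polynomials into
  powers of \<open>\<parallel>x\<parallel>\<^sup>2\<close> times harmonic polynomials (\<open>fischer_decomposition\<close>) replaces the harmonic factor by
  an arbitrary polynomial, and the theorem of Stone and Weierstrass by an arbitrary continuous
  function; measurable functions follow by dominated convergence.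

  The rest is operator theory for a diagonal operator with real, discrete eigenvalues
  other than \<open>0\<close> and a dense span of orthogonal eigenvectors. Away from the eigenvalues it is bounded below with dense
  range, so its closure is surjective there by completeness of \<open>L\<^sup>2\<close>. Invertibility at \<open>0\<close> identifies the
  closure with the adjoint, which is therefore self-adjoint
  (\<open>self_adjoint_closure_operator\<close>) and the only self-adjoint extension
  (\<open>self_adjoint_extension_unique\<close>). Surjectivity off the eigenvalues leaves no continuous spectrum, and
  the point spectrum consists of the eigenvalues (\<open>spectrum_closure_operator\<close>).
\<close>

section \<open>Square-integrable functions\<close>

lemma borel_measurable_cnj[measurable (raw)]:
  assumes "f \<in> borel_measurable M" shows "(\<lambda>x. cnj (f x)) \<in> borel_measurable M"
  by (rule measurable_compose[OF assms])
    (intro borel_measurable_continuous_onI continuous_on_cnj continuous_on_id)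

lemma L2_I:
  assumes "f \<in> borel_measurable M" "integrable M (\<lambda>x. (cmod (f x))\<^sup>2)"
  shows "f \<in> L2 M"
  using assms by (simp add: L2_def)

lemma L2_measurable[measurable_dest]: "f \<in> L2 M \<Longrightarrow> f \<in> borel_measurable M"
  by (simp add: L2_def)

lemma L2_integrable: "f \<in> L2 M \<Longrightarrow> integrable M (\<lambda>x. (cmod (f x))\<^sup>2)"
  by (simp add: L2_def)

lemma L2_dominated:
  assumes [measurable]: "f \<in> borel_measurable M" and "integrable M (\<lambda>x. (h x)\<^sup>2)"
    and "AE x in M. cmod (f x) \<le> h x"
  shows "f \<in> L2 M"
proof (rule L2_I)
  show "integrable M (\<lambda>x. (cmod (f x))\<^sup>2)"
  proof (rule Bochner_Integration.integrable_bound[OF assms(2)])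
    show "AE x in M. norm ((cmod (f x))\<^sup>2) \<le> norm ((h x)\<^sup>2)"
      using assms(3) by eventually_elim (auto intro!: power_mono)
  qed simp
qed simp

lemma L2_zero[simp]: "(\<lambda>x. 0) \<in> L2 M"
  by (simp add: L2_def)

lemma L2_scale: "f \<in> L2 M \<Longrightarrow> (\<lambda>x. c * f x) \<in> L2 M"
  by (auto simp: L2_def norm_mult power_mult_distrib)

lemma L2_add:
  assumes "f \<in> L2 M" "g \<in> L2 M" shows "(\<lambda>x. f x + g x) \<in> L2 M"
proof (rule L2_I)
  note [measurable] = L2_measurable[OF assms(1)] L2_measurable[OF assms(2)]
  show "(\<lambda>x. f x + g x) \<in> borel_measurable M" by simp
  show "integrable M (\<lambda>x. (cmod (f x + g x))\<^sup>2)"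
  proof (rule Bochner_Integration.integrable_bound)
    show "integrable M (\<lambda>x. 2 * (cmod (f x))\<^sup>2 + 2 * (cmod (g x))\<^sup>2)"
      using L2_integrable[OF assms(1)] L2_integrable[OF assms(2)] by simp
    have "(cmod (u + v))\<^sup>2 \<le> 2 * (cmod u)\<^sup>2 + 2 * (cmod v)\<^sup>2" for u v
    proof -
      have "(cmod (u + v))\<^sup>2 \<le> (cmod u + cmod v)\<^sup>2" by (intro power_mono norm_triangle_ineq) auto
      also have "\<dots> \<le> 2 * (cmod u)\<^sup>2 + 2 * (cmod v)\<^sup>2"
        using sum_squares_bound[of "cmod u" "cmod v"] by (simp add: power2_sum)
      finally show ?thesis .
    qed
    then show "AE x in M. norm ((cmod (f x + g x))\<^sup>2)
        \<le> norm (2 * (cmod (f x))\<^sup>2 + 2 * (cmod (g x))\<^sup>2)"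
      by auto
  qed simp
qed

lemma L2_diff:
  assumes "f \<in> L2 M" "g \<in> L2 M" shows "(\<lambda>x. f x - g x) \<in> L2 M"
  using L2_add[OF assms(1) L2_scale[OF assms(2), of "-1"]] by simp

lemma L2_sum:
  assumes "\<And>i. i \<in> S \<Longrightarrow> f i \<in> L2 M" shows "(\<lambda>x. \<Sum>i\<in>S. f i x) \<in> L2 M"
  using assms by (induction S rule: infinite_finite_induct) (auto intro: L2_add)

lemma L2_AE_cong:
  assumes "f \<in> L2 M" "g \<in> borel_measurable M" "AE x in M. g x = f x" shows "g \<in> L2 M"
  by (rule L2_dominated[OF assms(2) L2_integrable[OF assms(1)]]) (use assms(3) in auto)

lemma L2_mult_integrable:
  assumes "f \<in> L2 M" "g \<in> L2 M" shows "integrable M (\<lambda>x. f x * cnj (g x))"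
proof -
  note [measurable] = L2_measurable[OF assms(1)] L2_measurable[OF assms(2)]
  show ?thesis
  proof (rule Bochner_Integration.integrable_bound)
    show "integrable M (\<lambda>x. (cmod (f x))\<^sup>2 + (cmod (g x))\<^sup>2)"
      using L2_integrable[OF assms(1)] L2_integrable[OF assms(2)] by simp
    have "cmod u * cmod v \<le> (cmod u)\<^sup>2 + (cmod v)\<^sup>2" for u v
      using sum_squares_bound[of "cmod u" "cmod v"]
        mult_nonneg_nonneg[OF norm_ge_zero[of u] norm_ge_zero[of v]] by linarith
    then show "AE x in M. norm (f x * cnj (g x)) \<le> norm ((cmod (f x))\<^sup>2 + (cmod (g x))\<^sup>2)"
      by (auto simp: norm_mult)
  qed simp
qed

lemma L2_norm_nonneg[simp]: "0 \<le> L2_norm M f"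
  by (simp add: L2_norm_def)

lemma L2_norm_sq: "(L2_norm M f)\<^sup>2 = (LINT x|M. (cmod (f x))\<^sup>2)"
  by (simp add: L2_norm_def)

lemma L2_norm_zero[simp]: "L2_norm M (\<lambda>x. 0) = 0"
  by (simp add: L2_norm_def)

lemma L2_norm_scale: "L2_norm M (\<lambda>x. c * f x) = cmod c * L2_norm M f"
  by (simp add: L2_norm_def norm_mult power_mult_distrib real_sqrt_mult)

lemma L2_norm_minus_commute: "L2_norm M (\<lambda>x. f x - g x) = L2_norm M (\<lambda>x. g x - f x)"
  by (simp add: L2_norm_def norm_minus_commute)

lemma L2_norm_eq_0:
  assumes "f \<in> L2 M" shows "L2_norm M f = 0 \<longleftrightarrow> (AE x in M. f x = 0)"
  using integral_nonneg_eq_0_iff_AE[OF L2_integrable[OF assms]] by (simp add: L2_norm_def)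

lemma L2_norm_cong_AE:
  assumes "AE x in M. f x = g x" "f \<in> borel_measurable M" "g \<in> borel_measurable M"
  shows "L2_norm M f = L2_norm M g"
  unfolding L2_norm_def using assms by (auto intro!: arg_cong[of _ _ sqrt] integral_cong_AE)

lemma L2_inner_cong_AE:
  assumes "AE x in M. f x = f' x" "AE x in M. g x = g' x"
    "f \<in> borel_measurable M" "g \<in> borel_measurable M"
    "f' \<in> borel_measurable M" "g' \<in> borel_measurable M"
  shows "L2_inner M f g = L2_inner M f' g'"
  unfolding L2_inner_def using assms by (auto intro!: integral_cong_AE borel_measurable_cnj)

lemma L2_inner_self: "L2_inner M f f = complex_of_real ((L2_norm M f)\<^sup>2)"
proof -
  have "f x * cnj (f x) = complex_of_real ((cmod (f x))\<^sup>2)" for x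
    by (simp only: complex_norm_square)
  then show ?thesis
    by (simp only: L2_inner_def L2_norm_sq integral_complex_of_real)
qed

lemma L2_inner_cnj: "cnj (L2_inner M f g) = L2_inner M g f"
  unfolding L2_inner_def Bochner_Integration.integral_cnj[symmetric] by (simp add: mult.commute)

lemma L2_inner_scale_left: "L2_inner M (\<lambda>x. c * f x) g = c * L2_inner M f g"
  unfolding L2_inner_def by (simp add: mult.assoc)

lemma L2_inner_scale_right: "L2_inner M f (\<lambda>x. c * g x) = cnj c * L2_inner M f g"
  unfolding L2_inner_def by (simp add: mult.left_commute)

lemma L2_inner_add_left:
  "f \<in> L2 M \<Longrightarrow> f' \<in> L2 M \<Longrightarrow> g \<in> L2 M \<Longrightarrow>
    L2_inner M (\<lambda>x. f x + f' x) g = L2_inner M f g + L2_inner M f' g"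
  unfolding L2_inner_def
  by (simp add: distrib_right L2_mult_integrable Bochner_Integration.integral_add)

lemma L2_inner_diff_left:
  "f \<in> L2 M \<Longrightarrow> f' \<in> L2 M \<Longrightarrow> g \<in> L2 M \<Longrightarrow>
    L2_inner M (\<lambda>x. f x - f' x) g = L2_inner M f g - L2_inner M f' g"
  unfolding L2_inner_def
  by (simp add: left_diff_distrib L2_mult_integrable Bochner_Integration.integral_diff)

lemma L2_inner_add_right:
  assumes "f \<in> L2 M" "f' \<in> L2 M" "g \<in> L2 M"
  shows "L2_inner M g (\<lambda>x. f x + f' x) = L2_inner M g f + L2_inner M g f'"
  using arg_cong[where f = cnj, OF L2_inner_add_left[OF assms]] by (simp add: L2_inner_cnj)

lemma L2_inner_diff_right:
  assumes "f \<in> L2 M" "f' \<in> L2 M" "g \<in> L2 M"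
  shows "L2_inner M g (\<lambda>x. f x - f' x) = L2_inner M g f - L2_inner M g f'"
  using arg_cong[where f = cnj, OF L2_inner_diff_left[OF assms]] by (simp add: L2_inner_cnj)

lemma L2_inner_sum_left:
  assumes "\<And>i. i \<in> S \<Longrightarrow> f i \<in> L2 M" "g \<in> L2 M"
  shows "L2_inner M (\<lambda>x. \<Sum>i\<in>S. f i x) g = (\<Sum>i\<in>S. L2_inner M (f i) g)"
  unfolding L2_inner_def sum_distrib_right
  by (rule Bochner_Integration.integral_sum) (auto intro: L2_mult_integrable assms)

lemma L2_inner_sum_right:
  assumes "\<And>i. i \<in> S \<Longrightarrow> f i \<in> L2 M" "g \<in> L2 M"
  shows "L2_inner M g (\<lambda>x. \<Sum>i\<in>S. f i x) = (\<Sum>i\<in>S. L2_inner M g (f i))"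
  using arg_cong[where f = cnj, OF L2_inner_sum_left[OF assms]] by (simp add: L2_inner_cnj)

lemma L2_integral_mult_le:
  assumes "f \<in> L2 M" "g \<in> L2 M"
  shows "(LINT x|M. cmod (f x) * cmod (g x)) \<le> L2_norm M f * L2_norm M g"
proof -
  note [measurable] = L2_measurable[OF assms(1)] L2_measurable[OF assms(2)]
  have int: "integrable M (\<lambda>x. cmod (f x) * cmod (g x))"
    using integrable_norm[OF L2_mult_integrable[OF assms]] by (simp add: norm_mult)
  have "ennreal ((LINT x|M. cmod (f x) * cmod (g x))\<^sup>2)
      = (\<integral>\<^sup>+x. ennreal (cmod (f x)) * ennreal (cmod (g x)) \<partial>M)\<^sup>2"
    using int by (simp add: nn_integral_eq_integral ennreal_mult'[symmetric] ennreal_power)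
  also have "\<dots> \<le> (\<integral>\<^sup>+x. (ennreal (cmod (f x)))\<^sup>2 \<partial>M) * (\<integral>\<^sup>+x. (ennreal (cmod (g x)))\<^sup>2 \<partial>M)"
    by (rule Cauchy_Schwarz_nn_integral) auto
  also have "\<dots> = ennreal ((L2_norm M f)\<^sup>2 * (L2_norm M g)\<^sup>2)"
    using L2_integrable[OF assms(1)] L2_integrable[OF assms(2)]
    by (simp add: L2_norm_sq nn_integral_eq_integral ennreal_power ennreal_mult')
  finally have "(LINT x|M. cmod (f x) * cmod (g x))\<^sup>2 \<le> (L2_norm M f * L2_norm M g)\<^sup>2"
    by (simp add: power_mult_distrib)
  then show ?thesis by (rule power2_le_imp_le) simp
qed

lemma L2_Cauchy_Schwarz:
  assumes "f \<in> L2 M" "g \<in> L2 M"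
  shows "cmod (L2_inner M f g) \<le> L2_norm M f * L2_norm M g"
  unfolding L2_inner_def
  using integral_norm_bound[of M "\<lambda>x. f x * cnj (g x)"] L2_integral_mult_le[OF assms]
  by (simp add: norm_mult)

lemma L2_norm_triangle:
  assumes "f \<in> L2 M" "g \<in> L2 M"
  shows "L2_norm M (\<lambda>x. f x + g x) \<le> L2_norm M f + L2_norm M g"
proof (rule power2_le_imp_le)
  have int: "integrable M (\<lambda>x. cmod (f x) * cmod (g x))"
    using integrable_norm[OF L2_mult_integrable[OF assms]] by (simp add: norm_mult)
  have "(L2_norm M (\<lambda>x. f x + g x))\<^sup>2
      \<le> (LINT x|M. (cmod (f x))\<^sup>2 + (cmod (g x))\<^sup>2 + 2 * (cmod (f x) * cmod (g x)))"
    unfolding L2_norm_sq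
  proof (rule integral_mono)
    show "integrable M (\<lambda>x. (cmod (f x + g x))\<^sup>2)" by (rule L2_integrable[OF L2_add[OF assms]])
    fix x
    have "(cmod (f x + g x))\<^sup>2 \<le> (cmod (f x) + cmod (g x))\<^sup>2"
      by (intro power_mono norm_triangle_ineq) auto
    then show "(cmod (f x + g x))\<^sup>2 \<le> (cmod (f x))\<^sup>2 + (cmod (g x))\<^sup>2 + 2 * (cmod (f x) * cmod (g x))"
      by (simp add: power2_sum)
  qed (use int L2_integrable[OF assms(1)] L2_integrable[OF assms(2)] in auto)
  also have "\<dots> = (L2_norm M f)\<^sup>2 + (L2_norm M g)\<^sup>2 + 2 * (LINT x|M. cmod (f x) * cmod (g x))"
    using int L2_integrable[OF assms(1)] L2_integrable[OF assms(2)] by (simp add: L2_norm_sq)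
  also have "\<dots> \<le> (L2_norm M f + L2_norm M g)\<^sup>2"
    using L2_integral_mult_le[OF assms] by (simp add: power2_sum)
  finally show "(L2_norm M (\<lambda>x. f x + g x))\<^sup>2 \<le> (L2_norm M f + L2_norm M g)\<^sup>2" .
qed simp

lemma L2_norm_triangle_diff:
  assumes "f \<in> L2 M" "g \<in> L2 M" "h \<in> L2 M"
  shows "L2_norm M (\<lambda>x. f x - h x) \<le> L2_norm M (\<lambda>x. f x - g x) + L2_norm M (\<lambda>x. g x - h x)"
  using L2_norm_triangle[OF L2_diff[OF assms(1,2)] L2_diff[OF assms(2,3)]] by simp

text \<open>A sequence with \<open>L\<^sup>2\<close>-increments below \<open>4^(-k)\<close> converges almost everywhere, because the
  series of \<open>2^k \<bar>d\<^sub>k\<bar>\<^sup>2\<close> has finite integral and \<open>\<bar>d\<^sub>k\<bar> \<le> 2^k \<bar>d\<^sub>k\<bar>\<^sup>2 + 2^(-k)\<close>.\<close>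

lemma L2_rapid_Cauchy_converges_AE:
  assumes f: "\<And>k. f k \<in> L2 M"
    and d: "\<And>k. L2_norm M (\<lambda>x. f (Suc k) x - f k x) < (1/4) ^ k"
  shows "AE x in M. convergent (\<lambda>k. f k x)"
proof -
  note [measurable] = L2_measurable[OF f]
  let ?d = "\<lambda>k x. f (Suc k) x - f k x"
  have "(\<integral>\<^sup>+x. (\<Sum>k. ennreal (2 ^ k * (cmod (?d k x))\<^sup>2)) \<partial>M)
      = (\<Sum>k. \<integral>\<^sup>+x. ennreal (2 ^ k * (cmod (?d k x))\<^sup>2) \<partial>M)"
    by (rule nn_integral_suminf) auto
  also have "\<dots> = (\<Sum>k. ennreal (2 ^ k * (L2_norm M (?d k))\<^sup>2))"
    using L2_integrable[OF L2_diff[OF f f]]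
    by (simp add: nn_integral_eq_integral L2_norm_sq)
  also have "\<dots> \<le> (\<Sum>k. ennreal ((1/2) ^ k))"
  proof (intro suminf_le ennreal_leI)
    fix k :: nat
    have "(L2_norm M (?d k))\<^sup>2 \<le> ((1/4) ^ k)\<^sup>2" by (intro power_mono) (auto intro: less_imp_le d)
    also have "\<dots> \<le> (1/4) ^ k"
      using power_le_one[of "(1/4)::real" k] by (simp add: power2_eq_square mult_left_le)
    finally have "2 ^ k * (L2_norm M (?d k))\<^sup>2 \<le> 2 ^ k * (1/4) ^ k" by (intro mult_left_mono) auto
    also have "\<dots> = (1/2) ^ k" by (simp add: power_mult_distrib[symmetric])
    finally show "2 ^ k * (L2_norm M (?d k))\<^sup>2 \<le> (1/2) ^ k" .
  qed auto
  also have "\<dots> = ennreal (\<Sum>k. (1/2) ^ k)" by (rule suminf_ennreal2) auto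
  finally have "(\<integral>\<^sup>+x. (\<Sum>k. ennreal (2 ^ k * (cmod (?d k x))\<^sup>2)) \<partial>M) \<noteq> \<infinity>"
    by (auto simp: top_unique)
  then have "AE x in M. (\<Sum>k. ennreal (2 ^ k * (cmod (?d k x))\<^sup>2)) \<noteq> \<infinity>"
    by (intro nn_integral_PInf_AE) auto
  then show ?thesis
  proof eventually_elim
    fix x assume fin: "(\<Sum>k. ennreal (2 ^ k * (cmod (?d k x))\<^sup>2)) \<noteq> \<infinity>"
    have "summable (\<lambda>k. 2 ^ k * (cmod (?d k x))\<^sup>2)"
      by (rule summable_suminf_not_top) (use fin in auto)
    then have s: "summable (\<lambda>k. 2 ^ k * (cmod (?d k x))\<^sup>2 + (1/2) ^ k)"
      by (intro summable_add) (auto intro: summable_geometric)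
    have "summable (\<lambda>k. ?d k x)"
    proof (rule summable_comparison_test'[OF s])
      fix k :: nat
      let ?u = "cmod (?d k x)"
      have e: "sqrt (2 ^ k) * (sqrt ((1/2) ^ k)) = 1"
        by (simp add: real_sqrt_mult[symmetric] power_mult_distrib[symmetric])
      have "2 * (sqrt (2 ^ k) * ?u) * sqrt ((1/2) ^ k)
          \<le> (sqrt (2 ^ k) * ?u)\<^sup>2 + (sqrt ((1/2) ^ k))\<^sup>2"
        by (rule sum_squares_bound)
      moreover have "2 * (sqrt (2 ^ k) * ?u) * sqrt ((1/2) ^ k)
          = 2 * ?u * (sqrt (2 ^ k) * (sqrt ((1/2) ^ k)))"
        by (simp only: mult_ac)
      ultimately have "2 * ?u \<le> 2 ^ k * ?u\<^sup>2 + (1/2) ^ k"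
        unfolding e by (simp add: power_mult_distrib)
      then show "norm (?d k x) \<le> 2 ^ k * ?u\<^sup>2 + (1/2) ^ k" using norm_ge_zero[of "?d k x"] by linarith
    qed
    then have "convergent (\<lambda>n. (\<Sum>k<n. ?d k x) + f 0 x)"
      by (intro convergent_add convergent_const) (simp add: summable_iff_convergent)
    moreover have "(\<Sum>k<n. ?d k x) + f 0 x = f n x" for n
      using sum_lessThan_telescope[of "\<lambda>k. f k x" n] by simp
    ultimately show "convergent (\<lambda>k. f k x)" by simp
  qed
qed

text \<open>The rapidly converging subsequence has a pointwise limit, and Fatou's lemma turns the Cauchy
  condition into convergence to that limit in norm.\<close>

theorem L2_complete:
  assumes f: "\<And>n. f n \<in> L2 M"
    and Cauchy: "\<And>e. e > 0 \<Longrightarrow> \<exists>N. \<forall>m\<ge>N. \<forall>n\<ge>N. L2_norm M (\<lambda>x. f m x - f n x) < e"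
  shows "\<exists>g\<in>L2 M. (\<lambda>n. L2_norm M (\<lambda>x. f n x - g x)) \<longlonglongrightarrow> 0"
proof -
  note [measurable] = L2_measurable[OF f]
  have "\<forall>k. \<exists>N. \<forall>m\<ge>N. \<forall>n\<ge>N. L2_norm M (\<lambda>x. f m x - f n x) < (1/4) ^ k"
    using Cauchy by simp
  then obtain N where N: "\<And>k m n. m \<ge> N k \<Longrightarrow> n \<ge> N k \<Longrightarrow> L2_norm M (\<lambda>x. f m x - f n x) < (1/4) ^ k"
    by metis
  define r where "r k = (\<Sum>i\<le>k. N i)" for k
  have rN: "r k \<ge> N k" for k unfolding r_def by (rule member_le_sum) auto
  have r_mono: "r i \<ge> r k" if "i \<ge> k" for i k
    unfolding r_def using that by (intro sum_mono2) auto
  have conv: "AE x in M. convergent (\<lambda>k. f (r k) x)"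
    by (rule L2_rapid_Cauchy_converges_AE) (auto intro!: f N intro: rN order_trans[OF rN r_mono])
  define g where "g x = lim (\<lambda>k. f (r k) x)" for x
  have [measurable]: "g \<in> borel_measurable M" unfolding g_def by measurable
  have lim: "AE x in M. (\<lambda>k. f (r k) x) \<longlonglongrightarrow> g x"
    using conv by eventually_elim (simp add: g_def convergent_LIMSEQ_iff)
  have bound: "(\<integral>\<^sup>+x. ennreal ((cmod (f n x - g x))\<^sup>2) \<partial>M) \<le> ennreal (((1/4) ^ K)\<^sup>2)"
    if n: "n \<ge> r K" for n K
  proof -
    have "(\<integral>\<^sup>+x. ennreal ((cmod (f n x - g x))\<^sup>2) \<partial>M)
        = (\<integral>\<^sup>+x. liminf (\<lambda>k. ennreal ((cmod (f n x - f (r k) x))\<^sup>2)) \<partial>M)"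
    proof (rule nn_integral_cong_AE)
      show "AE x in M. ennreal ((cmod (f n x - g x))\<^sup>2)
          = liminf (\<lambda>k. ennreal ((cmod (f n x - f (r k) x))\<^sup>2))"
        using lim
      proof eventually_elim
        case (elim x)
        then have "(\<lambda>k. ennreal ((cmod (f n x - f (r k) x))\<^sup>2)) \<longlonglongrightarrow> ennreal ((cmod (f n x - g x))\<^sup>2)"
          by (intro tendsto_intros) auto
        then show ?case by (intro lim_imp_Liminf[symmetric]) auto
      qed
    qed
    also have "\<dots> \<le> liminf (\<lambda>k. \<integral>\<^sup>+x. ennreal ((cmod (f n x - f (r k) x))\<^sup>2) \<partial>M)"
      by (rule nn_integral_liminf) auto
    also have "\<dots> = liminf (\<lambda>k. ennreal ((L2_norm M (\<lambda>x. f n x - f (r k) x))\<^sup>2))"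
      using L2_integrable[OF L2_diff[OF f f]] by (simp add: nn_integral_eq_integral L2_norm_sq)
    also have "\<dots> \<le> limsup (\<lambda>k. ennreal ((L2_norm M (\<lambda>x. f n x - f (r k) x))\<^sup>2))"
      by (rule Liminf_le_Limsup) simp
    also have "\<dots> \<le> ennreal (((1/4) ^ K)\<^sup>2)"
    proof (rule Limsup_bounded)
      show "\<forall>\<^sub>F k in sequentially. ennreal ((L2_norm M (\<lambda>x. f n x - f (r k) x))\<^sup>2) \<le> ennreal (((1/4) ^ K)\<^sup>2)"
      proof (rule eventually_sequentiallyI)
        fix k assume "k \<ge> K"
        then have "L2_norm M (\<lambda>x. f n x - f (r k) x) < (1/4) ^ K"
          using n rN[of K] r_mono[of K k] by (intro N) auto
        then show "ennreal ((L2_norm M (\<lambda>x. f n x - f (r k) x))\<^sup>2) \<le> ennreal (((1/4) ^ K)\<^sup>2)"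
          by (intro ennreal_leI power_mono) auto
      qed
    qed
    finally show ?thesis .
  qed
  have diffL2: "(\<lambda>x. f n x - g x) \<in> L2 M" if n: "n \<ge> r K" for n K
  proof (rule L2_I)
    show "integrable M (\<lambda>x. (cmod (f n x - g x))\<^sup>2)"
      using order.strict_trans1[OF bound[OF n]] by (intro integrableI_bounded) auto
  qed simp
  have g: "g \<in> L2 M" using L2_diff[OF f[of "r 0"] diffL2[of 0 "r 0"]] by simp
  have "(\<lambda>n. L2_norm M (\<lambda>x. f n x - g x)) \<longlonglongrightarrow> 0"
  proof (rule LIMSEQ_I)
    fix e :: real assume "e > 0"
    then obtain K where K: "(1/4::real) ^ K < e" using real_arch_pow_inv[of e "1/4"] by auto
    have "L2_norm M (\<lambda>x. f n x - g x) < e" if n: "n \<ge> r K" for n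
    proof -
      have "ennreal ((L2_norm M (\<lambda>x. f n x - g x))\<^sup>2) \<le> ennreal (((1/4) ^ K)\<^sup>2)"
        using bound[OF n] L2_integrable[OF diffL2[OF n]] by (simp add: L2_norm_sq nn_integral_eq_integral)
      then have "(L2_norm M (\<lambda>x. f n x - g x))\<^sup>2 \<le> ((1/4) ^ K)\<^sup>2" by (simp add: ennreal_le_iff)
      then have "L2_norm M (\<lambda>x. f n x - g x) \<le> (1/4) ^ K" by (rule power2_le_imp_le) simp
      with K show ?thesis by linarith
    qed
    then show "\<exists>no. \<forall>n\<ge>no. norm (L2_norm M (\<lambda>x. f n x - g x) - 0) < e" by auto
  qed
  with g show ?thesis by blast
qed

lemma L2_norm_dominated_convergence:
  assumes f: "\<And>n. f n \<in> borel_measurable M" and [measurable]: "g \<in> borel_measurable M"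
    and h: "integrable M (\<lambda>x. (h x)\<^sup>2)"
    and lim: "AE x in M. (\<lambda>n. f n x) \<longlonglongrightarrow> g x" and bd: "\<And>n. AE x in M. cmod (f n x) \<le> h x"
  shows "(\<lambda>n. L2_norm M (\<lambda>x. f n x - g x)) \<longlonglongrightarrow> 0" and "g \<in> L2 M"
proof -
  note [measurable] = f
  have bd': "AE x in M. \<forall>n. cmod (f n x) \<le> h x" using bd by (simp add: AE_all_countable)
  have gh: "AE x in M. cmod (g x) \<le> h x"
    using bd' lim
  proof eventually_elim
    case (elim x)
    show ?case by (rule LIMSEQ_le_const2[OF tendsto_norm[OF elim(2)]]) (use elim(1) in auto)
  qed
  then show "g \<in> L2 M" by (intro L2_dominated[OF _ h]) auto
  have "(\<lambda>n. LINT x|M. (cmod (f n x - g x))\<^sup>2) \<longlonglongrightarrow> (LINT x|M. 0)"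
  proof (rule integral_dominated_convergence[where w = "\<lambda>x. 4 * (h x)\<^sup>2"])
    show "AE x in M. (\<lambda>n. (cmod (f n x - g x))\<^sup>2) \<longlonglongrightarrow> 0"
      using lim by eventually_elim (auto intro!: tendsto_eq_intros)
    show "AE x in M. norm ((cmod (f n x - g x))\<^sup>2) \<le> 4 * (h x)\<^sup>2" for n
      using bd' gh
    proof eventually_elim
      case (elim x)
      have "cmod (f n x - g x) \<le> 2 * h x"
        using norm_triangle_ineq4[of "f n x" "g x"] elim(1)[rule_format, of n] elim(2) by linarith
      then have "(cmod (f n x - g x))\<^sup>2 \<le> (2 * h x)\<^sup>2" by (intro power_mono) auto
      then show ?case by (simp add: power_mult_distrib)
    qed
  qed (use h in auto)
  then have "(\<lambda>n. sqrt (LINT x|M. (cmod (f n x - g x))\<^sup>2)) \<longlonglongrightarrow> sqrt 0"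
    by (intro tendsto_real_sqrt) simp
  then show "(\<lambda>n. L2_norm M (\<lambda>x. f n x - g x)) \<longlonglongrightarrow> 0" by (simp add: L2_norm_def)
qed

lemma L2_inner_tendsto:
  assumes "\<And>n. f n \<in> L2 M" "u \<in> L2 M" "v \<in> L2 M"
    and "(\<lambda>n. L2_norm M (\<lambda>x. f n x - u x)) \<longlonglongrightarrow> 0"
  shows "(\<lambda>n. L2_inner M (f n) v) \<longlonglongrightarrow> L2_inner M u v"
proof (rule Lim_null[THEN iffD2], rule Lim_null_comparison)
  show "(\<lambda>n. L2_norm M (\<lambda>x. f n x - u x) * L2_norm M v) \<longlonglongrightarrow> 0"
    using tendsto_mult_right[OF assms(4)] by simp
  show "\<forall>\<^sub>F n in sequentially. norm (L2_inner M (f n) v - L2_inner M u v)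
      \<le> L2_norm M (\<lambda>x. f n x - u x) * L2_norm M v"
    using L2_Cauchy_Schwarz[OF L2_diff[OF assms(1,2)] assms(3)]
    by (simp add: L2_inner_diff_left assms(1-3))
qed

lemma L2_inner_tendsto_right:
  assumes "\<And>n. f n \<in> L2 M" "u \<in> L2 M" "v \<in> L2 M"
    and "(\<lambda>n. L2_norm M (\<lambda>x. f n x - u x)) \<longlonglongrightarrow> 0"
  shows "(\<lambda>n. L2_inner M v (f n)) \<longlonglongrightarrow> L2_inner M v u"
  using tendsto_cnj[OF L2_inner_tendsto[OF assms]] by (simp add: L2_inner_cnj)

lemma L2_norm_tendsto:
  assumes "\<And>n. f n \<in> L2 M" "u \<in> L2 M" and "(\<lambda>n. L2_norm M (\<lambda>x. f n x - u x)) \<longlonglongrightarrow> 0"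
  shows "(\<lambda>n. L2_norm M (f n)) \<longlonglongrightarrow> L2_norm M u"
proof (rule Lim_null[THEN iffD2], rule Lim_null_comparison[OF _ assms(3)])
  have "norm (L2_norm M (f n) - L2_norm M u) \<le> L2_norm M (\<lambda>x. f n x - u x)" for n
    using L2_norm_triangle[OF L2_diff[OF assms(1)[of n] assms(2)] assms(2)]
      L2_norm_triangle[OF L2_diff[OF assms(2) assms(1)[of n]] assms(1)[of n]]
    by (simp add: L2_norm_minus_commute[of M u])
  then show "\<forall>\<^sub>F n in sequentially. norm (L2_norm M (f n) - L2_norm M u) \<le> L2_norm M (\<lambda>x. f n x - u x)"
    by simp
qed

section \<open>Symmetric operators with a complete system of eigenvectors\<close>

lemma L2_adjointI:
  assumes "u \<in> L2 M" "w \<in> L2 M" "\<And>f g. (f, g) \<in> A \<Longrightarrow> L2_inner M g u = L2_inner M f w"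
  shows "(u, w) \<in> L2_adjoint M A"
  using assms by (auto simp: L2_adjoint_def)

lemma L2_adjoint_antimono: "A \<subseteq> B \<Longrightarrow> L2_adjoint M B \<subseteq> L2_adjoint M A"
  by (auto simp: L2_adjoint_def)

text \<open>The space \<open>E \<mu>\<close> stands for the eigenvectors with eigenvalue \<open>\<mu>\<close>, and is allowed to be trivial.
  Indexing by all real numbers instead of a set of eigenvalues keeps sums over finite sets of
  indices uniform; the numbers with a nontrivial eigenspace are recovered as \<open>eigenvalues\<close>.\<close>

locale orthogonal_eigenspaces =
  fixes M :: "'a measure" and E :: "real \<Rightarrow> ('a \<Rightarrow> complex) set"
  assumes E_L2: "f \<in> E \<mu> \<Longrightarrow> f \<in> L2 M"
    and E_zero: "(\<lambda>x. 0) \<in> E \<mu>"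
    and E_add: "f \<in> E \<mu> \<Longrightarrow> g \<in> E \<mu> \<Longrightarrow> (\<lambda>x. f x + g x) \<in> E \<mu>"
    and E_scale: "f \<in> E \<mu> \<Longrightarrow> (\<lambda>x. c * f x) \<in> E \<mu>"
    and E_orthogonal: "f \<in> E \<mu> \<Longrightarrow> g \<in> E \<nu> \<Longrightarrow> \<mu> \<noteq> \<nu> \<Longrightarrow> L2_inner M f g = 0"
begin

definition eigenvalues :: "real set" where
  "eigenvalues = {\<mu>. \<exists>f\<in>E \<mu>. \<not> (AE x in M. f x = 0)}"

text \<open>The operator on the linear span of all eigenspaces that multiplies \<open>E \<mu>\<close> by \<open>\<mu>\<close>.\<close>

definition graph :: "(('a \<Rightarrow> complex) \<times> ('a \<Rightarrow> complex)) set" where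
  "graph = {((\<lambda>x. \<Sum>\<mu>\<in>T. F \<mu> x), (\<lambda>x. \<Sum>\<mu>\<in>T. complex_of_real \<mu> * F \<mu> x)) |T F.
     finite T \<and> (\<forall>\<mu>. F \<mu> \<in> E \<mu>)}"

lemma graph_L2: "(f, g) \<in> graph \<Longrightarrow> f \<in> L2 M \<and> g \<in> L2 M"
  unfolding graph_def by clarify (intro conjI L2_sum L2_scale; blast intro: E_L2)

lemma graph_diff:
  assumes "(f, g) \<in> graph" "(f', g') \<in> graph"
  shows "((\<lambda>x. f x - f' x), (\<lambda>x. g x - g' x)) \<in> graph"
proof -
  obtain T F T' F' where T: "finite T" "\<And>\<mu>. F \<mu> \<in> E \<mu>" "finite T'" "\<And>\<mu>. F' \<mu> \<in> E \<mu>"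
    and fg: "f = (\<lambda>x. \<Sum>\<mu>\<in>T. F \<mu> x)" "g = (\<lambda>x. \<Sum>\<mu>\<in>T. complex_of_real \<mu> * F \<mu> x)"
      "f' = (\<lambda>x. \<Sum>\<mu>\<in>T'. F' \<mu> x)" "g' = (\<lambda>x. \<Sum>\<mu>\<in>T'. complex_of_real \<mu> * F' \<mu> x)"
    using assms unfolding graph_def by blast
  define H where "H \<mu> x = (if \<mu> \<in> T then F \<mu> x else 0) + (-1) * (if \<mu> \<in> T' then F' \<mu> x else 0)" for \<mu> x
  have 1: "(\<lambda>x. if \<mu> \<in> T then F \<mu> x else 0) \<in> E \<mu>" for \<mu> using T E_zero by (cases "\<mu> \<in> T") auto
  have 2: "(\<lambda>x. if \<mu> \<in> T' then F' \<mu> x else 0) \<in> E \<mu>" for \<mu> using T E_zero by (cases "\<mu> \<in> T'") auto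
  have H: "H \<mu> \<in> E \<mu>" for \<mu>
    using E_add[OF 1 E_scale[OF 2, of "-1"]] by (simp add: H_def[abs_def])
  have s: "(\<Sum>\<mu>\<in>T \<union> T'. w \<mu> * (if \<mu> \<in> A then h \<mu> else 0)) = (\<Sum>\<mu>\<in>A. w \<mu> * h \<mu>)"
    if "A = T \<or> A = T'" for A and w h :: "real \<Rightarrow> complex"
    using that T by (intro sum.mono_neutral_cong_right) auto
  have "(\<Sum>\<mu>\<in>T \<union> T'. w \<mu> * H \<mu> x) = (\<Sum>\<mu>\<in>T. w \<mu> * F \<mu> x) - (\<Sum>\<mu>\<in>T'. w \<mu> * F' \<mu> x)" for x w
    using s[of T w "\<lambda>\<mu>. F \<mu> x"] s[of T' w "\<lambda>\<mu>. F' \<mu> x"]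
    by (simp add: H_def distrib_left right_diff_distrib sum_subtractf)
  from this[of "\<lambda>_. 1"] this[of complex_of_real]
  have "(\<lambda>x. f x - f' x) = (\<lambda>x. \<Sum>\<mu>\<in>T \<union> T'. H \<mu> x)"
    "(\<lambda>x. g x - g' x) = (\<lambda>x. \<Sum>\<mu>\<in>T \<union> T'. complex_of_real \<mu> * H \<mu> x)"
    by (auto simp: fg)
  moreover have "finite (T \<union> T')" using T by simp
  ultimately show ?thesis unfolding graph_def using H by blast
qed

lemma pythagoras:
  assumes "finite T" "\<And>\<mu>. F \<mu> \<in> E \<mu>"
  shows "(L2_norm M (\<lambda>x. \<Sum>\<mu>\<in>T. F \<mu> x))\<^sup>2 = (\<Sum>\<mu>\<in>T. (L2_norm M (F \<mu>))\<^sup>2)"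
proof -
  have L: "F \<mu> \<in> L2 M" for \<mu> by (rule E_L2[OF assms(2)])
  have "L2_inner M (\<lambda>x. \<Sum>\<mu>\<in>T. F \<mu> x) (\<lambda>x. \<Sum>\<mu>\<in>T. F \<mu> x)
      = (\<Sum>\<mu>\<in>T. \<Sum>\<nu>\<in>T. L2_inner M (F \<mu>) (F \<nu>))"
    by (simp add: L2_inner_sum_left L2_inner_sum_right L2_sum L)
  also have "\<dots> = (\<Sum>\<mu>\<in>T. \<Sum>\<nu>\<in>T. if \<mu> = \<nu> then complex_of_real ((L2_norm M (F \<mu>))\<^sup>2) else 0)"
    by (intro sum.cong refl) (auto simp: L2_inner_self intro: E_orthogonal[OF assms(2) assms(2)])
  also have "\<dots> = complex_of_real (\<Sum>\<mu>\<in>T. (L2_norm M (F \<mu>))\<^sup>2)"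
    using assms(1) by simp
  finally show ?thesis unfolding L2_inner_self by (simp only: of_real_eq_iff)
qed

text \<open>Only pairs with equal eigenvalue contribute to either side, and the eigenvalues are real.\<close>

lemma graph_symmetric:
  assumes "(f, g) \<in> graph" "(f', g') \<in> graph" shows "L2_inner M g f' = L2_inner M f g'"
proof -
  obtain T F T' F' where T: "finite T" "\<And>\<mu>. F \<mu> \<in> E \<mu>" "finite T'" "\<And>\<mu>. F' \<mu> \<in> E \<mu>"
    and fg: "f = (\<lambda>x. \<Sum>\<mu>\<in>T. F \<mu> x)" "g = (\<lambda>x. \<Sum>\<mu>\<in>T. complex_of_real \<mu> * F \<mu> x)"
      "f' = (\<lambda>x. \<Sum>\<mu>\<in>T'. F' \<mu> x)" "g' = (\<lambda>x. \<Sum>\<mu>\<in>T'. complex_of_real \<mu> * F' \<mu> x)"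
    using assms unfolding graph_def by blast
  have L: "F \<mu> \<in> L2 M" "F' \<mu> \<in> L2 M" for \<mu> by (auto intro: E_L2 T)
  have "L2_inner M g f' = (\<Sum>\<mu>\<in>T. \<Sum>\<nu>\<in>T'. complex_of_real \<mu> * L2_inner M (F \<mu>) (F' \<nu>))"
    unfolding fg
    by (simp add: L2_inner_sum_left L2_inner_sum_right L2_sum L L2_scale L2_inner_scale_left
        sum_distrib_left)
  also have "\<dots> = (\<Sum>\<mu>\<in>T. \<Sum>\<nu>\<in>T'. complex_of_real \<nu> * L2_inner M (F \<mu>) (F' \<nu>))"
  proof (intro sum.cong refl)
    fix \<mu> \<nu> show "complex_of_real \<mu> * L2_inner M (F \<mu>) (F' \<nu>)
        = complex_of_real \<nu> * L2_inner M (F \<mu>) (F' \<nu>)"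
      using E_orthogonal[OF T(2) T(4), of \<mu> \<nu>] by (cases "\<mu> = \<nu>") auto
  qed
  also have "\<dots> = L2_inner M f g'"
    unfolding fg
    by (simp add: L2_inner_sum_left L2_inner_sum_right L2_sum L L2_scale L2_inner_scale_right
        sum_distrib_left)
  finally show ?thesis .
qed

text \<open>By orthogonality both norms are sums over the components, and the component \<open>F \<mu>\<close> is
  multiplied by \<open>\<mu> - z\<close>. A component with \<open>\<bar>\<mu> - z\<bar> < d\<close> vanishes almost everywhere, because
  \<open>\<mu>\<close> is then not an eigenvalue.\<close>

lemma graph_lower_bound:
  assumes "(f, g) \<in> graph" and d: "d > 0" "\<And>\<mu>. \<mu> \<in> eigenvalues \<Longrightarrow> d \<le> cmod (complex_of_real \<mu> - z)"
  shows "d * L2_norm M f \<le> L2_norm M (\<lambda>x. g x - z * f x)"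
proof -
  obtain T F where T: "finite T" "\<And>\<mu>. F \<mu> \<in> E \<mu>"
    and fg: "f = (\<lambda>x. \<Sum>\<mu>\<in>T. F \<mu> x)" "g = (\<lambda>x. \<Sum>\<mu>\<in>T. complex_of_real \<mu> * F \<mu> x)"
    using assms(1) unfolding graph_def by blast
  have "(\<lambda>x. g x - z * f x) = (\<lambda>x. \<Sum>\<mu>\<in>T. (complex_of_real \<mu> - z) * F \<mu> x)"
    by (simp add: fg sum_distrib_left sum_subtractf left_diff_distrib)
  then have "(L2_norm M (\<lambda>x. g x - z * f x))\<^sup>2
      = (\<Sum>\<mu>\<in>T. (L2_norm M (\<lambda>x. (complex_of_real \<mu> - z) * F \<mu> x))\<^sup>2)"
    using pythagoras[OF T(1), of "\<lambda>\<mu> x. (complex_of_real \<mu> - z) * F \<mu> x"] E_scale[OF T(2)] by simp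
  also have "\<dots> \<ge> (\<Sum>\<mu>\<in>T. d\<^sup>2 * (L2_norm M (F \<mu>))\<^sup>2)"
  proof (rule sum_mono)
    fix \<mu>
    show "d\<^sup>2 * (L2_norm M (F \<mu>))\<^sup>2 \<le> (L2_norm M (\<lambda>x. (complex_of_real \<mu> - z) * F \<mu> x))\<^sup>2"
    proof (cases "\<mu> \<in> eigenvalues")
      case True
      then show ?thesis using d by (auto simp: L2_norm_scale power_mult_distrib intro!: mult_right_mono power_mono)
    next
      case False
      then have "L2_norm M (F \<mu>) = 0"
        using T(2)[of \<mu>] L2_norm_eq_0[OF E_L2[OF T(2)[of \<mu>]]] unfolding eigenvalues_def by blast
      then show ?thesis by (simp add: L2_norm_scale)
    qed
  qed
  finally have "(d * L2_norm M f)\<^sup>2 \<le> (L2_norm M (\<lambda>x. g x - z * f x))\<^sup>2"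
    using pythagoras[OF T] by (simp add: fg(1) power_mult_distrib sum_distrib_left)
  then show ?thesis by (rule power2_le_imp_le) simp
qed

text \<open>The operator minus \<open>z\<close> is inverted by dividing each component by \<open>\<mu> - z\<close>.\<close>

lemma graph_resolvent:
  assumes "(f, g) \<in> graph" and z: "\<And>\<mu>. \<mu> \<in> eigenvalues \<Longrightarrow> complex_of_real \<mu> \<noteq> z"
  shows "\<exists>u v. (u, v) \<in> graph \<and> (AE x in M. v x - z * u x = f x)"
proof -
  obtain T F where T: "finite T" "\<And>\<mu>. F \<mu> \<in> E \<mu>" and f: "f = (\<lambda>x. \<Sum>\<mu>\<in>T. F \<mu> x)"
    using assms(1) unfolding graph_def by blast
  define H where "H \<mu> x = inverse (complex_of_real \<mu> - z) * F \<mu> x" for \<mu> x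
  have H: "H \<mu> \<in> E \<mu>" for \<mu>
    using E_scale[OF T(2)] by (simp add: H_def[abs_def])
  have "AE x in M. (complex_of_real \<mu> - z) * H \<mu> x = F \<mu> x" for \<mu>
  proof (cases "\<mu> \<in> eigenvalues")
    case True
    then show ?thesis using z by (auto simp: H_def)
  next
    case False
    then have "AE x in M. F \<mu> x = 0" using T(2)[of \<mu>] unfolding eigenvalues_def by blast
    then show ?thesis by eventually_elim (simp add: H_def)
  qed
  then have "AE x in M. \<forall>\<mu>\<in>T. (complex_of_real \<mu> - z) * H \<mu> x = F \<mu> x"
    using T(1) by (simp add: AE_finite_all)
  then have "AE x in M. (\<Sum>\<mu>\<in>T. complex_of_real \<mu> * H \<mu> x) - z * (\<Sum>\<mu>\<in>T. H \<mu> x) = f x"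
  proof eventually_elim
    case (elim x)
    have "(\<Sum>\<mu>\<in>T. complex_of_real \<mu> * H \<mu> x) - z * (\<Sum>\<mu>\<in>T. H \<mu> x)
        = (\<Sum>\<mu>\<in>T. (complex_of_real \<mu> - z) * H \<mu> x)"
      by (simp add: sum_distrib_left sum_subtractf left_diff_distrib)
    then show ?case using elim by (simp add: f)
  qed
  moreover have "((\<lambda>x. \<Sum>\<mu>\<in>T. H \<mu> x), (\<lambda>x. \<Sum>\<mu>\<in>T. complex_of_real \<mu> * H \<mu> x)) \<in> graph"
    unfolding graph_def using T(1) H by blast
  ultimately show ?thesis by blast
qed

end

locale complete_eigenspaces = orthogonal_eigenspaces +
  assumes dense: "L2_dense M (Domain graph)"
begin

lemma approximating_sequence:
  assumes "f \<in> L2 M"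
  obtains u v where "\<And>n. (u n, v n) \<in> graph" "(\<lambda>n. L2_norm M (\<lambda>x. u n x - f x)) \<longlonglongrightarrow> 0"
proof -
  have "\<forall>n. \<exists>p\<in>graph. L2_norm M (\<lambda>x. f x - fst p x) < 1 / real (Suc n)"
  proof
    fix n
    obtain u where u: "u \<in> Domain graph" "L2_norm M (\<lambda>x. f x - u x) < 1 / real (Suc n)"
      using dense assms unfolding L2_dense_def
      by (meson divide_pos_pos of_nat_0_less_iff zero_less_Suc zero_less_one)
    then obtain v where "(u, v) \<in> graph" by blast
    with u show "\<exists>p\<in>graph. L2_norm M (\<lambda>x. f x - fst p x) < 1 / real (Suc n)"
      by (intro bexI[of _ "(u, v)"]) auto
  qed
  then obtain p where p: "\<And>n. p n \<in> graph"
    "\<And>n. L2_norm M (\<lambda>x. f x - fst (p n) x) < 1 / real (Suc n)" by metis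
  show thesis
  proof (rule that)
    show "(fst (p n), snd (p n)) \<in> graph" for n using p(1) by simp
    show "(\<lambda>n. L2_norm M (\<lambda>x. fst (p n) x - f x)) \<longlonglongrightarrow> 0"
    proof (rule tendsto_sandwich[OF _ _ tendsto_const])
      show "(\<lambda>n. 1 / real (Suc n)) \<longlonglongrightarrow> 0" using LIMSEQ_Suc[OF lim_1_over_n[where 'a=real]] by simp
      show "\<forall>\<^sub>F n in sequentially. L2_norm M (\<lambda>x. fst (p n) x - f x) \<le> 1 / real (Suc n)"
        using p(2) by (intro always_eventually allI less_imp_le) (simp add: L2_norm_minus_commute[of M _ f])
    qed simp
  qed
qed

lemma orthogonal_to_graph_imp_zero:
  assumes w: "w \<in> L2 M" and "\<And>f g. (f, g) \<in> graph \<Longrightarrow> L2_inner M f w = 0"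
  shows "AE x in M. w x = 0"
proof -
  obtain u v where uv: "\<And>n. (u n, v n) \<in> graph" "(\<lambda>n. L2_norm M (\<lambda>x. u n x - w x)) \<longlonglongrightarrow> 0"
    by (rule approximating_sequence[OF w]) (rule that)
  have "(\<lambda>n. L2_inner M (u n) w) \<longlonglongrightarrow> L2_inner M w w"
    using uv graph_L2 by (intro L2_inner_tendsto w) auto
  then have "L2_inner M w w = 0" using assms(2)[OF uv(1)] LIMSEQ_unique[of "\<lambda>n. 0"] by auto
  then show ?thesis using L2_norm_eq_0[OF w] by (simp add: L2_inner_self)
qed

text \<open>The adjoint serves as the definition of the closure, because self-adjointness is then the
  statement that it is a symmetric operator. That every element is a limit of elements of \<open>graph\<close>
  is proved in \<open>closure_operator_approx\<close> below, once the eigenvalues stay away from \<open>0\<close>.\<close>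

definition closure_operator :: "(('a \<Rightarrow> complex) \<times> ('a \<Rightarrow> complex)) set" where
  "closure_operator = L2_adjoint M graph"

lemma closure_operator_L2: "(u, w) \<in> closure_operator \<Longrightarrow> u \<in> L2 M \<and> w \<in> L2 M"
  by (simp add: closure_operator_def L2_adjoint_def)

lemma closure_operatorD:
  "(u, w) \<in> closure_operator \<Longrightarrow> (f, g) \<in> graph \<Longrightarrow> L2_inner M g u = L2_inner M f w"
  by (auto simp: closure_operator_def L2_adjoint_def)

lemma graph_subset_closure_operator: "graph \<subseteq> closure_operator"
  using graph_L2 graph_symmetric by (auto simp: closure_operator_def L2_adjoint_def)

lemma closure_operator_limit:
  assumes "\<And>n. (u n, v n) \<in> graph" "f \<in> L2 M" "g \<in> L2 M"
    and "(\<lambda>n. L2_norm M (\<lambda>x. u n x - f x)) \<longlonglongrightarrow> 0" "(\<lambda>n. L2_norm M (\<lambda>x. v n x - g x)) \<longlonglongrightarrow> 0"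
  shows "(f, g) \<in> closure_operator"
proof -
  have "L2_inner M q f = L2_inner M p g" if pq: "(p, q) \<in> graph" for p q
  proof -
    have "(\<lambda>n. L2_inner M q (u n)) \<longlonglongrightarrow> L2_inner M q f"
      by (intro L2_inner_tendsto_right assms) (use graph_L2 assms(1) pq in auto)
    moreover have "(\<lambda>n. L2_inner M p (v n)) \<longlonglongrightarrow> L2_inner M p g"
      by (intro L2_inner_tendsto_right assms) (use graph_L2 assms(1) pq in auto)
    ultimately show ?thesis
      using graph_symmetric[OF pq assms(1)] LIMSEQ_unique by auto
  qed
  with assms show ?thesis by (auto simp: closure_operator_def L2_adjoint_def)
qed

text \<open>If \<open>z\<close> has positive distance from the eigenvalues, then solutions of the equation for
  approximating right-hand sides form a Cauchy sequence by the lower bound.\<close>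

lemma closure_operator_surj:
  assumes f: "f \<in> L2 M"
    and d: "d > 0" "\<And>\<mu>. \<mu> \<in> eigenvalues \<Longrightarrow> d \<le> cmod (complex_of_real \<mu> - z)"
  obtains u v w where "\<And>n. (u n, v n) \<in> graph" "w \<in> L2 M"
    "(\<lambda>n. L2_norm M (\<lambda>x. u n x - w x)) \<longlonglongrightarrow> 0"
    "(\<lambda>n. L2_norm M (\<lambda>x. v n x - (f x + z * w x))) \<longlonglongrightarrow> 0"
proof -
  obtain p q where p: "\<And>n. (p n, q n) \<in> graph" "(\<lambda>n. L2_norm M (\<lambda>x. p n x - f x)) \<longlonglongrightarrow> 0"
    by (rule approximating_sequence[OF f]) (rule that)
  have pL[simp]: "p n \<in> L2 M" for n using p graph_L2 by blast
  have "complex_of_real \<mu> \<noteq> z" if "\<mu> \<in> eigenvalues" for \<mu> using d(1) d(2)[OF that] by auto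
  then have "\<forall>n. \<exists>uv. uv \<in> graph \<and> (AE x in M. snd uv x - z * fst uv x = p n x)"
    using graph_resolvent[OF p(1)] by (metis fst_conv snd_conv)
  then obtain uv where uv: "\<And>n. uv n \<in> graph" "\<And>n. AE x in M. snd (uv n) x - z * fst (uv n) x = p n x"
    by metis
  define u v where "u n = fst (uv n)" and "v n = snd (uv n)" for n
  have g: "(u n, v n) \<in> graph" for n using uv by (simp add: u_def v_def)
  have [simp]: "u n \<in> L2 M" "v n \<in> L2 M" for n using g graph_L2 by auto
  have AE: "AE x in M. v n x - z * u n x = p n x" for n using uv(2) by (simp add: u_def v_def)
  have le: "d * L2_norm M (\<lambda>x. u m x - u n x)
      \<le> L2_norm M (\<lambda>x. p m x - f x) + L2_norm M (\<lambda>x. p n x - f x)" for m n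
  proof -
    have "d * L2_norm M (\<lambda>x. u m x - u n x)
        \<le> L2_norm M (\<lambda>x. (v m x - v n x) - z * (u m x - u n x))"
      by (rule graph_lower_bound[OF graph_diff[OF g g] d])
    also have "\<dots> = L2_norm M (\<lambda>x. p m x - p n x)"
    proof (rule L2_norm_cong_AE)
      show "AE x in M. (v m x - v n x) - z * (u m x - u n x) = p m x - p n x"
        using AE[of m] AE[of n]
      proof eventually_elim
        case (elim x)
        then show ?case unfolding elim[symmetric] by (simp add: algebra_simps)
      qed
    qed (auto intro!: L2_measurable L2_diff L2_scale)
    also have "\<dots> \<le> L2_norm M (\<lambda>x. p m x - f x) + L2_norm M (\<lambda>x. f x - p n x)"
      by (intro L2_norm_triangle_diff f) auto
    finally show ?thesis by (simp add: L2_norm_minus_commute[of M f])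
  qed
  have "\<exists>w\<in>L2 M. (\<lambda>n. L2_norm M (\<lambda>x. u n x - w x)) \<longlonglongrightarrow> 0"
  proof (rule L2_complete)
    fix e :: real assume "e > 0"
    then have "\<forall>\<^sub>F n in sequentially. L2_norm M (\<lambda>x. p n x - f x) < d * e / 2"
      using d by (intro order_tendstoD(2)[OF p(2)]) simp
    then obtain N where N: "\<And>n. n \<ge> N \<Longrightarrow> L2_norm M (\<lambda>x. p n x - f x) < d * e / 2"
      by (auto simp: eventually_sequentially)
    have "L2_norm M (\<lambda>x. u m x - u n x) < e" if "m \<ge> N" "n \<ge> N" for m n
    proof -
      have "d * L2_norm M (\<lambda>x. u m x - u n x) < d * e"
        using le[of m n] N[OF that(1)] N[OF that(2)] by linarith
      then show ?thesis using d by simp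
    qed
    then show "\<exists>N. \<forall>m\<ge>N. \<forall>n\<ge>N. L2_norm M (\<lambda>x. u m x - u n x) < e" by blast
  qed simp
  then obtain w where w: "w \<in> L2 M" "(\<lambda>n. L2_norm M (\<lambda>x. u n x - w x)) \<longlonglongrightarrow> 0" by blast
  have "(\<lambda>n. L2_norm M (\<lambda>x. v n x - (f x + z * w x))) \<longlonglongrightarrow> 0"
  proof (rule tendsto_sandwich[OF _ _ tendsto_const])
    show "(\<lambda>n. L2_norm M (\<lambda>x. p n x - f x) + cmod z * L2_norm M (\<lambda>x. u n x - w x)) \<longlonglongrightarrow> 0"
      using tendsto_add[OF p(2) tendsto_mult_left[OF w(2)]] by simp
    have "L2_norm M (\<lambda>x. v n x - (f x + z * w x))
        \<le> L2_norm M (\<lambda>x. p n x - f x) + cmod z * L2_norm M (\<lambda>x. u n x - w x)" for n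
    proof -
      have "L2_norm M (\<lambda>x. v n x - (f x + z * w x)) = L2_norm M (\<lambda>x. (p n x - f x) + z * (u n x - w x))"
      proof (rule L2_norm_cong_AE)
        show "AE x in M. v n x - (f x + z * w x) = (p n x - f x) + z * (u n x - w x)"
          using AE[of n]
        proof eventually_elim
          case (elim x)
          then show ?case unfolding elim[symmetric] by (simp add: algebra_simps)
        qed
      qed (auto intro!: L2_measurable L2_diff L2_scale L2_add f w)
      also have "\<dots> \<le> L2_norm M (\<lambda>x. p n x - f x) + L2_norm M (\<lambda>x. z * (u n x - w x))"
        by (intro L2_norm_triangle L2_scale L2_diff f w) auto
      finally show ?thesis by (simp add: L2_norm_scale)
    qed
    then show "\<forall>\<^sub>F n in sequentially. L2_norm M (\<lambda>x. v n x - (f x + z * w x))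
        \<le> L2_norm M (\<lambda>x. p n x - f x) + cmod z * L2_norm M (\<lambda>x. u n x - w x)" by simp
  qed simp
  with that[OF g w] show thesis .
qed

lemma shifted_range_closure_operator:
  assumes d: "d > 0" "\<And>\<mu>. \<mu> \<in> eigenvalues \<Longrightarrow> d \<le> cmod (complex_of_real \<mu> - z)"
  shows "shifted_range closure_operator z = L2 M"
proof
  show "shifted_range closure_operator z \<subseteq> L2 M"
    using closure_operator_L2 by (auto simp: shifted_range_def intro!: L2_diff L2_scale)
  show "L2 M \<subseteq> shifted_range closure_operator z"
  proof
    fix f assume f: "f \<in> L2 M"
    obtain u v w where uv: "\<And>n. (u n, v n) \<in> graph" "w \<in> L2 M"
      "(\<lambda>n. L2_norm M (\<lambda>x. u n x - w x)) \<longlonglongrightarrow> 0"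
      "(\<lambda>n. L2_norm M (\<lambda>x. v n x - (f x + z * w x))) \<longlonglongrightarrow> 0"
      by (rule closure_operator_surj[OF f d], assumption, rule that)
    have "(w, \<lambda>x. f x + z * w x) \<in> closure_operator"
      by (rule closure_operator_limit[OF uv(1,2) _ uv(3,4)]) (intro L2_add L2_scale f uv)
    then show "f \<in> shifted_range closure_operator z"
      unfolding shifted_range_def by force
  qed
qed

end

text \<open>Discreteness is stated as a gap around every complex number, in the form in which the lower
  bound uses it. At \<open>0\<close>, which is no eigenvalue, it makes the operator invertible.\<close>

locale negative_eigenspaces = complete_eigenspaces +
  assumes negative: "\<And>\<mu>. \<mu> \<in> eigenvalues \<Longrightarrow> \<mu> < 0"
    and discrete: "\<And>z. \<exists>d>0. \<forall>\<mu>\<in>eigenvalues. complex_of_real \<mu> \<noteq> z \<longrightarrow> d \<le> cmod (complex_of_real \<mu> - z)"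
begin

text \<open>
  With eigenvalues bounded away from \<open>0\<close> the adjoint of the diagonal operator is its closure:
  if \<open>(u, w)\<close> lies in the adjoint, solve the equation with right-hand side \<open>w\<close> by an element of
  the closure; its argument agrees with \<open>u\<close> on the (dense) range, hence almost everywhere.
\<close>

lemma closure_operator_approx:
  assumes uw: "(u, w) \<in> closure_operator"
  obtains f g where "\<And>n. (f n, g n) \<in> graph"
    "(\<lambda>n. L2_norm M (\<lambda>x. f n x - u x)) \<longlonglongrightarrow> 0" "(\<lambda>n. L2_norm M (\<lambda>x. g n x - w x)) \<longlonglongrightarrow> 0"
proof -
  note [simp] = conjunct1[OF closure_operator_L2[OF uw]] conjunct2[OF closure_operator_L2[OF uw]]
  obtain d where "d > 0" and d0: "\<forall>\<mu>\<in>eigenvalues. complex_of_real \<mu> \<noteq> 0 \<longrightarrow> d \<le> cmod (complex_of_real \<mu> - 0)"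
    using discrete[of 0] by blast
  have d: "d > 0" "d \<le> cmod (complex_of_real \<mu> - 0)" if "\<mu> \<in> eigenvalues" for \<mu>
    using \<open>d > 0\<close> d0 negative[OF that] that by auto
  obtain f g v where fg: "\<And>n. (f n, g n) \<in> graph" "v \<in> L2 M"
    "(\<lambda>n. L2_norm M (\<lambda>x. f n x - v x)) \<longlonglongrightarrow> 0" "(\<lambda>n. L2_norm M (\<lambda>x. g n x - (w x + 0 * v x))) \<longlonglongrightarrow> 0"
    by (rule closure_operator_surj[OF \<open>w \<in> L2 M\<close> \<open>d > 0\<close> d(2)], assumption, rule that)
  have vw: "(v, w) \<in> closure_operator"
    by (rule closure_operator_limit[OF fg(1,2) _ fg(3)]) (use fg(4) in auto)
  have "AE x in M. u x - v x = 0"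
  proof (rule orthogonal_to_graph_imp_zero)
    show "(\<lambda>x. u x - v x) \<in> L2 M" using fg by (intro L2_diff) auto
    fix p q assume pq: "(p, q) \<in> graph"
    have "complex_of_real \<mu> \<noteq> 0" if "\<mu> \<in> eigenvalues" for \<mu> using negative[OF that] by simp
    then obtain r s where rs: "(r, s) \<in> graph" "AE x in M. s x - 0 * r x = p x"
      using graph_resolvent[OF pq] by blast
    have "L2_inner M p (\<lambda>x. u x - v x) = L2_inner M s (\<lambda>x. u x - v x)"
      using rs graph_L2[OF rs(1)] graph_L2[OF pq] fg(2)
      by (intro L2_inner_cong_AE) (auto intro!: L2_measurable L2_diff)
    also have "\<dots> = 0"
      using closure_operatorD[OF uw rs(1)] closure_operatorD[OF vw rs(1)] graph_L2[OF rs(1)] fg(2)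
      by (simp add: L2_inner_diff_right)
    finally show "L2_inner M p (\<lambda>x. u x - v x) = 0" .
  qed
  then have "L2_norm M (\<lambda>x. f n x - u x) = L2_norm M (\<lambda>x. f n x - v x)" for n
    using graph_L2[OF fg(1)] fg(2)
    by (intro L2_norm_cong_AE) (auto intro!: L2_measurable L2_diff)
  with fg show thesis by (intro that[of f g]) auto
qed

text \<open>Symmetry passes from the graph to limits of its elements.\<close>

lemma closure_operator_symmetric:
  assumes "(u, w) \<in> closure_operator" "(u', w') \<in> closure_operator"
  shows "L2_inner M w u' = L2_inner M u w'"
proof -
  obtain f g where fg: "\<And>n. (f n, g n) \<in> graph"
    "(\<lambda>n. L2_norm M (\<lambda>x. f n x - u x)) \<longlonglongrightarrow> 0" "(\<lambda>n. L2_norm M (\<lambda>x. g n x - w x)) \<longlonglongrightarrow> 0"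
    by (rule closure_operator_approx[OF assms(1)]) (rule that)
  have "(\<lambda>n. L2_inner M (g n) u') \<longlonglongrightarrow> L2_inner M w u'"
    using closure_operator_L2[OF assms(1)] closure_operator_L2[OF assms(2)] graph_L2[OF fg(1)]
    by (intro L2_inner_tendsto fg) auto
  moreover have "(\<lambda>n. L2_inner M (f n) w') \<longlonglongrightarrow> L2_inner M u w'"
    using closure_operator_L2[OF assms(1)] closure_operator_L2[OF assms(2)] graph_L2[OF fg(1)]
    by (intro L2_inner_tendsto fg) auto
  ultimately show ?thesis
    using closure_operatorD[OF assms(2) fg(1)] LIMSEQ_unique by auto
qed

lemma L2_operator_closure_operator: "L2_operator M closure_operator"
proof -
  have wd: "AE x in M. g x = g' x" if "(f, g) \<in> closure_operator" "(f, g') \<in> closure_operator" for f g g'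
  proof -
    have L: "g \<in> L2 M" "g' \<in> L2 M" using that closure_operator_L2 by auto
    have "AE x in M. g x - g' x = 0"
    proof (rule orthogonal_to_graph_imp_zero)
      fix p q assume pq: "(p, q) \<in> graph"
      show "L2_inner M p (\<lambda>x. g x - g' x) = 0"
        using closure_operatorD[OF that(1) pq] closure_operatorD[OF that(2) pq] graph_L2[OF pq] L
        by (simp add: L2_inner_diff_right)
    qed (intro L2_diff L)
    then show ?thesis by simp
  qed
  have cong: "(f', g') \<in> closure_operator"
    if "(f, g) \<in> closure_operator" and L: "f' \<in> L2 M" "g' \<in> L2 M"
      and AE: "AE x in M. f' x = f x" "AE x in M. g' x = g x" for f g f' g'
  proof -
    have "L2_inner M q f' = L2_inner M p g'" if pq: "(p, q) \<in> graph" for p q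
    proof -
      have "L2_inner M q f' = L2_inner M q f" "L2_inner M p g' = L2_inner M p g"
        using AE L graph_L2[OF pq] closure_operator_L2[OF \<open>(f, g) \<in> closure_operator\<close>]
        by (auto intro!: L2_inner_cong_AE L2_measurable)
      with closure_operatorD[OF \<open>(f, g) \<in> closure_operator\<close> pq] show ?thesis by simp
    qed
    with L show ?thesis by (auto simp: closure_operator_def L2_adjoint_def)
  qed
  have zero: "((\<lambda>x. 0), (\<lambda>x. 0)) \<in> closure_operator"
    by (auto simp: closure_operator_def L2_adjoint_def L2_inner_def)
  have add: "((\<lambda>x. f x + f' x), (\<lambda>x. g x + g' x)) \<in> closure_operator"
    if "(f, g) \<in> closure_operator" "(f', g') \<in> closure_operator" for f g f' g'
  proof -
    have L: "f \<in> L2 M" "g \<in> L2 M" "f' \<in> L2 M" "g' \<in> L2 M"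
      using that closure_operator_L2 by auto
    have "L2_inner M q (\<lambda>x. f x + f' x) = L2_inner M p (\<lambda>x. g x + g' x)" if "(p, q) \<in> graph" for p q
      using closure_operatorD[OF \<open>(f, g) \<in> closure_operator\<close> that]
        closure_operatorD[OF \<open>(f', g') \<in> closure_operator\<close> that] graph_L2[OF that] L
      by (simp add: L2_inner_add_right)
    with L show ?thesis by (auto simp: closure_operator_def L2_adjoint_def intro!: L2_add)
  qed
  have scale: "((\<lambda>x. c * f x), (\<lambda>x. c * g x)) \<in> closure_operator"
    if "(f, g) \<in> closure_operator" for f g c
    using that by (auto simp: closure_operator_def L2_adjoint_def L2_inner_scale_right
      intro!: L2_scale)
  show ?thesis
    unfolding L2_operator_def
  proof (intro conjI)
    show "closure_operator \<subseteq> L2 M \<times> L2 M" using closure_operator_L2 by auto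
  qed (rule zero, use add in blast, use scale in blast, use cong in blast, use wd in blast)
qed

lemma self_adjoint_closure_operator: "self_adjoint M closure_operator"
proof -
  have "L2_adjoint M closure_operator = closure_operator"
  proof
    have "L2_adjoint M closure_operator \<subseteq> L2_adjoint M graph"
      by (rule L2_adjoint_antimono[OF graph_subset_closure_operator])
    then show "L2_adjoint M closure_operator \<subseteq> closure_operator"
      by (simp only: closure_operator_def)
    show "closure_operator \<subseteq> L2_adjoint M closure_operator"
    proof clarify
      fix u w assume uw: "(u, w) \<in> closure_operator"
      then have "u \<in> L2 M" "w \<in> L2 M" using closure_operator_L2 by blast+
      then show "(u, w) \<in> L2_adjoint M closure_operator"
        by (rule L2_adjointI) (rule closure_operator_symmetric[OF _ uw])
    qed
  qed
  moreover have "L2_dense M (Domain closure_operator)"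
    unfolding L2_dense_def
  proof (intro conjI ballI allI impI)
    show "Domain closure_operator \<subseteq> L2 M" by (auto dest: closure_operator_L2)
    fix f :: "'a \<Rightarrow> complex" and e :: real assume "f \<in> L2 M" "e > 0"
    with dense have "\<exists>u\<in>Domain graph. L2_norm M (\<lambda>x. f x - u x) < e"
      by (simp only: L2_dense_def)
    then obtain u where u: "u \<in> Domain graph" "L2_norm M (\<lambda>x. f x - u x) < e" by (rule bexE)
    have "u \<in> Domain closure_operator"
      by (rule subsetD[OF Domain_mono[OF graph_subset_closure_operator] u(1)])
    with u(2) show "\<exists>u\<in>Domain closure_operator. L2_norm M (\<lambda>x. f x - u x) < e" by (rule bexI)
  qed
  ultimately show ?thesis
    unfolding self_adjoint_def by (intro conjI L2_operator_closure_operator)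
qed

text \<open>Self-adjoint operators have no proper self-adjoint extensions.\<close>

lemma self_adjoint_extension_unique:
  assumes A: "self_adjoint M A"
    and ext: "\<And>f g. (f, g) \<in> graph \<Longrightarrow> \<exists>g'. (f, g') \<in> A \<and> (AE x in M. g' x = g x)"
  shows "A = closure_operator"
proof -
  have sub: "graph \<subseteq> A"
  proof (clarify)
    fix f g assume fg: "(f, g) \<in> graph"
    obtain g' where g': "(f, g') \<in> A" "AE x in M. g' x = g x"
      using ext[OF fg] by blast
    then have AE: "AE x in M. g x = g' x" by (auto elim: eventually_mono)
    have "\<forall>f g f' g'. (f, g) \<in> A \<longrightarrow> f' \<in> L2 M \<longrightarrow> g' \<in> L2 M \<longrightarrow>
        (AE x in M. f' x = f x) \<longrightarrow> (AE x in M. g' x = g x) \<longrightarrow> (f', g') \<in> A"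
      using A unfolding self_adjoint_def L2_operator_def by blast
    from this[rule_format, OF g'(1) _ _ _ AE] graph_L2[OF fg] show "(f, g) \<in> A" by simp
  qed
  have eqs: "L2_adjoint M A = A" "L2_adjoint M closure_operator = closure_operator"
    using A self_adjoint_closure_operator unfolding self_adjoint_def by blast+
  have le: "A \<subseteq> closure_operator"
    using L2_adjoint_antimono[OF sub, of M] unfolding eqs(1) closure_operator_def .
  then show ?thesis using L2_adjoint_antimono[OF le, of M] unfolding eqs by (rule equalityI)
qed

text \<open>The lower bound passes to limits of elements of the graph, so an eigenvector of the closure for a
  number outside \<open>eigenvalues\<close> has norm \<open>0\<close>.\<close>

lemma point_spectrum_closure_operator:
  "point_spectrum M closure_operator = complex_of_real ` eigenvalues"
proof
  show "complex_of_real ` eigenvalues \<subseteq> point_spectrum M closure_operator"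
  proof clarify
    fix \<mu> assume "\<mu> \<in> eigenvalues"
    then obtain f where f: "f \<in> E \<mu>" "\<not> (AE x in M. f x = 0)" unfolding eigenvalues_def by blast
    have "(f, \<lambda>x. complex_of_real \<mu> * f x) \<in> graph"
      unfolding graph_def mem_Collect_eq
      by (rule exI[of _ "{\<mu>}"], rule exI[of _ "\<lambda>\<nu>. if \<nu> = \<mu> then f else (\<lambda>x. 0)"])
        (use f E_zero in auto)
    then have "(f, \<lambda>x. complex_of_real \<mu> * f x) \<in> closure_operator"
      by (rule subsetD[OF graph_subset_closure_operator])
    then show "complex_of_real \<mu> \<in> point_spectrum M closure_operator"
      unfolding point_spectrum_def by (intro CollectI exI[of _ f] conjI f(2))
  qed
  show "point_spectrum M closure_operator \<subseteq> complex_of_real ` eigenvalues"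
  proof (rule subsetI, rule ccontr)
    fix z assume z: "z \<in> point_spectrum M closure_operator" "z \<notin> complex_of_real ` eigenvalues"
    obtain d where "d > 0" and d0: "\<forall>\<mu>\<in>eigenvalues. complex_of_real \<mu> \<noteq> z \<longrightarrow> d \<le> cmod (complex_of_real \<mu> - z)"
      using discrete[of z] by blast
    have d: "d > 0" "\<And>\<mu>. \<mu> \<in> eigenvalues \<Longrightarrow> d \<le> cmod (complex_of_real \<mu> - z)"
      using \<open>d > 0\<close> d0 z(2) by auto
    obtain u where u: "(u, \<lambda>x. z * u x) \<in> closure_operator" "\<not> (AE x in M. u x = 0)"
      using z(1) unfolding point_spectrum_def mem_Collect_eq by (elim exE conjE)
    obtain f g where fg: "\<And>n. (f n, g n) \<in> graph"
      "(\<lambda>n. L2_norm M (\<lambda>x. f n x - u x)) \<longlonglongrightarrow> 0" "(\<lambda>n. L2_norm M (\<lambda>x. g n x - z * u x)) \<longlonglongrightarrow> 0"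
      by (rule closure_operator_approx[OF u(1)]) (rule that)
    have L[simp]: "u \<in> L2 M" "f n \<in> L2 M" "g n \<in> L2 M" for n
      using graph_L2[OF fg(1)] closure_operator_L2[OF u(1)] by auto
    have "d * L2_norm M (f n)
        \<le> L2_norm M (\<lambda>x. g n x - z * u x) + cmod z * L2_norm M (\<lambda>x. f n x - u x)" for n
    proof -
      have "d * L2_norm M (f n) \<le> L2_norm M (\<lambda>x. g n x - z * f n x)"
        by (rule graph_lower_bound[OF fg(1) d])
      also have "\<dots> \<le> L2_norm M (\<lambda>x. g n x - z * u x) + L2_norm M (\<lambda>x. z * u x - z * f n x)"
        by (intro L2_norm_triangle_diff L2_scale) auto
      also have "L2_norm M (\<lambda>x. z * u x - z * f n x) = cmod z * L2_norm M (\<lambda>x. f n x - u x)"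
        using L2_norm_scale[of M z "\<lambda>x. u x - f n x"]
        by (simp add: right_diff_distrib L2_norm_minus_commute[of M u])
      finally show ?thesis .
    qed
    moreover have "(\<lambda>n. d * L2_norm M (f n)) \<longlonglongrightarrow> d * L2_norm M u"
      by (intro tendsto_mult_left L2_norm_tendsto fg) auto
    moreover have "(\<lambda>n. L2_norm M (\<lambda>x. g n x - z * u x) + cmod z * L2_norm M (\<lambda>x. f n x - u x)) \<longlonglongrightarrow> 0"
      using tendsto_add[OF fg(3) tendsto_mult_left[OF fg(2)]] by simp
    ultimately have "d * L2_norm M u \<le> 0" by (intro LIMSEQ_le) auto
    then have "L2_norm M u = 0" using d(1) L2_norm_nonneg[of M u] by (simp add: mult_le_0_iff)
    then show False using L2_norm_eq_0[OF L(1)] u(2) by simp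
  qed
qed

text \<open>Outside the eigenvalues the discreteness gap makes the shifted operator surjective, so nothing
  is left for the continuous spectrum.\<close>

theorem spectrum_closure_operator:
  "continuous_spectrum M closure_operator = {}"
  "\<forall>z\<in>point_spectrum M closure_operator. z \<in> \<real> \<and> Re z < 0"
proof -
  have "shifted_range closure_operator z = L2 M" if z: "z \<notin> complex_of_real ` eigenvalues" for z
  proof -
    obtain d where "d > 0" and d0: "\<forall>\<mu>\<in>eigenvalues. complex_of_real \<mu> \<noteq> z \<longrightarrow> d \<le> cmod (complex_of_real \<mu> - z)"
      using discrete[of z] by blast
    have d: "d > 0" "\<And>\<mu>. \<mu> \<in> eigenvalues \<Longrightarrow> d \<le> cmod (complex_of_real \<mu> - z)"
      using \<open>d > 0\<close> d0 z by auto
    from d show ?thesis by (rule shifted_range_closure_operator)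
  qed
  then show "continuous_spectrum M closure_operator = {}"
    unfolding continuous_spectrum_def point_spectrum_closure_operator by auto
  show "\<forall>z\<in>point_spectrum M closure_operator. z \<in> \<real> \<and> Re z < 0"
    unfolding point_spectrum_closure_operator using negative by auto
qed

end

section \<open>Integrals of directional derivatives, reflections and polar coordinates\<close>

lemma cball_in_borel[measurable]: "cball (a::'a::metric_space) r \<in> sets borel"
  by simp

lemma nn_integral_lborel_translate:
  fixes f :: "'a::euclidean_space \<Rightarrow> ennreal"
  assumes [measurable]: "f \<in> borel_measurable borel"
  shows "(\<integral>\<^sup>+x. f (x + c) \<partial>lborel) = (\<integral>\<^sup>+x. f x \<partial>lborel)"
  by (subst (2) lborel_distr_plus[of c, symmetric], subst nn_integral_distr) (auto simp: add.commute)

lemma has_bochner_integral_lborel_translate: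
  fixes f :: "'a::euclidean_space \<Rightarrow> 'b::{banach, second_countable_topology}"
  assumes "integrable lborel f"
  shows "integrable lborel (\<lambda>x. f (x + c))" "(LINT x|lborel. f (x + c)) = (LINT x|lborel. f x)"
proof -
  have [measurable]: "f \<in> borel_measurable borel" using borel_measurable_integrable[OF assms] by simp
  show "integrable lborel (\<lambda>x. f (x + c))"
    using assms by (subst (asm) lborel_distr_plus[of c, symmetric], subst (asm) integrable_distr_eq)
      (auto simp: add.commute)
  show "(LINT x|lborel. f (x + c)) = (LINT x|lborel. f x)"
    by (subst (2) lborel_distr_plus[of c, symmetric], subst integral_distr) (auto simp: add.commute)
qed

text \<open>
  The increments \<open>u (x + \<xi>) - u x\<close> have vanishing integral by translation invariance, and they are
  the integrals of the derivative over unit segments; averaging over the segments does not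
  change the integral of the derivative. Exceptional points on the segments are harmless because
  \<open>u\<close> is continuous.
\<close>

lemma integral_directional_derivative_eq_0:
  fixes u v :: "'a::euclidean_space \<Rightarrow> complex"
  assumes u: "integrable lborel u" "continuous_on UNIV u" and v: "integrable lborel v"
    and deriv: "AE x in lborel. \<exists>S. finite S \<and>
      (\<forall>t\<in>{0<..<1} - S. ((\<lambda>t. u (x + t *\<^sub>R \<xi>)) has_vector_derivative v (x + t *\<^sub>R \<xi>)) (at t))"
  shows "(LINT x|lborel. v x) = 0"
proof -
  have [measurable]: "v \<in> borel_measurable borel" using borel_measurable_integrable[OF v] by simp
  define f where "f t x = indicator {0..1::real} t *\<^sub>R v (x + t *\<^sub>R \<xi>)" for t x
  have m[measurable]: "case_prod f \<in> borel_measurable (lborel \<Otimes>\<^sub>M lborel)"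
    unfolding f_def by measurable
  have it: "(\<integral>\<^sup>+x. ennreal (norm (f t x)) \<partial>lborel)
      = indicator {0..1} t * (\<integral>\<^sup>+x. ennreal (norm (v x)) \<partial>lborel)" for t
    using nn_integral_lborel_translate[of "\<lambda>x. ennreal (norm (v x))" "t *\<^sub>R \<xi>"]
    by (auto simp: f_def indicator_def)
  have int: "integrable (lborel \<Otimes>\<^sub>M lborel) (case_prod f)"
  proof (rule integrableI_bounded)
    have "(\<integral>\<^sup>+z. ennreal (norm (case_prod f z)) \<partial>(lborel \<Otimes>\<^sub>M lborel))
        = (\<integral>\<^sup>+t. \<integral>\<^sup>+x. ennreal (norm (f t x)) \<partial>lborel \<partial>lborel)"
      by (subst lborel.nn_integral_fst[symmetric]) auto
    also have "\<dots> = (\<integral>\<^sup>+x. ennreal (norm (v x)) \<partial>lborel)"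
      unfolding it by (simp add: nn_integral_multc)
    also have "\<dots> < \<infinity>" using v by (simp add: integrable_iff_bounded)
    finally show "(\<integral>\<^sup>+z. ennreal (norm (case_prod f z)) \<partial>(lborel \<Otimes>\<^sub>M lborel)) < \<infinity>" .
  qed simp
  have "(LINT x|lborel. u (x + \<xi>) - u x) = (LINT x|lborel. LINT t|lborel. f t x)"
  proof (rule integral_cong_AE)
    show "AE x in lborel. u (x + \<xi>) - u x = (LINT t|lborel. f t x)"
      using deriv lborel_pair.AE_integrable_snd[OF int]
    proof eventually_elim
      case (elim x)
      then obtain S where S: "finite S" "\<And>t. t \<in> {0<..<1} - S \<Longrightarrow>
          ((\<lambda>t. u (x + t *\<^sub>R \<xi>)) has_vector_derivative v (x + t *\<^sub>R \<xi>)) (at t)" by blast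
      have "((\<lambda>t. v (x + t *\<^sub>R \<xi>)) has_integral (u (x + 1 *\<^sub>R \<xi>) - u (x + 0 *\<^sub>R \<xi>))) {0..1}"
        by (rule fundamental_theorem_of_calculus_interior_strong[OF S(1) _ S(2)])
          (auto intro!: continuous_intros continuous_on_compose2[OF u(2)])
      then have "((\<lambda>t. if t \<in> {0..1} then v (x + t *\<^sub>R \<xi>) else 0) has_integral (u (x + \<xi>) - u x)) UNIV"
        unfolding has_integral_restrict_UNIV by simp
      moreover have "(\<lambda>t. if t \<in> {0..1} then v (x + t *\<^sub>R \<xi>) else 0) = (\<lambda>t. f t x)"
        by (auto simp: f_def)
      ultimately have "((\<lambda>t. f t x) has_integral (u (x + \<xi>) - u x)) UNIV" by simp
      with has_integral_integral_lborel[OF elim(2)] show ?case by (blast intro: has_integral_unique)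
    qed
    have "u \<in> borel_measurable borel" using borel_measurable_integrable[OF u(1)] by simp
    then show "(\<lambda>x. u (x + \<xi>) - u x) \<in> borel_measurable lborel" by measurable
    show "(\<lambda>x. LINT t|lborel. f t x) \<in> borel_measurable lborel"
      unfolding f_def by measurable
  qed
  also have "\<dots> = (LINT t|lborel. LINT x|lborel. f t x)"
    by (rule lborel_pair.Fubini_integral[OF int])
  also have "\<dots> = (LINT t|lborel. indicator {0..1::real} t *\<^sub>R (LINT x|lborel. v x))"
    using has_bochner_integral_lborel_translate(2)[OF v] by (simp add: f_def)
  also have "\<dots> = (LINT x|lborel. v x)" by simp
  finally show ?thesis
    using has_bochner_integral_lborel_translate[OF u(1), of \<xi>] u(1) by simp
qed

text \<open>The bound is the increment of the antiderivative \<open>sgn y \<bar>y\<bar>^(s+1) / (s+1)\<close>. Exponents in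
  \<open>(-1, 0)\<close> occur for the weight divided by a linear form when a multiplicity lies in \<open>(0, 1/2)\<close>.\<close>

lemma nn_integral_abs_affine_powr:
  fixes b c s :: real
  assumes "s > -1" "b > 0"
  shows "(\<integral>\<^sup>+t. indicator {0..1} t * ennreal (\<bar>c + t * b\<bar> powr s) \<partial>lborel)
    \<le> ennreal (2 * (\<bar>c\<bar> + b) powr (s + 1) / ((s + 1) * b))"
proof -
  define G where "G y = sgn y * \<bar>y\<bar> powr (s + 1) / (s + 1)" for y :: real
  have Gpos: "G = (\<lambda>y. if y \<le> 0 then - ((-y) powr (s + 1) / (s + 1)) else y powr (s + 1) / (s + 1))"
    by (rule ext) (auto simp: G_def sgn_if)
  have cont: "continuous_on UNIV G"
  proof -
    have "continuous_on ({..0} \<union> {0..}) G"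
      unfolding Gpos using assms(1)
      by (intro continuous_on_cases closed_atMost closed_atLeast continuous_intros continuous_on_powr') auto
    moreover have "{..0} \<union> {0..} = (UNIV :: real set)" by auto
    ultimately show ?thesis by simp
  qed
  have deriv: "(G has_real_derivative \<bar>y\<bar> powr s) (at y)" if "y \<noteq> 0" for y
  proof (cases "y > 0")
    case True
    have "((\<lambda>y. y powr (s + 1) / (s + 1)) has_real_derivative \<bar>y\<bar> powr s) (at y)"
      using True assms(1) by (auto intro!: derivative_eq_intros)
    then show ?thesis
      by (rule has_field_derivative_transform_within_open[of _ _ _ "{0<..}"]) (use True in \<open>auto simp: G_def\<close>)
  next
    case False
    then have y: "y < 0" using that by simp
    have "((\<lambda>y. - ((-y) powr (s + 1) / (s + 1))) has_real_derivative \<bar>y\<bar> powr s) (at y)"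
      using y assms(1) by (auto intro!: derivative_eq_intros)
    then show ?thesis
      by (rule has_field_derivative_transform_within_open[of _ _ _ "{..<0}"]) (use y in \<open>auto simp: G_def\<close>)
  qed
  have "((\<lambda>t. \<bar>c + t * b\<bar> powr s) has_integral (G (c + 1 * b) / b - G (c + 0 * b) / b)) {0..1}"
  proof (rule fundamental_theorem_of_calculus_interior_strong[of "{- c / b}" _ _ "\<lambda>t. G (c + t * b) / b"])
    fix t assume "t \<in> {0<..<1} - {- c / b}"
    then have "c + t * b \<noteq> 0" using assms(2) by (auto simp: field_simps eq_neg_iff_add_eq_0 add.commute)
    then have "((\<lambda>t. G (c + t * b) / b) has_real_derivative \<bar>c + t * b\<bar> powr s) (at t)"
      using assms(2) by (auto intro!: derivative_eq_intros DERIV_chain'[of _ b _ _ G] deriv)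
    then show "((\<lambda>t. G (c + t * b) / b) has_vector_derivative \<bar>c + t * b\<bar> powr s) (at t)"
      by (simp add: has_real_derivative_iff_has_vector_derivative)
  next
    show "continuous_on {0..1} (\<lambda>t. G (c + t * b) / b)"
      using assms(2) by (auto intro!: continuous_intros continuous_on_compose2[OF cont])
  qed auto
  then have "((\<lambda>t. if t \<in> {0..1} then \<bar>c + t * b\<bar> powr s else 0) has_integral ((G (c + b) - G c) / b)) UNIV"
    unfolding has_integral_restrict_UNIV by (simp add: diff_divide_distrib)
  moreover have "(\<lambda>t. if t \<in> {0..1} then \<bar>c + t * b\<bar> powr s else 0)
      = (\<lambda>t. indicator {0..1} t * \<bar>c + t * b\<bar> powr s)"
    by (auto simp: indicator_def)
  ultimately have "((\<lambda>t. indicator {0..1} t * \<bar>c + t * b\<bar> powr s) has_integral ((G (c + b) - G c) / b)) UNIV"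
    by simp
  then have "(\<integral>\<^sup>+t. ennreal (indicator {0..1} t * \<bar>c + t * b\<bar> powr s) \<partial>lborel) = ennreal ((G (c + b) - G c) / b)"
    by (intro nn_integral_has_integral_lborel) auto
  also have "\<dots> \<le> ennreal (2 * (\<bar>c\<bar> + b) powr (s + 1) / ((s + 1) * b))"
  proof (rule ennreal_leI)
    have "\<bar>G y\<bar> \<le> (\<bar>c\<bar> + b) powr (s + 1) / (s + 1)" if "\<bar>y\<bar> \<le> \<bar>c\<bar> + b" for y
    proof -
      have "\<bar>G y\<bar> \<le> \<bar>y\<bar> powr (s + 1) / (s + 1)"
        using assms(1) by (auto simp: G_def abs_mult abs_sgn_eq)
      also have "\<dots> \<le> (\<bar>c\<bar> + b) powr (s + 1) / (s + 1)"
        using that assms by (intro divide_right_mono powr_mono2) auto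
      finally show ?thesis .
    qed
    from this[of "c + b"] this[of c] have "\<bar>G (c + b)\<bar> \<le> (\<bar>c\<bar> + b) powr (s + 1) / (s + 1)"
      "\<bar>G c\<bar> \<le> (\<bar>c\<bar> + b) powr (s + 1) / (s + 1)"
      using assms(2) abs_triangle_ineq[of c b] by simp_all
    then have "G (c + b) - G c \<le> 2 * ((\<bar>c\<bar> + b) powr (s + 1) / (s + 1))"
      by linarith
    then have "(G (c + b) - G c) / b \<le> 2 * ((\<bar>c\<bar> + b) powr (s + 1) / (s + 1)) / b"
      using assms(2) by (intro divide_right_mono) auto
    then show "(G (c + b) - G c) / b \<le> 2 * (\<bar>c\<bar> + b) powr (s + 1) / ((s + 1) * b)" by simp
  qed
  finally show ?thesis by (simp add: ennreal_mult ennreal_indicator[symmetric] del: ennreal_indicator)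
qed

text \<open>Averaging over unit segments in direction \<open>\<alpha>\<close> reduces the claim to dimension one.\<close>

lemma nn_integral_abs_inner_powr_finite:
  fixes \<alpha> :: "'a::euclidean_space"
  assumes "s > -1" "\<alpha> \<noteq> 0"
  shows "(\<integral>\<^sup>+x. indicator (cball 0 r) x * ennreal (\<bar>\<alpha> \<bullet> x\<bar> powr s) \<partial>lborel) < \<infinity>"
proof -
  define g where "g x = indicator (cball 0 r) x * ennreal (\<bar>\<alpha> \<bullet> x\<bar> powr s)" for x :: 'a
  have [measurable]: "(\<lambda>x. \<bar>\<alpha> \<bullet> x\<bar> powr s) \<in> borel_measurable borel" by simp
  have [measurable]: "g \<in> borel_measurable borel" unfolding g_def by measurable
  define b where "b = \<alpha> \<bullet> \<alpha>"
  have b: "b > 0" using assms(2) by (simp add: b_def)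
  define \<rho> where "\<rho> = r + norm \<alpha>"
  define K where "K = 2 * (norm \<alpha> * \<rho> + b) powr (s + 1) / ((s + 1) * b)"
  have "(\<integral>\<^sup>+x. g x \<partial>lborel) = (\<integral>\<^sup>+t. indicator {0..1::real} t * (\<integral>\<^sup>+x. g x \<partial>lborel) \<partial>lborel)"
    by (simp add: nn_integral_multc)
  also have "\<dots> = (\<integral>\<^sup>+t. indicator {0..1::real} t * (\<integral>\<^sup>+x. g (x + t *\<^sub>R \<alpha>) \<partial>lborel) \<partial>lborel)"
    by (simp add: nn_integral_lborel_translate)
  also have "\<dots> = (\<integral>\<^sup>+t. \<integral>\<^sup>+x. indicator {0..1::real} t * g (x + t *\<^sub>R \<alpha>) \<partial>lborel \<partial>lborel)"
    by (simp add: nn_integral_cmult)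
  also have "\<dots> = (\<integral>\<^sup>+x. \<integral>\<^sup>+t. indicator {0..1::real} t * g (x + t *\<^sub>R \<alpha>) \<partial>lborel \<partial>lborel)"
    by (rule lborel_pair.Fubini') measurable
  also have "\<dots> \<le> (\<integral>\<^sup>+x. indicator (cball (0::'a) \<rho>) x * ennreal K \<partial>lborel)"
  proof (rule nn_integral_mono)
    fix x :: 'a
    show "(\<integral>\<^sup>+t. indicator {0..1::real} t * g (x + t *\<^sub>R \<alpha>) \<partial>lborel) \<le> indicator (cball 0 \<rho>) x * ennreal K"
    proof (cases "norm x \<le> \<rho>")
      case True
      have "(\<integral>\<^sup>+t. indicator {0..1::real} t * g (x + t *\<^sub>R \<alpha>) \<partial>lborel)
          \<le> (\<integral>\<^sup>+t. indicator {0..1} t * ennreal (\<bar>\<alpha> \<bullet> x + t * b\<bar> powr s) \<partial>lborel)"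
        by (intro nn_integral_mono) (auto simp: g_def b_def inner_add_right indicator_def)
      also have "\<dots> \<le> ennreal (2 * (\<bar>\<alpha> \<bullet> x\<bar> + b) powr (s + 1) / ((s + 1) * b))"
        by (rule nn_integral_abs_affine_powr[OF assms(1) b])
      also have "\<dots> \<le> ennreal K"
      proof -
        have "\<bar>\<alpha> \<bullet> x\<bar> \<le> norm \<alpha> * \<rho>"
          using Cauchy_Schwarz_ineq2[of \<alpha> x] mult_left_mono[OF True norm_ge_zero[of \<alpha>]] by linarith
        then show ?thesis
          unfolding K_def using assms(1) b
          by (intro ennreal_leI divide_right_mono mult_left_mono powr_mono2) auto
      qed
      finally show ?thesis using True by simp
    next
      case False
      have "indicator {0..1} t * g (x + t *\<^sub>R \<alpha>) = 0" for t :: real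
      proof (cases "t \<in> {0..1}")
        case True
        have "norm x \<le> norm (x + t *\<^sub>R \<alpha>) + norm (t *\<^sub>R \<alpha>)"
          using norm_triangle_ineq4[of "x + t *\<^sub>R \<alpha>" "t *\<^sub>R \<alpha>"] by simp
        moreover have "norm (t *\<^sub>R \<alpha>) \<le> norm \<alpha>" using True by (simp add: mult_left_le_one_le)
        ultimately have "norm (x + t *\<^sub>R \<alpha>) > r" using False by (simp add: \<rho>_def)
        then show ?thesis by (simp add: g_def)
      qed simp
      then have "(\<integral>\<^sup>+t. indicator {0..1::real} t * g (x + t *\<^sub>R \<alpha>) \<partial>lborel) = (\<integral>\<^sup>+(t::real). 0 \<partial>lborel)"
        by (intro nn_integral_cong)
      then show ?thesis by simp
    qed
  qed
  also have "\<dots> = ennreal K * emeasure lborel (cball 0 \<rho> :: 'a set)"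
    by (subst nn_integral_multc) (auto simp: mult.commute)
  also have "\<dots> < \<infinity>" using emeasure_lborel_cball_finite[of "0::'a" \<rho>] by (simp add: ennreal_mult_less_top)
  finally show ?thesis by (simp add: g_def)
qed

text \<open>
  Integrate the indicator of \<open>{(x, y). x \<in> ball 0 1 \<and> x + f y \<in> B}\<close> in both orders: translation
  invariance of the image measure gives the volume of the ball times the image measure of \<open>B\<close>,
  and, since \<open>f\<close> is an isometry, translation invariance of Lebesgue measure gives the volume of
  \<open>B\<close> times that of the ball.
\<close>

lemma lborel_distr_orthogonal:
  fixes f :: "'a::euclidean_space \<Rightarrow> 'a"
  assumes f: "orthogonal_transformation f"
  shows "distr lborel borel f = lborel"
proof (rule measure_eqI)
  have lin: "linear f" and nf: "\<And>x. norm (f x) = norm x"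
    using f by (simp_all add: orthogonal_transformation)
  have surj: "surj f" by (rule orthogonal_transformation_surj[OF f])
  have [measurable]: "f \<in> borel_measurable borel"
    using lin by (intro borel_measurable_continuous_onI linear_continuous_on linear_conv_bounded_linear[THEN iffD1])
  fix B assume "B \<in> sets (distr lborel borel f)"
  then have [measurable]: "B \<in> sets borel" by simp
  define A where "A = ball (0::'a) 1"
  have [measurable]: "A \<in> sets borel" by (simp add: A_def)
  define \<mu> where "\<mu> = emeasure (distr lborel borel f) B"
  have \<mu>: "(\<integral>\<^sup>+y. indicator B (f y) \<partial>lborel) = \<mu>"
    unfolding \<mu>_def by (subst nn_integral_indicator[symmetric], simp, subst nn_integral_distr) auto
  have 1: "(\<integral>\<^sup>+y. indicator B (x + f y) \<partial>lborel) = \<mu>" for x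
  proof -
    obtain x' where "x = f x'" using surj by (metis surjD)
    then have "(\<integral>\<^sup>+y. indicator B (x + f y) \<partial>lborel) = (\<integral>\<^sup>+y. indicator B (f (y + x')) \<partial>lborel)"
      using lin by (simp add: linear_add add.commute)
    also have "\<dots> = \<mu>" using nn_integral_lborel_translate[of "\<lambda>y. indicator B (f y)" x'] \<mu> by simp
    finally show ?thesis .
  qed
  have 2: "(\<integral>\<^sup>+y. indicator A (x - f y) \<partial>lborel) = emeasure lborel A" for x
  proof -
    obtain x' where "x = f x'" using surj by (metis surjD)
    then have eq: "norm (x - f y) = norm (y + - x')" for y
      using lin nf[of "x' - y"] by (simp add: linear_diff norm_minus_commute)
    have "(\<integral>\<^sup>+y. indicator A (x - f y) \<partial>lborel) = (\<integral>\<^sup>+y. indicator A (y + - x') \<partial>lborel)"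
      by (intro nn_integral_cong) (auto simp: A_def indicator_def eq)
    also have "\<dots> = emeasure lborel A"
      using nn_integral_lborel_translate[of "indicator A" "- x'"] by simp
    finally show ?thesis .
  qed
  have "emeasure lborel A * \<mu> = (\<integral>\<^sup>+x. indicator A x * (\<integral>\<^sup>+y. indicator B (x + f y) \<partial>lborel) \<partial>lborel)"
    unfolding 1 by (simp add: nn_integral_multc)
  also have "\<dots> = (\<integral>\<^sup>+x. \<integral>\<^sup>+y. indicator A x * indicator B (x + f y) \<partial>lborel \<partial>lborel)"
    by (simp add: nn_integral_cmult)
  also have "\<dots> = (\<integral>\<^sup>+y. \<integral>\<^sup>+x. indicator A x * indicator B (x + f y) \<partial>lborel \<partial>lborel)"
    by (rule lborel_pair.Fubini'[symmetric]) measurable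
  also have "\<dots> = (\<integral>\<^sup>+y. \<integral>\<^sup>+x. indicator A (x - f y) * indicator B x \<partial>lborel \<partial>lborel)"
  proof (rule nn_integral_cong)
    fix y
    show "(\<integral>\<^sup>+x. indicator A x * indicator B (x + f y) \<partial>lborel)
        = (\<integral>\<^sup>+x. indicator A (x - f y) * indicator B x \<partial>lborel)"
      using nn_integral_lborel_translate[of "\<lambda>x. indicator A (x - f y) * indicator B x" "f y"] by simp
  qed
  also have "\<dots> = (\<integral>\<^sup>+x. \<integral>\<^sup>+y. indicator A (x - f y) * indicator B x \<partial>lborel \<partial>lborel)"
    by (rule lborel_pair.Fubini') measurable
  also have "\<dots> = (\<integral>\<^sup>+x. emeasure lborel A * indicator B x \<partial>lborel)"
    by (simp add: nn_integral_multc 2)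
  also have "\<dots> = emeasure lborel A * emeasure lborel B" by (simp add: nn_integral_cmult)
  finally have "emeasure lborel A * \<mu> = emeasure lborel A * emeasure lborel B" .
  moreover have "emeasure lborel A \<noteq> 0"
    using unit_ball_vol_pos[of "real DIM('a)"] unfolding A_def by (simp add: emeasure_ball less_imp_neq[symmetric])
  moreover have "emeasure lborel A \<noteq> top"
    unfolding A_def using emeasure_lborel_ball_finite[of "0::'a" 1] by simp
  ultimately show "emeasure (distr lborel borel f) B = emeasure lborel B"
    unfolding \<mu>_def[symmetric] by (simp add: ennreal_mult_cancel_left)
qed simp

lemma nn_integral_lborel_scale:
  fixes f :: "'a::euclidean_space \<Rightarrow> ennreal"
  assumes [measurable]: "f \<in> borel_measurable borel" and c: "c > 0"
  shows "(\<integral>\<^sup>+x. f x \<partial>lborel) = (\<integral>\<^sup>+x. ennreal (c ^ DIM('a)) * f (c *\<^sub>R x) \<partial>lborel)"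
proof -
  have "c \<noteq> 0" using c by simp
  then show ?thesis
    by (subst lborel_affine[of c "0::'a"]) (use c in \<open>simp_all add: nn_integral_density nn_integral_distr nn_integral_cmult ennreal_power\<close>)
qed

text \<open>
  A homogeneous density has radial distribution a power law: both measures agree on the sets
  \<open>{..t}\<close> by scaling.
\<close>

lemma nn_integral_homogeneous_radial:
  fixes P :: "'a::euclidean_space \<Rightarrow> real" and h :: "real \<Rightarrow> ennreal"
  assumes [measurable]: "P \<in> borel_measurable borel" "h \<in> borel_measurable borel"
    and P0: "\<And>x. 0 \<le> P x" and hom: "\<And>c x. c > 0 \<Longrightarrow> P (c *\<^sub>R x) = c powr d * P x"
    and D: "D = d + real DIM('a)" "D > 0" and a: "a > 0"
    and C: "(\<integral>\<^sup>+x. indicator (cball 0 1) x * ennreal (P x) \<partial>lborel) = ennreal C" "C \<ge> 0"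
  shows "(\<integral>\<^sup>+x. ennreal (P x) * h (norm x powr a) \<partial>lborel)
    = (\<integral>\<^sup>+t. ennreal (indicator {0<..} t * (C * (D / a) * t powr (D / a - 1))) * h t \<partial>lborel)"
proof -
  define \<nu>1 where "\<nu>1 = distr (density lborel (\<lambda>x. ennreal (P x))) borel (\<lambda>x::'a. norm x powr a)"
  define q where "q t = indicator {0<..} t * (C * (D / a) * t powr (D / a - 1))" for t :: real
  have [measurable]: "q \<in> borel_measurable borel" unfolding q_def by measurable
  define \<nu>2 where "\<nu>2 = density lborel (\<lambda>t. ennreal (q t))"
  have e1: "emeasure \<nu>1 {..t} = ennreal (if t > 0 then C * t powr (D / a) else 0)" for t
  proof -
    have "emeasure \<nu>1 {..t} = (\<integral>\<^sup>+x. ennreal (P x) * indicator {x. norm x powr a \<le> t} x \<partial>lborel)"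
      unfolding \<nu>1_def by (subst emeasure_distr, simp, simp, subst emeasure_density)
        (auto simp: vimage_def)
    also have "\<dots> = ennreal (if t > 0 then C * t powr (D / a) else 0)"
    proof (cases "t > 0")
      case True
      define \<rho> where "\<rho> = t powr (1 / a)"
      have \<rho>: "\<rho> > 0" "\<rho> powr a = t" using True a by (auto simp: \<rho>_def powr_powr)
      have iff: "norm x powr a \<le> t \<longleftrightarrow> norm x \<le> \<rho>" for x :: 'a
        using powr_mono2'[of a] powr_less_mono2[of a "norm x" \<rho>] powr_less_mono2[of a \<rho> "norm x"] \<rho> a
        by (metis less_imp_le linorder_neqE_linordered_idom norm_ge_zero not_le)
      have "(\<integral>\<^sup>+x. ennreal (P x) * indicator {x. norm x powr a \<le> t} x \<partial>lborel)
          = (\<integral>\<^sup>+x. ennreal (P x) * indicator (cball 0 \<rho>) x \<partial>lborel)"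
        by (intro nn_integral_cong) (auto simp: iff indicator_def)
      also have "\<dots> = (\<integral>\<^sup>+x. ennreal (\<rho> ^ DIM('a)) * (ennreal (P (\<rho> *\<^sub>R x)) * indicator (cball 0 \<rho>) (\<rho> *\<^sub>R x)) \<partial>lborel)"
        using \<rho> by (intro nn_integral_lborel_scale borel_measurable_times_ennreal borel_measurable_indicator) simp_all
      also have "\<dots> = (\<integral>\<^sup>+x. ennreal (\<rho> powr D) * (indicator (cball 0 1) x * ennreal (P x)) \<partial>lborel)"
      proof (rule nn_integral_cong)
        fix x :: 'a
        have "indicator (cball 0 \<rho>) (\<rho> *\<^sub>R x) = (indicator (cball 0 1) x :: ennreal)"
          using \<rho> by (auto simp: indicator_def)
        moreover have "ennreal (\<rho> ^ DIM('a)) * ennreal (P (\<rho> *\<^sub>R x)) = ennreal (\<rho> powr D) * ennreal (P x)"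
          using \<rho> P0 by (simp add: ennreal_mult[symmetric] hom D powr_add powr_realpow mult_ac)
        ultimately show "ennreal (\<rho> ^ DIM('a)) * (ennreal (P (\<rho> *\<^sub>R x)) * indicator (cball 0 \<rho>) (\<rho> *\<^sub>R x))
            = ennreal (\<rho> powr D) * (indicator (cball 0 1) x * ennreal (P x))"
          by (metis mult.assoc mult.commute)
      qed
      also have "\<dots> = ennreal (\<rho> powr D) * ennreal C"
        unfolding C(1)[symmetric] by (rule nn_integral_cmult) measurable
      also have "\<dots> = ennreal (C * t powr (D / a))"
        using C by (simp add: ennreal_mult[symmetric] \<rho>_def powr_powr mult.commute)
      finally show ?thesis using True by simp
    next
      case False
      have "(\<integral>\<^sup>+x. ennreal (P x) * indicator {x. norm x powr a \<le> t} x \<partial>lborel) = (\<integral>\<^sup>+(x::'a). 0 \<partial>lborel)"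
      proof (rule nn_integral_cong_AE)
        show "AE x in lborel. ennreal (P x) * indicator {x. norm x powr a \<le> t} x = 0"
          using AE_lborel_singleton[of 0]
        proof eventually_elim
          case (elim x)
          then have "norm x powr a > 0" by simp
          with False have "\<not> norm x powr a \<le> t" by linarith
          then show ?case by simp
        qed
      qed
      then show ?thesis using False by simp
    qed
    finally show ?thesis .
  qed
  have e2: "emeasure \<nu>2 {..t} = ennreal (if t > 0 then C * t powr (D / a) else 0)" for t
  proof (cases "t > 0")
    case True
    have "((\<lambda>s. C * (D / a) * s powr (D / a - 1)) has_integral (C * t powr (D / a) - C * 0 powr (D / a))) {0..t}"
    proof (rule fundamental_theorem_of_calculus_interior_strong[of "{}" _ _ "\<lambda>s. C * s powr (D / a)"])
      fix s assume "s \<in> {0<..<t} - {}"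
      then have "((\<lambda>s. C * s powr (D / a)) has_real_derivative C * (D / a) * s powr (D / a - 1)) (at s)"
        by (auto intro!: derivative_eq_intros)
      then show "((\<lambda>s. C * s powr (D / a)) has_vector_derivative C * (D / a) * s powr (D / a - 1)) (at s)"
        by (simp add: has_real_derivative_iff_has_vector_derivative)
    qed (use True D a in \<open>auto intro!: continuous_intros continuous_on_powr'\<close>)
    then have "((\<lambda>s. if s \<in> {0..t} then C * (D / a) * s powr (D / a - 1) else 0) has_integral (C * t powr (D / a))) UNIV"
      unfolding has_integral_restrict_UNIV by simp
    moreover have "(\<lambda>s. if s \<in> {0..t} then C * (D / a) * s powr (D / a - 1) else 0) = (\<lambda>s. q s * indicator {..t} s)"
      by (intro ext) (auto simp: q_def indicator_def le_less)
    ultimately have I: "((\<lambda>s. q s * indicator {..t} s) has_integral (C * t powr (D / a))) UNIV" by simp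
    have "emeasure \<nu>2 {..t} = (\<integral>\<^sup>+s. ennreal (q s) * indicator {..t} s \<partial>lborel)"
      unfolding \<nu>2_def by (rule emeasure_density) auto
    also have "\<dots> = (\<integral>\<^sup>+s. ennreal (q s * indicator {..t} s) \<partial>lborel)"
      by (intro nn_integral_cong) (auto simp: indicator_def)
    also have "\<dots> = ennreal (C * t powr (D / a))"
      using C D a by (intro nn_integral_has_integral_lborel[OF _ _ I]) (auto simp: q_def)
    finally show ?thesis using True by simp
  next
    case False
    have "emeasure \<nu>2 {..t} = (\<integral>\<^sup>+s. ennreal (q s) * indicator {..t} s \<partial>lborel)"
      unfolding \<nu>2_def by (rule emeasure_density) auto
    also have "\<dots> = 0" using False by (auto simp: q_def indicator_def intro!: nn_integral_0_iff_AE[THEN iffD2])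
    finally show ?thesis using False by simp
  qed
  have "\<nu>1 = \<nu>2"
  proof (rule measure_eqI_generator_eq[where E = "range atMost" and \<Omega> = UNIV and A = "\<lambda>i. {..real i}"])
    show "Int_stable (range (atMost :: real \<Rightarrow> real set))"
      by (auto simp: Int_stable_def intro!: exI[of _ "min _ _"])
    show "sets \<nu>1 = sigma_sets UNIV (range (atMost :: real \<Rightarrow> real set))"
      "sets \<nu>2 = sigma_sets UNIV (range (atMost :: real \<Rightarrow> real set))"
      by (simp_all add: \<nu>1_def \<nu>2_def borel_eq_atMost sets_measure_of_conv full_SetCompr_eq)
    show "(\<Union>i. {..real i}) = UNIV"
      using real_arch_simple by auto
  qed (auto simp: e1 e2)
  have "(\<integral>\<^sup>+x. ennreal (P x) * h (norm x powr a) \<partial>lborel) = (\<integral>\<^sup>+t. h t \<partial>\<nu>1)"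
    unfolding \<nu>1_def by (subst nn_integral_distr, simp, simp, subst nn_integral_density) auto
  also have "\<dots> = (\<integral>\<^sup>+t. ennreal (q t) * h t \<partial>lborel)"
    unfolding \<open>\<nu>1 = \<nu>2\<close> \<nu>2_def by (subst nn_integral_density) auto
  finally show ?thesis by (simp add: q_def)
qed

section \<open>Complex polynomials on Euclidean space\<close>

lemma polynomial_function_complex_iff:
  "polynomial_function (p :: 'a::real_normed_vector \<Rightarrow> complex) \<longleftrightarrow>
    real_polynomial_function (\<lambda>x. Re (p x)) \<and> real_polynomial_function (\<lambda>x. Im (p x))"
  unfolding polynomial_function_iff_Basis_inner by (simp add: Basis_complex_def inner_complex_def)

lemma polynomial_function_complex_mult:
  fixes p q :: "'a::real_normed_vector \<Rightarrow> complex"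
  assumes "polynomial_function p" "polynomial_function q"
  shows "polynomial_function (\<lambda>x. p x * q x)"
  using assms unfolding polynomial_function_complex_iff by auto

lemma polynomial_function_of_real:
  "real_polynomial_function f \<Longrightarrow> polynomial_function (\<lambda>x. complex_of_real (f x))"
  by (auto simp: polynomial_function_complex_iff)

lemma polynomial_function_cnj:
  "polynomial_function p \<Longrightarrow> polynomial_function (\<lambda>x. cnj (p x))"
  by (auto simp: polynomial_function_complex_iff)

lemma real_polynomial_function_inner: "real_polynomial_function (\<lambda>x. v \<bullet> x)"
  by (rule real_polynomial_function.intros(1)) (rule bounded_linear_inner_right)

lemma real_polynomial_function_inner_self: "real_polynomial_function (\<lambda>x::'a::euclidean_space. x \<bullet> x)"
proof -
  have "(\<lambda>x::'a. x \<bullet> x) = (\<lambda>x. \<Sum>b\<in>Basis. (b \<bullet> x) * (b \<bullet> x))"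
    by (intro ext, subst euclidean_inner) (simp add: inner_commute)
  then show ?thesis by (auto intro!: real_polynomial_function_sum real_polynomial_function_inner)
qed

text \<open>Polynomial functions are generated by constants and real linear forms; this generation suits
  reflections and derivatives better than coordinates do.\<close>

lemma complex_polynomial_induct[consumes 1, case_names const inner add mult]:
  fixes p :: "'a::euclidean_space \<Rightarrow> complex"
  assumes p: "polynomial_function p"
    and const: "\<And>c. P (\<lambda>x. c)" and inner: "\<And>v. P (\<lambda>x. complex_of_real (v \<bullet> x))"
    and add: "\<And>f g. polynomial_function f \<Longrightarrow> polynomial_function g \<Longrightarrow> P f \<Longrightarrow> P g \<Longrightarrow> P (\<lambda>x. f x + g x)"
    and mult: "\<And>f g. polynomial_function f \<Longrightarrow> polynomial_function g \<Longrightarrow> P f \<Longrightarrow> P g \<Longrightarrow> P (\<lambda>x. f x * g x)"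
  shows "P p"
proof -
  have real: "P (\<lambda>x. complex_of_real (f x))" if "real_polynomial_function f" for f
    using that
  proof induction
    case (linear f)
    define v where "v = (\<Sum>b\<in>Basis. f b *\<^sub>R b)"
    have "f x = v \<bullet> x" for x
    proof -
      have "f x = f (\<Sum>b\<in>Basis. (x \<bullet> b) *\<^sub>R b)" by (simp add: euclidean_representation)
      also have "\<dots> = (\<Sum>b\<in>Basis. (x \<bullet> b) *\<^sub>R f b)"
        using linear by (simp add: linear_sum bounded_linear.linear linear_scale)
      finally show ?thesis by (simp add: v_def inner_sum_left inner_commute[of x] mult.commute)
    qed
    then show ?case using inner[of v] by simp
  next
    case (const c)
    show ?case by (rule assms(2))
  next
    case (add f g)
    then show ?case using assms(4)[of "\<lambda>x. complex_of_real (f x)" "\<lambda>x. complex_of_real (g x)"]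
      by (simp add: polynomial_function_of_real)
  next
    case (mult f g)
    then show ?case using assms(5)[of "\<lambda>x. complex_of_real (f x)" "\<lambda>x. complex_of_real (g x)"]
      by (simp add: polynomial_function_of_real)
  qed
  have "P (\<lambda>x. complex_of_real (Re (p x)) + \<i> * complex_of_real (Im (p x)))"
    using p unfolding polynomial_function_complex_iff
    by (auto intro!: add mult real const polynomial_function_of_real polynomial_function_complex_mult)
  then show ?thesis by (simp add: complex_eq[symmetric])
qed

lemma differentiable_polynomial:
  "polynomial_function p \<Longrightarrow> (p :: 'a::euclidean_space \<Rightarrow> complex) differentiable (at x)"
  by (rule differentiable_at_polynomial_function)

lemma continuous_on_polynomial:
  "polynomial_function p \<Longrightarrow> continuous_on S (p :: 'a::euclidean_space \<Rightarrow> complex)"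
  by (rule continuous_on_polymonial_function)

lemma has_derivative_polynomial:
  "polynomial_function p \<Longrightarrow>
    ((p :: 'a::euclidean_space \<Rightarrow> complex) has_derivative frechet_derivative p (at x)) (at x)"
  using differentiable_polynomial frechet_derivative_works by blast

lemma frechet_derivativeI:
  "(f has_derivative f') (at x) \<Longrightarrow> frechet_derivative f (at x) v = f' v"
  by (metis frechet_derivative_at)

lemma polynomial_function_directional_derivative:
  fixes p :: "'a::euclidean_space \<Rightarrow> complex"
  assumes "polynomial_function p"
  shows "polynomial_function (\<lambda>x. frechet_derivative p (at x) \<xi>)"
  using assms
proof (induction rule: complex_polynomial_induct)
  case (inner v)
  have "frechet_derivative (\<lambda>x. complex_of_real (v \<bullet> x)) (at x) \<xi> = complex_of_real (v \<bullet> \<xi>)" for x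
    by (rule frechet_derivativeI) (auto intro!: derivative_eq_intros)
  then show ?case by simp
next
  case (add f g)
  have "frechet_derivative (\<lambda>x. f x + g x) (at x) \<xi>
      = frechet_derivative f (at x) \<xi> + frechet_derivative g (at x) \<xi>" for x
    by (rule frechet_derivativeI) (intro has_derivative_add has_derivative_polynomial add.hyps)
  then show ?case using add.IH by auto
next
  case (mult f g)
  have "frechet_derivative (\<lambda>x. f x * g x) (at x) \<xi>
      = f x * frechet_derivative g (at x) \<xi> + frechet_derivative f (at x) \<xi> * g x" for x
    by (rule frechet_derivativeI) (intro has_derivative_mult has_derivative_polynomial mult.hyps)
  then show ?case using mult by (auto intro!: polynomial_function_complex_mult)
qed auto

section \<open>Reflections and Dunkl operators on polynomials\<close>

lemma inner_reflection: "\<beta> \<bullet> reflection \<alpha> x = \<beta> \<bullet> x - 2 * (\<alpha> \<bullet> x) * (\<beta> \<bullet> \<alpha>) / (norm \<alpha>)\<^sup>2"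
  by (simp add: reflection_def inner_diff_right)

lemma linear_reflection: "linear (reflection \<alpha>)"
proof (rule linearI)
  show "reflection \<alpha> (x + y) = reflection \<alpha> x + reflection \<alpha> y" for x y
    by (simp add: reflection_def inner_add_right distrib_left add_divide_distrib scaleR_add_left)
  show "reflection \<alpha> (c *\<^sub>R x) = c *\<^sub>R reflection \<alpha> x" for c x
    by (simp add: reflection_def scaleR_diff_right mult.left_commute)
qed

lemma inner_reflection_swap: "\<beta> \<bullet> reflection \<alpha> x = reflection \<alpha> \<beta> \<bullet> x"
  by (simp add: reflection_def inner_diff_right inner_diff_left inner_commute)

lemma reflection_self: "\<alpha> \<noteq> 0 \<Longrightarrow> reflection \<alpha> \<alpha> = - \<alpha>"
  by (simp add: reflection_def power2_norm_eq_inner scaleR_left_distrib[symmetric] algebra_simps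
      scaleR_2)

lemma reflection_involution: "\<alpha> \<noteq> 0 \<Longrightarrow> reflection \<alpha> (reflection \<alpha> x) = x"
  by (simp add: reflection_def inner_diff_right power2_norm_eq_inner[symmetric] field_simps)

lemma inner_self_reflection: "\<alpha> \<noteq> 0 \<Longrightarrow> \<alpha> \<bullet> reflection \<alpha> x = - (\<alpha> \<bullet> x)"
  by (simp add: inner_reflection_swap reflection_self)

lemma inner_reflection_reflection: "\<alpha> \<noteq> 0 \<Longrightarrow> reflection \<alpha> x \<bullet> reflection \<alpha> y = x \<bullet> y"
  by (simp add: inner_reflection_swap reflection_involution)

lemma norm_reflection: "\<alpha> \<noteq> 0 \<Longrightarrow> norm (reflection \<alpha> x) = norm x"
  by (simp add: norm_eq_sqrt_inner inner_reflection_reflection)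

lemma orthogonal_transformation_reflection: "\<alpha> \<noteq> 0 \<Longrightarrow> orthogonal_transformation (reflection \<alpha>)"
  by (simp add: orthogonal_transformation_def linear_reflection inner_reflection_reflection)

lemma reflection_hyperplane: "\<alpha> \<bullet> x = 0 \<Longrightarrow> reflection \<alpha> x = x"
  by (simp add: reflection_def)

lemma has_derivative_reflection: "(reflection \<alpha> has_derivative reflection \<alpha>) F"
  by (rule bounded_linear_imp_has_derivative)
    (rule linear_reflection[unfolded linear_conv_bounded_linear])

text \<open>The difference quotients in the Dunkl operators of a polynomial are polynomials again; for
  products this is the Leibniz rule of a divided difference.\<close>

lemma polynomial_difference_divisible:
  fixes p :: "real ^ 'n \<Rightarrow> complex"
  assumes "polynomial_function p"
  shows "\<exists>q. polynomial_function q \<and> (\<forall>x. p x - p (reflection \<alpha> x) = complex_of_real (\<alpha> \<bullet> x) * q x)"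
  using assms
proof (induction rule: complex_polynomial_induct)
  case (const c)
  show ?case by (intro exI[of _ "\<lambda>x. 0"]) auto
next
  case (inner v)
  let ?c = "2 * (v \<bullet> \<alpha>) / (norm \<alpha>)\<^sup>2"
  have "v \<bullet> x - v \<bullet> reflection \<alpha> x = (\<alpha> \<bullet> x) * ?c" for x
    by (simp add: inner_reflection)
  then have "complex_of_real (v \<bullet> x) - complex_of_real (v \<bullet> reflection \<alpha> x)
      = complex_of_real (\<alpha> \<bullet> x) * complex_of_real ?c" for x
    by (metis of_real_diff of_real_mult)
  then show ?case by (intro exI[of _ "\<lambda>x. complex_of_real ?c"] conjI allI polynomial_function_const)
next
  case (add f g)
  then obtain q r where "polynomial_function q" "polynomial_function r"
    "\<And>x. f x - f (reflection \<alpha> x) = complex_of_real (\<alpha> \<bullet> x) * q x"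
    "\<And>x. g x - g (reflection \<alpha> x) = complex_of_real (\<alpha> \<bullet> x) * r x" by blast
  then have "f x + g x - (f (reflection \<alpha> x) + g (reflection \<alpha> x))
      = complex_of_real (\<alpha> \<bullet> x) * (q x + r x)" for x
    by (simp add: distrib_left) (metis add_diff_add)
  with \<open>polynomial_function q\<close> \<open>polynomial_function r\<close> show ?case
    by (intro exI[of _ "\<lambda>x. q x + r x"] conjI allI polynomial_function_add)
next
  case (mult f g)
  then obtain q r where qr: "polynomial_function q" "polynomial_function r"
    "\<And>x. f x - f (reflection \<alpha> x) = complex_of_real (\<alpha> \<bullet> x) * q x"
    "\<And>x. g x - g (reflection \<alpha> x) = complex_of_real (\<alpha> \<bullet> x) * r x" by blast
  have "polynomial_function (\<lambda>x. g (reflection \<alpha> x))"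
    by (rule polynomial_function_compose[unfolded o_def, OF _ mult.hyps(2)])
      (rule polynomial_function_bounded_linear[OF linear_reflection[unfolded linear_conv_bounded_linear]])
  then have "polynomial_function (\<lambda>x. f x * r x + q x * g (reflection \<alpha> x))"
    using mult.hyps qr by (intro polynomial_function_add polynomial_function_complex_mult) auto
  moreover have "f x * g x - f (reflection \<alpha> x) * g (reflection \<alpha> x)
      = complex_of_real (\<alpha> \<bullet> x) * (f x * r x + q x * g (reflection \<alpha> x))" for x
  proof -
    have "f x * g x - f (reflection \<alpha> x) * g (reflection \<alpha> x)
        = f x * (g x - g (reflection \<alpha> x)) + (f x - f (reflection \<alpha> x)) * g (reflection \<alpha> x)"
      by (simp add: algebra_simps)
    then show ?thesis by (simp only: qr) (simp add: algebra_simps)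
  qed
  ultimately show ?case by blast
qed

text \<open>On the hyperplane the value of the quotient is found by differentiating the factorisation
  in direction \<open>\<alpha>\<close>.\<close>

lemma dunkl_quotient_polynomial:
  fixes p :: "real ^ 'n \<Rightarrow> complex"
  assumes p: "polynomial_function p" and \<alpha>: "\<alpha> \<noteq> 0"
  shows "polynomial_function (dunkl_quotient \<alpha> p)"
    and "p x - p (reflection \<alpha> x) = complex_of_real (\<alpha> \<bullet> x) * dunkl_quotient \<alpha> p x"
proof -
  obtain q where q: "polynomial_function q"
    "\<And>x. p x - p (reflection \<alpha> x) = complex_of_real (\<alpha> \<bullet> x) * q x"
    using polynomial_difference_divisible[OF p] by blast
  have "dunkl_quotient \<alpha> p x = q x" for x
  proof (cases "\<alpha> \<bullet> x = 0")
    case False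
    then show ?thesis by (simp add: dunkl_quotient_def q(2) scaleR_conv_of_real)
  next
    case True
    let ?Dp = "frechet_derivative p (at x)"
    have Dp: "(p has_derivative ?Dp) (at x)" by (rule has_derivative_polynomial[OF p])
    have d1: "((\<lambda>x. p x - p (reflection \<alpha> x)) has_derivative (\<lambda>v. ?Dp v - ?Dp (reflection \<alpha> v))) (at x)"
      using reflection_hyperplane[OF True] Dp
      by (intro has_derivative_diff has_derivative_compose[OF has_derivative_reflection]) auto
    have d2: "((\<lambda>x. complex_of_real (\<alpha> \<bullet> x) * q x) has_derivative
        (\<lambda>v. complex_of_real (\<alpha> \<bullet> x) * frechet_derivative q (at x) v + complex_of_real (\<alpha> \<bullet> v) * q x)) (at x)"
      by (intro has_derivative_mult has_derivative_polynomial q(1)) (auto intro!: derivative_eq_intros)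
    have "?Dp \<alpha> - ?Dp (reflection \<alpha> \<alpha>)
        = complex_of_real (\<alpha> \<bullet> x) * frechet_derivative q (at x) \<alpha> + complex_of_real (\<alpha> \<bullet> \<alpha>) * q x"
      using fun_cong[OF has_derivative_unique[OF d1[unfolded q(2)] d2], of \<alpha>] .
    moreover have "?Dp (- \<alpha>) = - ?Dp \<alpha>"
      using has_derivative_linear[OF Dp] by (rule linear_neg)
    ultimately have "2 * ?Dp \<alpha> = complex_of_real ((norm \<alpha>)\<^sup>2) * q x"
      by (simp only: True reflection_self[OF \<alpha>] power2_norm_eq_inner) simp
    then show ?thesis
      using True \<alpha> by (simp add: dunkl_quotient_def scaleR_conv_of_real divide_eq_eq mult.commute)
  qed
  then have "dunkl_quotient \<alpha> p = q" by blast
  with q show "polynomial_function (dunkl_quotient \<alpha> p)"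
    "p x - p (reflection \<alpha> x) = complex_of_real (\<alpha> \<bullet> x) * dunkl_quotient \<alpha> p x" by auto
qed

definition homogeneous :: "nat \<Rightarrow> (real ^ 'n \<Rightarrow> complex) \<Rightarrow> bool" where
  "homogeneous m p \<longleftrightarrow> (\<forall>c x. p (c *\<^sub>R x) = (c ^ m) *\<^sub>R p x)"

lemma homogeneousD: "homogeneous m p \<Longrightarrow> p (c *\<^sub>R x) = complex_of_real (c ^ m) * p x"
  by (simp add: homogeneous_def scaleR_conv_of_real)

lemma homogeneous_0_const: "homogeneous 0 p \<Longrightarrow> p x = p 0"
  by (metis homogeneousD mult_1 of_real_1 power_0 scaleR_zero_left)

text \<open>Euler's identity.\<close>

lemma frechet_derivative_homogeneous:
  assumes "homogeneous m p" "polynomial_function p"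
  shows "frechet_derivative p (at x) x = complex_of_real (real m) * p x"
proof -
  have "((\<lambda>c::real. c *\<^sub>R x) has_derivative (\<lambda>c. c *\<^sub>R x)) (at 1)"
    by (auto intro!: derivative_eq_intros)
  then have "((\<lambda>c::real. p (c *\<^sub>R x)) has_derivative (\<lambda>c. frechet_derivative p (at (1 *\<^sub>R x)) (c *\<^sub>R x))) (at 1)"
    by (rule has_derivative_compose) (rule has_derivative_polynomial[OF assms(2)])
  note d1 = this
  have d2: "((\<lambda>c::real. complex_of_real (c ^ m) * p x) has_derivative
      (\<lambda>c. complex_of_real (real m * c) * p x)) (at 1)"
    by (auto intro!: derivative_eq_intros simp: mult_ac)
  have "frechet_derivative p (at (1 *\<^sub>R x)) (1 *\<^sub>R x) = complex_of_real (real m * 1) * p x"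
    using fun_cong[OF has_derivative_unique[OF d1[unfolded homogeneousD[OF assms(1)]] d2], of 1] .
  then show ?thesis by simp
qed

locale dunkl =
  fixes R Rp :: "(real ^ 'n) set" and k :: "real ^ 'n \<Rightarrow> real"
  assumes root_system: "reduced_root_system R"
    and positive: "positive_subsystem R Rp"
    and multiplicity: "multiplicity_function R k"
    and k_nonneg: "\<alpha> \<in> R \<Longrightarrow> 0 \<le> k \<alpha>"
begin

abbreviation T where "T \<equiv> dunkl_operator Rp k"

abbreviation lap where "lap \<equiv> dunkl_laplacian Rp k"

abbreviation "\<gamma> \<equiv> mult_index Rp k"

lemma finite_R[simp]: "finite R" and zero_notin_R: "0 \<notin> R"
  using root_system by (simp_all add: reduced_root_system_def)

lemma Rp_subset: "Rp \<subseteq> R" and finite_Rp[simp]: "finite Rp"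
proof -
  show "Rp \<subseteq> R" using positive by (auto simp: positive_subsystem_def)
  then show "finite Rp" by (rule finite_subset) simp
qed

lemma R_nonzero: "\<alpha> \<in> R \<Longrightarrow> \<alpha> \<noteq> 0" and Rp_nonzero: "\<alpha> \<in> Rp \<Longrightarrow> \<alpha> \<noteq> 0"
  using zero_notin_R Rp_subset by auto

lemma reflection_image_R: "\<beta> \<in> R \<Longrightarrow> reflection \<beta> ` R = R"
  using root_system by (simp add: reduced_root_system_def)

lemma reflection_in_R: "\<beta> \<in> R \<Longrightarrow> \<alpha> \<in> R \<Longrightarrow> reflection \<beta> \<alpha> \<in> R"
  using reflection_image_R by blast

lemma uminus_in_R: "\<alpha> \<in> R \<Longrightarrow> - \<alpha> \<in> R"
  using reflection_in_R[of \<alpha> \<alpha>] by (simp add: reflection_self R_nonzero)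

lemma k_reflection: "\<beta> \<in> R \<Longrightarrow> \<alpha> \<in> R \<Longrightarrow> k (reflection \<beta> \<alpha>) = k \<alpha>"
  using multiplicity coxeter_step[OF _ coxeter_id, of \<beta> R]
  by (force simp: multiplicity_function_def)

lemma k_uminus: "\<alpha> \<in> R \<Longrightarrow> k (- \<alpha>) = k \<alpha>"
  using k_reflection[of \<alpha> \<alpha>] by (simp add: reflection_self R_nonzero)

lemma sum_R_eq_sum_Rp:
  fixes f :: "real ^ 'n \<Rightarrow> 'b::comm_monoid_add"
  assumes "\<And>\<alpha>. \<alpha> \<in> R \<Longrightarrow> f (- \<alpha>) = f \<alpha>"
  shows "sum f R = sum f Rp + sum f Rp"
proof -
  obtain \<beta> where \<beta>: "\<And>\<alpha>. \<alpha> \<in> R \<Longrightarrow> \<alpha> \<bullet> \<beta> \<noteq> 0" "Rp = {\<alpha> \<in> R. \<alpha> \<bullet> \<beta> > 0}"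
    using positive unfolding positive_subsystem_def by blast
  have un: "R = Rp \<union> uminus ` Rp"
  proof (intro equalityI subsetI)
    fix \<alpha> assume \<alpha>: "\<alpha> \<in> R"
    show "\<alpha> \<in> Rp \<union> uminus ` Rp"
    proof (cases "\<alpha> \<bullet> \<beta> > 0")
      case False
      then have "- \<alpha> \<in> Rp" using \<beta>(1)[OF \<alpha>] uminus_in_R[OF \<alpha>] by (simp add: \<beta>(2))
      then show ?thesis by (auto intro: image_eqI[of _ _ "- \<alpha>"])
    qed (use \<alpha> in \<open>simp add: \<beta>(2)\<close>)
  qed (use Rp_subset uminus_in_R in auto)
  have disj: "Rp \<inter> uminus ` Rp = {}" by (auto simp: \<beta>(2))
  have "sum f R = sum f Rp + sum f (uminus ` Rp)"
    by (subst un, rule sum.union_disjoint) (use disj in auto)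
  also have "sum f (uminus ` Rp) = sum f Rp"
    using assms Rp_subset by (subst sum.reindex) (auto simp: inj_on_def intro!: sum.cong)
  finally show ?thesis .
qed

text \<open>The points off all root hyperplanes. Here the Dunkl operators are given by genuine difference
  quotients; the complement is a null set, and polynomial identities extend to it by continuity.\<close>

definition generic :: "(real ^ 'n) set" where
  "generic = {x. x \<noteq> 0 \<and> (\<forall>\<alpha>\<in>R. \<alpha> \<bullet> x \<noteq> 0)}"

lemma generic_nonzero: "x \<in> generic \<Longrightarrow> x \<noteq> 0"
  and generic_inner: "x \<in> generic \<Longrightarrow> \<alpha> \<in> R \<Longrightarrow> \<alpha> \<bullet> x \<noteq> 0"
  and generic_inner_Rp: "x \<in> generic \<Longrightarrow> \<alpha> \<in> Rp \<Longrightarrow> \<alpha> \<bullet> x \<noteq> 0"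
  using Rp_subset by (auto simp: generic_def)

lemma open_generic: "open generic"
proof -
  have "generic = - {0} \<inter> (\<Inter>\<alpha>\<in>R. - {x. \<alpha> \<bullet> x = 0})" by (auto simp: generic_def)
  also have "open \<dots>"
    by (intro open_Int open_INT finite_R ballI open_Compl closed_hyperplane closed_singleton)
  finally show ?thesis .
qed

lemma reflection_generic: "\<beta> \<in> R \<Longrightarrow> x \<in> generic \<Longrightarrow> reflection \<beta> x \<in> generic"
  unfolding generic_def
  using norm_reflection[of \<beta> x] R_nonzero[of \<beta>]
  by (auto simp: inner_reflection_swap reflection_in_R)

lemma scaleR_generic: "c \<noteq> 0 \<Longrightarrow> x \<in> generic \<Longrightarrow> c *\<^sub>R x \<in> generic"
  by (auto simp: generic_def)

lemma negligible_not_generic: "negligible (- generic)"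
proof -
  have "- generic = {0} \<union> (\<Union>\<alpha>\<in>R. {x. \<alpha> \<bullet> x = 0})" by (auto simp: generic_def)
  also have "negligible \<dots>"
    using R_nonzero by (intro negligible_Un negligible_sing negligible_Union) (auto intro!: negligible_hyperplane)
  finally show ?thesis .
qed

lemma AE_generic: "AE x in lebesgue. x \<in> generic"
  using AE_not_in[OF negligible_not_generic[unfolded negligible_iff_null_sets]] by simp

lemma AE_generic_lborel: "AE x in lborel. x \<in> generic"
proof -
  have "generic \<in> sets borel" using open_generic by simp
  then show ?thesis using AE_generic by (simp add: AE_completion_iff)
qed

lemma dense_generic: "closure generic = UNIV"
proof -
  have "interior (- generic) = {}"
    using negligible_not_generic
    by (metis interior_subset negligible_subset open_interior open_not_negligible)
  then show ?thesis by (simp add: closure_interior)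
qed

lemma eq_on_generic_imp_eq:
  fixes f g :: "real ^ 'n \<Rightarrow> complex"
  assumes "continuous_on UNIV f" "continuous_on UNIV g" "\<And>x. x \<in> generic \<Longrightarrow> f x = g x"
  shows "f x = g x"
proof -
  have "closed {x. f x = g x}" using assms(1,2) by (rule closed_Collect_eq)
  then have "closure generic \<subseteq> {x. f x = g x}" using assms(3) by (intro closure_minimal) auto
  then show ?thesis using dense_generic by auto
qed

subsection \<open>The operators at generic points\<close>

definition dunkl_coeff :: "real ^ 'n \<Rightarrow> real ^ 'n \<Rightarrow> real ^ 'n \<Rightarrow> complex" where
  "dunkl_coeff \<xi> x \<alpha> = complex_of_real (k \<alpha> * (\<alpha> \<bullet> \<xi>) / (\<alpha> \<bullet> x))"

lemma T_generic:
  assumes "x \<in> generic"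
  shows "T \<xi> f x = frechet_derivative f (at x) \<xi> +
    (\<Sum>\<alpha>\<in>Rp. dunkl_coeff \<xi> x \<alpha> * (f x - f (reflection \<alpha> x)))"
  unfolding dunkl_operator_def dunkl_coeff_def
  using generic_inner_Rp[OF assms]
  by (intro arg_cong2[where f = "(+)"] sum.cong refl)
    (simp add: dunkl_quotient_def scaleR_conv_of_real divide_simps)

lemma frechet_derivative_cong_generic:
  fixes f g :: "real ^ 'n \<Rightarrow> complex"
  assumes "x \<in> generic" "\<And>y. y \<in> generic \<Longrightarrow> f y = g y"
  shows "frechet_derivative f (at x) = frechet_derivative g (at x)"
proof -
  have "(f has_derivative h) (at x) \<longleftrightarrow> (g has_derivative h) (at x)" for h
    using assms open_generic
    by (metis (no_types, lifting) has_derivative_transform_within_open)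
  then show ?thesis unfolding frechet_derivative_def by simp
qed

lemma T_cong_generic:
  assumes "x \<in> generic" "\<And>y. y \<in> generic \<Longrightarrow> f y = g y"
  shows "T \<xi> f x = T \<xi> g x"
proof -
  have "f (reflection \<alpha> x) = g (reflection \<alpha> x)" if "\<alpha> \<in> Rp" for \<alpha>
    using assms reflection_generic Rp_subset that by blast
  then show ?thesis
    using assms frechet_derivative_cong_generic[OF assms]
    by (simp add: T_generic cong: sum.cong)
qed

lemma differentiable_cong_generic:
  fixes f g :: "real ^ 'n \<Rightarrow> complex"
  assumes "x \<in> generic" "\<And>y. y \<in> generic \<Longrightarrow> f y = g y" "f differentiable (at x)"
  shows "g differentiable (at x)"
  using assms open_generic unfolding differentiable_def
  by (metis (no_types, lifting) has_derivative_transform_within_open)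

lemma T_add:
  assumes "x \<in> generic" "f differentiable (at x)" "g differentiable (at x)"
  shows "T \<xi> (\<lambda>x. f x + g x) x = T \<xi> f x + T \<xi> g x"
proof -
  have "frechet_derivative (\<lambda>x. f x + g x) (at x) \<xi>
      = frechet_derivative f (at x) \<xi> + frechet_derivative g (at x) \<xi>"
    using assms(2,3) by (intro frechet_derivativeI has_derivative_add) (simp_all add: frechet_derivative_works[symmetric])
  then show ?thesis
    by (simp add: T_generic[OF assms(1)] sum.distrib[symmetric] algebra_simps)
qed

lemma T_cmult:
  assumes "x \<in> generic" "f differentiable (at x)"
  shows "T \<xi> (\<lambda>x. c * f x) x = c * T \<xi> f x"
proof -
  have "frechet_derivative (\<lambda>x. c * f x) (at x) \<xi> = c * frechet_derivative f (at x) \<xi>"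
    using assms(2) by (intro frechet_derivativeI has_derivative_mult_right) (simp_all add: frechet_derivative_works[symmetric])
  then show ?thesis
    by (simp add: T_generic[OF assms(1)] distrib_left sum_distrib_left algebra_simps)
qed

text \<open>Radial factors commute with reflections, so that only their derivative enters.\<close>

lemma has_derivative_radial:
  assumes "(\<phi> has_real_derivative \<phi>') (at (x \<bullet> x))"
  shows "((\<lambda>y::real ^ 'n. complex_of_real (\<phi> (y \<bullet> y))) has_derivative (\<lambda>\<xi>. complex_of_real (2 * (\<xi> \<bullet> x) * \<phi>'))) (at x)"
proof -
  have "((\<lambda>y. y \<bullet> y) has_derivative (\<lambda>\<xi>. 2 * (\<xi> \<bullet> x))) (at x)"
    by (auto intro!: derivative_eq_intros simp: inner_commute)
  from has_derivative_compose[OF this, of \<phi> "(*) \<phi>'"] assms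
  have "((\<lambda>y. \<phi> (y \<bullet> y)) has_derivative (\<lambda>\<xi>. \<phi>' * (2 * (\<xi> \<bullet> x)))) (at x)"
    by (simp add: has_field_derivative_def)
  then show ?thesis
    by (intro has_derivative_of_real) (simp add: mult_ac)
qed

lemma T_radial_mult:
  assumes x: "x \<in> generic" and p: "p differentiable (at x)"
    and \<phi>: "(\<phi> has_real_derivative \<phi>') (at (x \<bullet> x))"
  shows "T \<xi> (\<lambda>y. complex_of_real (\<phi> (y \<bullet> y)) * p y) x
    = complex_of_real (\<phi> (x \<bullet> x)) * T \<xi> p x + complex_of_real (2 * (\<xi> \<bullet> x) * \<phi>') * p x"
proof -
  let ?f = "\<lambda>y. complex_of_real (\<phi> (y \<bullet> y)) * p y"
  have d: "frechet_derivative ?f (at x) \<xi> = complex_of_real (\<phi> (x \<bullet> x)) * frechet_derivative p (at x) \<xi>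
      + complex_of_real (2 * (\<xi> \<bullet> x) * \<phi>') * p x"
    by (rule frechet_derivativeI, rule has_derivative_mult[OF has_derivative_radial[OF \<phi>]])
      (use p in \<open>simp add: frechet_derivative_works[symmetric]\<close>)
  have "(\<Sum>\<alpha>\<in>Rp. dunkl_coeff \<xi> x \<alpha> * (?f x - ?f (reflection \<alpha> x)))
      = (\<Sum>\<alpha>\<in>Rp. complex_of_real (\<phi> (x \<bullet> x)) * (dunkl_coeff \<xi> x \<alpha> * (p x - p (reflection \<alpha> x))))"
    by (rule sum.cong) (simp_all add: inner_reflection_reflection Rp_nonzero algebra_simps)
  then show ?thesis
    by (simp add: T_generic[OF x] d distrib_left sum_distrib_left)
qed

lemma differentiable_radial_mult:
  assumes "p differentiable (at x)" "(\<phi> has_real_derivative \<phi>') (at (x \<bullet> x))"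
  shows "(\<lambda>y::real ^ 'n. complex_of_real (\<phi> (y \<bullet> y)) * p y) differentiable (at x)"
  using has_derivative_radial[OF assms(2)] assms(1)
  by (intro differentiable_mult) (auto simp: differentiable_def)

subsection \<open>Polynomials\<close>

lemma polynomial_function_T:
  assumes "polynomial_function p" shows "polynomial_function (T \<xi> p)"
proof -
  have "polynomial_function (\<lambda>x. frechet_derivative p (at x) \<xi> + (\<Sum>\<alpha>\<in>Rp. (k \<alpha> * (\<alpha> \<bullet> \<xi>)) *\<^sub>R dunkl_quotient \<alpha> p x))"
    using dunkl_quotient_polynomial(1)[OF assms] Rp_nonzero
    by (intro polynomial_function_add polynomial_function_directional_derivative[OF assms]
      polynomial_function_sum polynomial_function_cmul finite_Rp) auto
  then show ?thesis by (simp add: dunkl_operator_def[abs_def])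
qed

lemma polynomial_function_lap: "polynomial_function p \<Longrightarrow> polynomial_function (lap p)"
  unfolding dunkl_laplacian_def[abs_def] by (intro polynomial_function_sum polynomial_function_T) auto

lemma T_polynomial_add:
  assumes "polynomial_function p" "polynomial_function q"
  shows "T \<xi> (\<lambda>x. p x + q x) = (\<lambda>x. T \<xi> p x + T \<xi> q x)"
proof (rule ext, rule eq_on_generic_imp_eq)
  show "continuous_on UNIV (T \<xi> (\<lambda>x. p x + q x))" "continuous_on UNIV (\<lambda>x. T \<xi> p x + T \<xi> q x)"
    using assms by (auto intro!: continuous_on_polynomial continuous_on_add polynomial_function_T)
qed (auto intro!: T_add differentiable_polynomial assms)

lemma T_polynomial_cmult:
  assumes "polynomial_function p" shows "T \<xi> (\<lambda>x. c * p x) = (\<lambda>x. c * T \<xi> p x)"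
proof (rule ext, rule eq_on_generic_imp_eq)
  show "continuous_on UNIV (T \<xi> (\<lambda>x. c * p x))"
    using assms by (intro continuous_on_polynomial polynomial_function_T polynomial_function_complex_mult) auto
  show "continuous_on UNIV (\<lambda>x. c * T \<xi> p x)"
    using assms by (intro continuous_intros continuous_on_polynomial polynomial_function_T)
qed (auto intro!: T_cmult differentiable_polynomial assms)

lemma lap_polynomial_add:
  assumes "polynomial_function p" "polynomial_function q"
  shows "lap (\<lambda>x. p x + q x) x = lap p x + lap q x"
  using assms by (simp add: dunkl_laplacian_def T_polynomial_add polynomial_function_T sum.distrib)

lemma lap_polynomial_cmult:
  assumes "polynomial_function p" shows "lap (\<lambda>x. c * p x) x = c * lap p x"
  using assms by (simp add: dunkl_laplacian_def T_polynomial_cmult polynomial_function_T sum_distrib_left)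

lemma T_const: "T \<xi> (\<lambda>x. c) x = 0"
proof -
  have "frechet_derivative (\<lambda>x. c) (at x) v = 0" for v
    by (rule frechet_derivativeI) (rule has_derivative_const)
  then show ?thesis by (simp add: dunkl_operator_def dunkl_quotient_def cong: if_cong)
qed

lemma T_cnj:
  assumes "polynomial_function p" shows "T \<xi> (\<lambda>x. cnj (p x)) = (\<lambda>x. cnj (T \<xi> p x))"
proof (rule ext, rule eq_on_generic_imp_eq)
  show "continuous_on UNIV (T \<xi> (\<lambda>x. cnj (p x)))"
    using assms by (intro continuous_on_polynomial polynomial_function_T polynomial_function_cnj)
  show "continuous_on UNIV (\<lambda>x. cnj (T \<xi> p x))"
    using assms by (intro continuous_intros continuous_on_polynomial polynomial_function_T)
  fix x assume x: "x \<in> generic"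
  have "frechet_derivative (\<lambda>x. cnj (p x)) (at x) \<xi> = cnj (frechet_derivative p (at x) \<xi>)"
    by (intro frechet_derivativeI has_derivative_cnj has_derivative_polynomial assms)
  then show "T \<xi> (\<lambda>x. cnj (p x)) x = cnj (T \<xi> p x)"
    by (simp add: T_generic[OF x] dunkl_coeff_def)
qed

lemma lap_cnj:
  assumes "polynomial_function p" shows "lap (\<lambda>x. cnj (p x)) x = cnj (lap p x)"
  using assms by (simp add: dunkl_laplacian_def T_cnj polynomial_function_T)

lemma homogeneous_if_generic:
  assumes p: "polynomial_function p"
    and hom: "\<And>c x. c \<noteq> 0 \<Longrightarrow> x \<in> generic \<Longrightarrow> p (c *\<^sub>R x) = complex_of_real (c ^ m) * p x"
  shows "homogeneous m p"
proof -
  have cont: "continuous_on UNIV p" by (rule continuous_on_polynomial[OF p])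
  have 1: "p (c *\<^sub>R x) = complex_of_real (c ^ m) * p x" if c: "c \<noteq> 0" for c x
  proof (rule eq_on_generic_imp_eq[where f = "\<lambda>x. p (c *\<^sub>R x)"])
    show "p (c *\<^sub>R x) = complex_of_real (c ^ m) * p x" if "x \<in> generic" for x
      by (rule hom[OF c that])
  qed (auto intro!: continuous_intros continuous_on_compose2[OF cont] cont)
  have "p (c *\<^sub>R x) = complex_of_real (c ^ m) * p x" for c x
  proof -
    have "closed {c. p (c *\<^sub>R x) = complex_of_real (c ^ m) * p x}"
      by (rule closed_Collect_eq) (auto intro!: continuous_intros continuous_on_compose2[OF cont])
    then have "closure (- {0}) \<subseteq> {c. p (c *\<^sub>R x) = complex_of_real (c ^ m) * p x}"
      using 1 by (intro closure_minimal) auto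
    moreover have "closure (- {0::real}) = UNIV" by (simp add: closure_interior)
    ultimately show ?thesis by auto
  qed
  then show ?thesis by (simp add: homogeneous_def scaleR_conv_of_real)
qed

lemma homogeneous_T:
  assumes p: "polynomial_function p" and hom: "homogeneous (Suc m) p"
  shows "homogeneous m (T \<xi> p)"
proof (rule homogeneous_if_generic[OF polynomial_function_T[OF p]])
  fix c :: real and x assume c: "c \<noteq> 0" and x: "x \<in> generic"
  have d1: "((\<lambda>x. p (c *\<^sub>R x)) has_derivative (\<lambda>\<xi>. frechet_derivative p (at (c *\<^sub>R x)) (c *\<^sub>R \<xi>))) (at x)"
    by (rule has_derivative_compose[OF _ has_derivative_polynomial[OF p]]) (auto intro!: derivative_eq_intros)
  have d2: "((\<lambda>x. complex_of_real (c ^ Suc m) * p x) has_derivative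
      (\<lambda>\<xi>. complex_of_real (c ^ Suc m) * frechet_derivative p (at x) \<xi>)) (at x)"
    by (intro has_derivative_mult_right has_derivative_polynomial p)
  have "frechet_derivative p (at (c *\<^sub>R x)) (c *\<^sub>R \<xi>) = complex_of_real (c ^ Suc m) * frechet_derivative p (at x) \<xi>"
    using fun_cong[OF has_derivative_unique[OF d1[unfolded homogeneousD[OF hom]] d2], of \<xi>] .
  moreover have "frechet_derivative p (at (c *\<^sub>R x)) (c *\<^sub>R \<xi>) = complex_of_real c * frechet_derivative p (at (c *\<^sub>R x)) \<xi>"
    using linear_scale[OF has_derivative_linear[OF has_derivative_polynomial[OF p]]]
    by (simp add: scaleR_conv_of_real)
  ultimately have d: "frechet_derivative p (at (c *\<^sub>R x)) \<xi> = complex_of_real (c ^ m) * frechet_derivative p (at x) \<xi>"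
    using c by simp
  have "dunkl_coeff \<xi> (c *\<^sub>R x) \<alpha> * (p (c *\<^sub>R x) - p (reflection \<alpha> (c *\<^sub>R x)))
      = complex_of_real (c ^ m) * (dunkl_coeff \<xi> x \<alpha> * (p x - p (reflection \<alpha> x)))" for \<alpha>
  proof -
    have "dunkl_coeff \<xi> (c *\<^sub>R x) \<alpha> * complex_of_real (c ^ Suc m) = complex_of_real (c ^ m) * dunkl_coeff \<xi> x \<alpha>"
      using c by (simp add: dunkl_coeff_def)
    moreover have "p (c *\<^sub>R x) - p (reflection \<alpha> (c *\<^sub>R x)) = complex_of_real (c ^ Suc m) * (p x - p (reflection \<alpha> x))"
      by (simp only: linear_scale[OF linear_reflection] homogeneousD[OF hom] right_diff_distrib)
    ultimately show ?thesis by (metis mult.assoc)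
  qed
  then show "T \<xi> p (c *\<^sub>R x) = complex_of_real (c ^ m) * T \<xi> p x"
    by (simp add: T_generic[OF x] T_generic[OF scaleR_generic[OF c x]] d distrib_left sum_distrib_left)
qed

lemma T_homogeneous_0: "homogeneous 0 p \<Longrightarrow> T \<xi> p x = 0"
  using T_const[of \<xi> "p 0" x] homogeneous_0_const[of p] by (metis (no_types, lifting) ext)

lemma homogeneous_sum:
  "(\<And>i. i \<in> I \<Longrightarrow> homogeneous m (f i)) \<Longrightarrow> homogeneous m (\<lambda>x. \<Sum>i\<in>I. f i x)"
  by (simp add: homogeneous_def scaleR_sum_right)

lemma homogeneous_lap:
  assumes "polynomial_function p" "homogeneous (Suc (Suc m)) p"
  shows "homogeneous m (lap p)"
  unfolding dunkl_laplacian_def[abs_def]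
  by (intro homogeneous_sum homogeneous_T polynomial_function_T assms)

lemma lap_homogeneous_less_2:
  assumes "polynomial_function p" "homogeneous m p" "m < 2"
  shows "lap p x = 0"
proof (cases m)
  case 0
  then have "T \<xi> p = (\<lambda>x. 0)" for \<xi> using T_homogeneous_0 assms(2) by blast
  then show ?thesis by (simp add: dunkl_laplacian_def T_const)
next
  case (Suc n)
  then have "homogeneous 0 (T \<xi> p)" for \<xi> using homogeneous_T[OF assms(1), of 0] assms by simp
  then show ?thesis by (simp add: dunkl_laplacian_def T_homogeneous_0)
qed

subsection \<open>The Dunkl Laplacian of a radial function times a homogeneous polynomial\<close>

text \<open>The operator \<open>\<Sum> x\<^sub>i T\<^sub>i\<close> is the Euler operator plus a reflection term.\<close>

lemma sum_coordinate_T: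
  assumes x: "x \<in> generic" and p: "polynomial_function p" "homogeneous m p"
  shows "(\<Sum>\<xi>\<in>Basis. complex_of_real (\<xi> \<bullet> x) * T \<xi> p x)
    = complex_of_real (real m) * p x + (\<Sum>\<alpha>\<in>Rp. complex_of_real (k \<alpha>) * (p x - p (reflection \<alpha> x)))"
proof -
  let ?D = "frechet_derivative p (at x)"
  have lin: "linear ?D" by (rule has_derivative_linear[OF has_derivative_polynomial[OF p(1)]])
  have "(\<Sum>\<xi>\<in>Basis. complex_of_real (\<xi> \<bullet> x) * ?D \<xi>) = ?D (\<Sum>\<xi>\<in>Basis. (x \<bullet> \<xi>) *\<^sub>R \<xi>)"
    unfolding linear_sum[OF lin] linear_scale[OF lin] by (simp add: scaleR_conv_of_real inner_commute)
  also have "\<dots> = complex_of_real (real m) * p x"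
    by (simp add: euclidean_representation frechet_derivative_homogeneous[OF p(2,1)])
  finally have D: "(\<Sum>\<xi>\<in>Basis. complex_of_real (\<xi> \<bullet> x) * ?D \<xi>) = complex_of_real (real m) * p x" .
  have "(\<Sum>\<xi>\<in>Basis. complex_of_real (\<xi> \<bullet> x) * (\<Sum>\<alpha>\<in>Rp. dunkl_coeff \<xi> x \<alpha> * (p x - p (reflection \<alpha> x))))
      = (\<Sum>\<alpha>\<in>Rp. \<Sum>\<xi>\<in>Basis. complex_of_real (\<xi> \<bullet> x) * (dunkl_coeff \<xi> x \<alpha> * (p x - p (reflection \<alpha> x))))"
    unfolding sum_distrib_left by (rule sum.swap)
  also have "\<dots> = (\<Sum>\<alpha>\<in>Rp. complex_of_real (k \<alpha>) * (p x - p (reflection \<alpha> x)))"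
  proof (rule sum.cong[OF refl])
    fix \<alpha> assume "\<alpha> \<in> Rp"
    then have nz: "\<alpha> \<bullet> x \<noteq> 0" by (rule generic_inner_Rp[OF x])
    have "(\<Sum>\<xi>\<in>Basis. complex_of_real (\<xi> \<bullet> x) * dunkl_coeff \<xi> x \<alpha>)
        = complex_of_real (\<Sum>\<xi>\<in>Basis. ((\<alpha> \<bullet> \<xi>) * (x \<bullet> \<xi>)) * (k \<alpha> / (\<alpha> \<bullet> x)))"
      unfolding of_real_sum by (rule sum.cong) (simp_all add: dunkl_coeff_def inner_commute)
    also have "\<dots> = complex_of_real (k \<alpha>)"
      using nz unfolding sum_distrib_right[symmetric] by (simp add: euclidean_inner[symmetric])
    finally show "(\<Sum>\<xi>\<in>Basis. complex_of_real (\<xi> \<bullet> x) * (dunkl_coeff \<xi> x \<alpha> * (p x - p (reflection \<alpha> x))))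
        = complex_of_real (k \<alpha>) * (p x - p (reflection \<alpha> x))"
      by (simp only: mult.assoc[symmetric] sum_distrib_right[symmetric])
  qed
  finally show ?thesis
    by (simp add: T_generic[OF x] distrib_left sum.distrib D)
qed

text \<open>Commuting \<open>T\<^sub>i\<close> with multiplication by \<open>x\<^sub>i\<close>. Together with the preceding lemma the reflection
  terms combine to the scalar \<open>2 \<gamma>\<close>, which is why the Dunkl Laplacian of a radial multiple
  of a homogeneous polynomial involves no reflections.\<close>

lemma sum_T_coordinate:
  assumes x: "x \<in> generic" and p: "polynomial_function p"
  shows "(\<Sum>\<xi>\<in>Basis. T \<xi> (\<lambda>y. complex_of_real (\<xi> \<bullet> y) * p y) x)
    = (\<Sum>\<xi>\<in>Basis. complex_of_real (\<xi> \<bullet> x) * T \<xi> p x) + of_nat CARD('n) * p x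
      + 2 * (\<Sum>\<alpha>\<in>Rp. complex_of_real (k \<alpha>) * p (reflection \<alpha> x))"
proof -
  let ?D = "frechet_derivative p (at x)"
  have T_coordinate: "T \<xi> (\<lambda>y. complex_of_real (\<xi> \<bullet> y) * p y) x = complex_of_real (\<xi> \<bullet> x) * T \<xi> p x + p x
      + (\<Sum>\<alpha>\<in>Rp. complex_of_real (2 * k \<alpha> * ((\<alpha> \<bullet> \<xi>) * (\<alpha> \<bullet> \<xi>)) / (norm \<alpha>)\<^sup>2) * p (reflection \<alpha> x))"
    if "\<xi> \<in> Basis" for \<xi>
  proof -
    have d: "frechet_derivative (\<lambda>y. complex_of_real (\<xi> \<bullet> y) * p y) (at x) \<xi>
        = complex_of_real (\<xi> \<bullet> x) * ?D \<xi> + complex_of_real (\<xi> \<bullet> \<xi>) * p x"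
      by (rule frechet_derivativeI, rule has_derivative_mult[OF _ has_derivative_polynomial[OF p]])
        (auto intro!: derivative_eq_intros)
    have r: "dunkl_coeff \<xi> x \<alpha> *
          (complex_of_real (\<xi> \<bullet> x) * p x - complex_of_real (\<xi> \<bullet> reflection \<alpha> x) * p (reflection \<alpha> x))
        = complex_of_real (\<xi> \<bullet> x) * (dunkl_coeff \<xi> x \<alpha> * (p x - p (reflection \<alpha> x)))
          + complex_of_real (2 * k \<alpha> * ((\<alpha> \<bullet> \<xi>) * (\<alpha> \<bullet> \<xi>)) / (norm \<alpha>)\<^sup>2) * p (reflection \<alpha> x)"
      if "\<alpha> \<in> Rp" for \<alpha>
    proof -
      have nz: "\<alpha> \<bullet> x \<noteq> 0" "norm \<alpha> \<noteq> 0" using generic_inner_Rp[OF x that] Rp_nonzero[OF that] by auto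
      have "k \<alpha> * (\<alpha> \<bullet> \<xi>) / (\<alpha> \<bullet> x) * (\<xi> \<bullet> reflection \<alpha> x)
          = k \<alpha> * (\<alpha> \<bullet> \<xi>) / (\<alpha> \<bullet> x) * (\<xi> \<bullet> x) - 2 * k \<alpha> * ((\<alpha> \<bullet> \<xi>) * (\<alpha> \<bullet> \<xi>)) / (norm \<alpha>)\<^sup>2"
        unfolding inner_reflection right_diff_distrib using nz by (simp add: inner_commute)
      then have "dunkl_coeff \<xi> x \<alpha> * complex_of_real (\<xi> \<bullet> reflection \<alpha> x)
          = dunkl_coeff \<xi> x \<alpha> * complex_of_real (\<xi> \<bullet> x)
            - complex_of_real (2 * k \<alpha> * ((\<alpha> \<bullet> \<xi>) * (\<alpha> \<bullet> \<xi>)) / (norm \<alpha>)\<^sup>2)"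
        unfolding dunkl_coeff_def by (metis of_real_mult of_real_diff)
      moreover have "w * (u * P - u' * Q) = u * (w * (P - Q)) + s * Q" if "w * u' = w * u - s"
        for w u u' s P Q :: complex
        using that by algebra
      ultimately show ?thesis by blast
    qed
    have "\<xi> \<bullet> \<xi> = 1" using that by (simp add: inner_Basis)
    then show ?thesis
      by (simp add: T_generic[OF x] d r distrib_left sum_distrib_left sum.distrib cong: sum.cong)
  qed
  have "(\<Sum>\<xi>\<in>Basis. \<Sum>\<alpha>\<in>Rp. complex_of_real (2 * k \<alpha> * ((\<alpha> \<bullet> \<xi>) * (\<alpha> \<bullet> \<xi>)) / (norm \<alpha>)\<^sup>2) * p (reflection \<alpha> x))
      = (\<Sum>\<alpha>\<in>Rp. \<Sum>\<xi>\<in>Basis. complex_of_real (2 * k \<alpha> * ((\<alpha> \<bullet> \<xi>) * (\<alpha> \<bullet> \<xi>)) / (norm \<alpha>)\<^sup>2) * p (reflection \<alpha> x))"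
    by (rule sum.swap)
  also have "\<dots> = (\<Sum>\<alpha>\<in>Rp. 2 * (complex_of_real (k \<alpha>) * p (reflection \<alpha> x)))"
  proof (rule sum.cong[OF refl])
    fix \<alpha> assume \<alpha>: "\<alpha> \<in> Rp"
    have "(\<Sum>\<xi>\<in>Basis. complex_of_real (2 * k \<alpha> * ((\<alpha> \<bullet> \<xi>) * (\<alpha> \<bullet> \<xi>)) / (norm \<alpha>)\<^sup>2) * p (reflection \<alpha> x))
        = complex_of_real (2 * k \<alpha> * (\<Sum>\<xi>\<in>Basis. (\<alpha> \<bullet> \<xi>) * (\<alpha> \<bullet> \<xi>)) / (norm \<alpha>)\<^sup>2) * p (reflection \<alpha> x)"
      by (simp only: of_real_sum[symmetric] sum_distrib_right[symmetric] sum_distrib_left[symmetric]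
          sum_divide_distrib[symmetric])
    also have "(\<Sum>\<xi>\<in>Basis. (\<alpha> \<bullet> \<xi>) * (\<alpha> \<bullet> \<xi>)) = (norm \<alpha>)\<^sup>2"
      by (simp add: euclidean_inner[symmetric] power2_norm_eq_inner)
    finally show "(\<Sum>\<xi>\<in>Basis. complex_of_real (2 * k \<alpha> * ((\<alpha> \<bullet> \<xi>) * (\<alpha> \<bullet> \<xi>)) / (norm \<alpha>)\<^sup>2) * p (reflection \<alpha> x))
        = 2 * (complex_of_real (k \<alpha>) * p (reflection \<alpha> x))"
      using Rp_nonzero[OF \<alpha>] by simp
  qed
  finally show ?thesis
    by (simp add: T_coordinate sum.distrib sum_distrib_left)
qed

lemma
  assumes p: "polynomial_function p"
    and \<phi>: "\<And>s. s > 0 \<Longrightarrow> (\<phi> has_real_derivative \<phi>' s) (at s)"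
    and \<phi>': "\<And>s. s > 0 \<Longrightarrow> (\<phi>' has_real_derivative \<phi>'' s) (at s)"
    and x: "x \<in> generic"
  shows T_radial_polynomial: "T \<xi> (\<lambda>y. complex_of_real (\<phi> (y \<bullet> y)) * p y) x
      = complex_of_real (\<phi> (x \<bullet> x)) * T \<xi> p x
        + complex_of_real (2 * \<phi>' (x \<bullet> x)) * (complex_of_real (\<xi> \<bullet> x) * p x)"
    and differentiable_T_radial_polynomial:
      "T \<xi> (\<lambda>y. complex_of_real (\<phi> (y \<bullet> y)) * p y) differentiable (at x)"
    and lap_radial_polynomial: "homogeneous m p \<Longrightarrow> lap (\<lambda>y. complex_of_real (\<phi> (y \<bullet> y)) * p y) x
      = complex_of_real (\<phi> (x \<bullet> x)) * lap p x
        + complex_of_real (2 * \<phi>' (x \<bullet> x) * (2 * real m + 2 * \<gamma> + real CARD('n))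
            + 4 * (x \<bullet> x) * \<phi>'' (x \<bullet> x)) * p x"
proof -
  have pos: "y \<bullet> y > 0" if "y \<in> generic" for y using generic_nonzero[OF that] by simp
  define q where "q \<xi> y = complex_of_real (\<xi> \<bullet> y) * p y" for \<xi> y
  have q: "polynomial_function (q \<xi>)" for \<xi>
    unfolding q_def by (intro polynomial_function_complex_mult polynomial_function_of_real real_polynomial_function_inner p)
  let ?f = "\<lambda>y. complex_of_real (\<phi> (y \<bullet> y)) * p y"
  let ?g = "\<lambda>\<xi> y. complex_of_real (\<phi> (y \<bullet> y)) * T \<xi> p y + complex_of_real (2 * \<phi>' (y \<bullet> y)) * q \<xi> y"
  have Tf: "T \<xi> ?f y = ?g \<xi> y" if "y \<in> generic" for \<xi> y
    by (subst T_radial_mult[OF that differentiable_polynomial[OF p] \<phi>[OF pos[OF that]]])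
      (simp add: q_def mult_ac)
  show "T \<xi> ?f x = complex_of_real (\<phi> (x \<bullet> x)) * T \<xi> p x
        + complex_of_real (2 * \<phi>' (x \<bullet> x)) * (complex_of_real (\<xi> \<bullet> x) * p x)"
    using Tf[OF x] by (simp add: q_def)
  have \<phi>2: "((\<lambda>s. 2 * \<phi>' s) has_real_derivative 2 * \<phi>'' (x \<bullet> x)) (at (x \<bullet> x))"
    using \<phi>'[OF pos[OF x]] by (auto intro!: derivative_eq_intros)
  have d1: "(\<lambda>y. complex_of_real (\<phi> (y \<bullet> y)) * T \<xi> p y) differentiable (at x)" for \<xi>
    by (intro differentiable_radial_mult[OF _ \<phi>[OF pos[OF x]]] differentiable_polynomial polynomial_function_T p)
  have d2: "(\<lambda>y. complex_of_real (2 * \<phi>' (y \<bullet> y)) * q \<xi> y) differentiable (at x)" for \<xi>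
    by (rule differentiable_radial_mult[OF _ \<phi>2]) (rule differentiable_polynomial[OF q])
  have "?g \<xi> differentiable (at x)" for \<xi> by (intro differentiable_add d1 d2)
  then show "T \<xi> ?f differentiable (at x)"
    by (rule differentiable_cong_generic[OF x, rotated]) (simp add: Tf)
  assume m: "homogeneous m p"
  have TT: "T \<xi> (T \<xi> ?f) x = complex_of_real (\<phi> (x \<bullet> x)) * T \<xi> (T \<xi> p) x
      + complex_of_real (2 * \<phi>' (x \<bullet> x)) * (complex_of_real (\<xi> \<bullet> x) * T \<xi> p x + T \<xi> (q \<xi>) x)
      + complex_of_real (4 * ((x \<bullet> \<xi>) * (x \<bullet> \<xi>)) * \<phi>'' (x \<bullet> x)) * p x" for \<xi>
  proof -
    have "T \<xi> (T \<xi> ?f) x = T \<xi> (?g \<xi>) x" by (rule T_cong_generic[OF x Tf])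
    also have "\<dots> = T \<xi> (\<lambda>y. complex_of_real (\<phi> (y \<bullet> y)) * T \<xi> p y) x
        + T \<xi> (\<lambda>y. complex_of_real (2 * \<phi>' (y \<bullet> y)) * q \<xi> y) x"
      by (rule T_add[OF x d1 d2])
    also have "T \<xi> (\<lambda>y. complex_of_real (\<phi> (y \<bullet> y)) * T \<xi> p y) x
        = complex_of_real (\<phi> (x \<bullet> x)) * T \<xi> (T \<xi> p) x + complex_of_real (2 * (\<xi> \<bullet> x) * \<phi>' (x \<bullet> x)) * T \<xi> p x"
      by (rule T_radial_mult[OF x _ \<phi>[OF pos[OF x]]]) (rule differentiable_polynomial[OF polynomial_function_T[OF p]])
    also have "T \<xi> (\<lambda>y. complex_of_real (2 * \<phi>' (y \<bullet> y)) * q \<xi> y) x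
        = complex_of_real (2 * \<phi>' (x \<bullet> x)) * T \<xi> (q \<xi>) x + complex_of_real (2 * (\<xi> \<bullet> x) * (2 * \<phi>'' (x \<bullet> x))) * q \<xi> x"
      by (rule T_radial_mult[OF x _ \<phi>2]) (rule differentiable_polynomial[OF q])
    finally show ?thesis by (simp add: q_def inner_commute algebra_simps)
  qed
  have S1: "(\<Sum>\<xi>\<in>Basis. complex_of_real (\<xi> \<bullet> x) * T \<xi> p x + T \<xi> (q \<xi>) x)
      = complex_of_real (2 * real m + 2 * \<gamma> + real CARD('n)) * p x"
  proof -
    define A where "A = (\<Sum>\<alpha>\<in>Rp. complex_of_real (k \<alpha>) * (p x - p (reflection \<alpha> x)))"
    define B where "B = (\<Sum>\<alpha>\<in>Rp. complex_of_real (k \<alpha>) * p (reflection \<alpha> x))"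
    have AB: "A = complex_of_real \<gamma> * p x - B"
      by (simp add: A_def B_def right_diff_distrib sum_subtractf mult_index_def sum_distrib_right)
    then show ?thesis
      unfolding q_def sum.distrib sum_T_coordinate[OF x p] sum_coordinate_T[OF x p m] A_def[symmetric] B_def[symmetric] AB
      by (simp add: algebra_simps)
  qed
  have S2: "(\<Sum>\<xi>\<in>Basis. complex_of_real (4 * ((x \<bullet> \<xi>) * (x \<bullet> \<xi>)) * \<phi>'' (x \<bullet> x)) * p x)
      = complex_of_real (4 * (x \<bullet> x) * \<phi>'' (x \<bullet> x)) * p x"
    by (subst (3) euclidean_inner)
      (simp only: of_real_sum[symmetric] sum_distrib_right[symmetric] sum_distrib_left[symmetric])
  show "lap ?f x = complex_of_real (\<phi> (x \<bullet> x)) * lap p x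
        + complex_of_real (2 * \<phi>' (x \<bullet> x) * (2 * real m + 2 * \<gamma> + real CARD('n))
            + 4 * (x \<bullet> x) * \<phi>'' (x \<bullet> x)) * p x"
    unfolding dunkl_laplacian_def TT
    by (subst sum.distrib, subst sum.distrib, unfold sum_distrib_left[symmetric] S1 S2)
      (simp add: algebra_simps)
qed

end

context dunkl
begin

section \<open>Decomposition of polynomials into Dunkl harmonics\<close>

abbreviation H where "H \<equiv> dunkl_harmonics Rp k"

lemma H_iff: "p \<in> H m \<longleftrightarrow> polynomial_function p \<and> homogeneous m p \<and> (\<forall>x. lap p x = 0)"
  by (simp add: dunkl_harmonics_def homogeneous_def)

lemma H_cmult: "p \<in> H m \<Longrightarrow> (\<lambda>x. c * p x) \<in> H m"
  using lap_polynomial_cmult[of p c]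
  by (auto simp: H_iff homogeneous_def intro!: polynomial_function_complex_mult[OF polynomial_function_const])

lemma \<gamma>_nonneg: "0 \<le> \<gamma>"
  unfolding mult_index_def using k_nonneg Rp_subset by (intro sum_nonneg) auto

lemma homogeneous_radial_mult:
  fixes p :: "real ^ 'n \<Rightarrow> complex"
  assumes "homogeneous m p"
  shows "homogeneous (2 * j + m) (\<lambda>x. complex_of_real ((x \<bullet> x) ^ j) * p x)"
  unfolding homogeneous_def
proof (intro allI)
  fix c :: real and x :: "real ^ 'n"
  have "((c *\<^sub>R x) \<bullet> (c *\<^sub>R x)) ^ j = c ^ (2 * j) * (x \<bullet> x) ^ j"
    by (simp add: power_mult_distrib power_mult power2_eq_square mult.assoc[symmetric])
  then show "complex_of_real (((c *\<^sub>R x) \<bullet> (c *\<^sub>R x)) ^ j) * p (c *\<^sub>R x)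
      = (c ^ (2 * j + m)) *\<^sub>R (complex_of_real ((x \<bullet> x) ^ j) * p x)"
    by (simp only: homogeneousD[OF assms]) (simp add: scaleR_conv_of_real power_add mult_ac)
qed

lemma polynomial_function_radial_mult:
  "polynomial_function p \<Longrightarrow> polynomial_function (\<lambda>x::real ^ 'n. complex_of_real ((x \<bullet> x) ^ j) * p x)"
  by (intro polynomial_function_complex_mult polynomial_function_of_real
      real_polynomial_function_power real_polynomial_function_inner_self)

lemma lap_radial_power_harmonic:
  assumes h: "h \<in> H m"
  shows "lap (\<lambda>x. complex_of_real ((x \<bullet> x) ^ Suc j) * h x) x
    = complex_of_real (2 * real (Suc j) * (2 * real m + 2 * \<gamma> + real CARD('n) + 2 * real j)) *
        (complex_of_real ((x \<bullet> x) ^ j) * h x)"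
proof (rule eq_on_generic_imp_eq)
  have h: "polynomial_function h" "homogeneous m h" "\<And>x. lap h x = 0" using h by (auto simp: H_iff)
  show "continuous_on UNIV (lap (\<lambda>x. complex_of_real ((x \<bullet> x) ^ Suc j) * h x))"
    by (intro continuous_on_polynomial polynomial_function_lap polynomial_function_radial_mult h)
  show "continuous_on UNIV (\<lambda>x. complex_of_real (2 * real (Suc j) * (2 * real m + 2 * \<gamma> + real CARD('n) + 2 * real j)) *
        (complex_of_real ((x \<bullet> x) ^ j) * h x))"
    by (intro continuous_on_polynomial polynomial_function_radial_mult polynomial_function_complex_mult[OF polynomial_function_const] h)
  fix x assume x: "x \<in> generic"
  have 1: "((\<lambda>s. s ^ Suc j) has_real_derivative real (Suc j) * s ^ j) (at s)" for s :: real
    using DERIV_pow[of "Suc j" s] by simp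
  have 2: "((\<lambda>s. real (Suc j) * s ^ j) has_real_derivative real (Suc j) * (real j * s ^ (j - 1))) (at s)" for s :: real
    using DERIV_cmult[OF DERIV_pow[of j s], of "real (Suc j)"] by simp
  have "2 * (real (Suc j) * (x \<bullet> x) ^ j) * (2 * real m + 2 * \<gamma> + real CARD('n))
        + 4 * (x \<bullet> x) * (real (Suc j) * (real j * (x \<bullet> x) ^ (j - 1)))
      = 2 * real (Suc j) * (2 * real m + 2 * \<gamma> + real CARD('n) + 2 * real j) * (x \<bullet> x) ^ j"
    by (cases j) (simp_all add: algebra_simps)
  then show "lap (\<lambda>x. complex_of_real ((x \<bullet> x) ^ Suc j) * h x) x
      = complex_of_real (2 * real (Suc j) * (2 * real m + 2 * \<gamma> + real CARD('n) + 2 * real j)) *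
        (complex_of_real ((x \<bullet> x) ^ j) * h x)"
    using lap_radial_polynomial[OF h(1) 1 2 x h(2)] by (simp only: h(3)) (simp add: mult_ac)
qed

lemma lap_polynomial_sum:
  assumes "finite I" "\<And>i. i \<in> I \<Longrightarrow> polynomial_function (f i)"
  shows "lap (\<lambda>x. \<Sum>i\<in>I. f i x) x = (\<Sum>i\<in>I. lap (f i) x)"
  using assms
proof (induction I)
  case empty
  show ?case using lap_homogeneous_less_2[of "\<lambda>x. 0" 0] by (simp add: homogeneous_def)
next
  case (insert i I)
  then show ?case using lap_polynomial_add[of "f i" "\<lambda>x. \<Sum>i\<in>I. f i x"] by (simp add: polynomial_function_sum)
qed

text \<open>
  Subtract from \<open>p\<close> a solution \<open>q\<close>, divisible by \<open>\<parallel>x\<parallel>\<^sup>2\<close>, of \<open>\<Delta>\<^sub>k q = \<Delta>\<^sub>k p\<close>. It is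
  found summand by summand in the decomposition of \<open>\<Delta>\<^sub>k p\<close>, because the Dunkl Laplacian maps
  \<open>\<parallel>x\<parallel>^(2j+2) h\<close> to a positive multiple of \<open>\<parallel>x\<parallel>^(2j) h\<close>.
\<close>

theorem fischer_decomposition:
  assumes "polynomial_function p" "homogeneous n p"
  shows "\<exists>h. (\<forall>j\<le>n div 2. h j \<in> H (n - 2 * j)) \<and>
    (\<forall>x. p x = (\<Sum>j\<le>n div 2. complex_of_real ((x \<bullet> x) ^ j) * h j x))"
  using assms
proof (induction n arbitrary: p rule: less_induct)
  case (less n)
  show ?case
  proof (cases "n < 2")
    case True
    then have "p \<in> H n" using less.prems lap_homogeneous_less_2 by (auto simp: H_iff)
    then show ?thesis using True by (intro exI[of _ "\<lambda>_. p"]) auto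
  next
    case False
    then obtain m where n: "n = Suc (Suc m)" by (metis Suc_1 less_Suc0 not_less_less_Suc_eq old.nat.exhaust less_2_cases_iff numeral_2_eq_2)
    define M where "M = m div 2"
    have nM: "n div 2 = Suc M" by (simp add: n M_def)
    have "homogeneous m (lap p)" using homogeneous_lap less.prems n by blast
    then obtain g where g: "\<And>j. j \<le> M \<Longrightarrow> g j \<in> H (m - 2 * j)"
      "\<And>x. lap p x = (\<Sum>j\<le>M. complex_of_real ((x \<bullet> x) ^ j) * g j x)"
      using less.IH[of m "lap p"] less.prems(1) n by (auto simp: polynomial_function_lap M_def)
    define c where "c j = 2 * real (Suc j) * (2 * real (m - 2 * j) + 2 * \<gamma> + real CARD('n) + 2 * real j)" for j
    have c: "c j > 0" for j
    proof -
      have "real CARD('n) > 0" by simp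
      then have "2 * real (m - 2 * j) + 2 * \<gamma> + real CARD('n) + 2 * real j > 0" using \<gamma>_nonneg by linarith
      then show ?thesis unfolding c_def by (intro mult_pos_pos) auto
    qed
    define q where "q j x = complex_of_real ((x \<bullet> x) ^ Suc j) * (complex_of_real (1 / c j) * g j x)" for j x
    have gc: "(\<lambda>x. complex_of_real (1 / c j) * g j x) \<in> H (m - 2 * j)" if "j \<le> M" for j
      by (rule H_cmult[OF g(1)[OF that]])
    have q_poly: "polynomial_function (q j)" if "j \<le> M" for j
      unfolding q_def[abs_def] using gc[OF that] by (intro polynomial_function_radial_mult) (simp add: H_iff)
    have q_hom: "homogeneous n (q j)" if "j \<le> M" for j
    proof -
      have "homogeneous (2 * Suc j + (m - 2 * j)) (q j)"
        unfolding q_def[abs_def] using gc[OF that] by (intro homogeneous_radial_mult) (simp add: H_iff)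
      then show ?thesis using that by (simp add: n M_def)
    qed
    have q_lap: "lap (q j) x = complex_of_real ((x \<bullet> x) ^ j) * g j x" if "j \<le> M" for j x
      unfolding q_def[abs_def] lap_radial_power_harmonic[OF gc[OF that]] c_def[symmetric]
      using c[of j] by simp
    define h0 where "h0 x = p x - (\<Sum>j\<le>M. q j x)" for x
    have sum_poly: "polynomial_function (\<lambda>x. \<Sum>j\<le>M. q j x)" using q_poly by (intro polynomial_function_sum) auto
    have h0: "h0 \<in> H n"
      unfolding H_iff
    proof (intro conjI allI)
      show "polynomial_function h0" unfolding h0_def[abs_def] using less.prems(1) sum_poly by (rule polynomial_function_diff)
      have "homogeneous n (\<lambda>x. \<Sum>j\<le>M. q j x)" by (intro homogeneous_sum q_hom) auto
      with less.prems(2) show "homogeneous n h0" by (simp add: h0_def homogeneous_def scaleR_diff_right)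
      fix x
      have "lap (\<lambda>x. p x + (- 1) * (\<Sum>j\<le>M. q j x)) x = lap p x + (- 1) * lap (\<lambda>x. \<Sum>j\<le>M. q j x) x"
        using less.prems(1) sum_poly
        by (simp only: lap_polynomial_add lap_polynomial_cmult polynomial_function_complex_mult polynomial_function_const)
      also have "lap (\<lambda>x. \<Sum>j\<le>M. q j x) x = (\<Sum>j\<le>M. lap (q j) x)"
        using q_poly by (intro lap_polynomial_sum) auto
      finally show "lap h0 x = 0" using q_lap by (simp add: h0_def[abs_def] g(2))
    qed
    define h where "h j x = (case j of 0 \<Rightarrow> h0 x | Suc i \<Rightarrow> complex_of_real (1 / c i) * g i x)" for j x
    have "h j \<in> H (n - 2 * j)" if "j \<le> n div 2" for j
    proof (cases j)
      case 0
      then show ?thesis using h0 by (simp add: h_def[abs_def])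
    next
      case (Suc i)
      then show ?thesis using gc[of i] that unfolding nM by (simp add: h_def[abs_def] n)
    qed
    moreover have "p x = (\<Sum>j\<le>n div 2. complex_of_real ((x \<bullet> x) ^ j) * h j x)" for x
      unfolding nM sum.atMost_Suc_shift by (simp add: h_def h0_def q_def del: power_Suc)
    ultimately show ?thesis by blast
  qed
qed

section \<open>Orthogonality of Dunkl harmonics\<close>

text \<open>The weight with the convention \<open>0\<^sup>0 = 1\<close>, which makes it continuous.\<close>

definition wt :: "real ^ 'n \<Rightarrow> real" where
  "wt x = (\<Prod>\<alpha>\<in>R. if k \<alpha> = 0 then 1 else \<bar>\<alpha> \<bullet> x\<bar> powr k \<alpha>)"

lemma wt_nonneg: "0 \<le> wt x"
  unfolding wt_def by (intro prod_nonneg) auto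

lemma continuous_on_prod_powr:
  "S \<subseteq> R \<Longrightarrow> continuous_on X (\<lambda>x. \<Prod>\<alpha>\<in>S. if k \<alpha> = 0 then 1 else \<bar>\<alpha> \<bullet> x\<bar> powr k \<alpha>)"
proof (intro continuous_on_prod)
  fix \<alpha> assume "S \<subseteq> R" "\<alpha> \<in> S"
  then have "k \<alpha> \<ge> 0" using k_nonneg by blast
  then show "continuous_on X (\<lambda>x. if k \<alpha> = 0 then 1 else \<bar>\<alpha> \<bullet> x\<bar> powr k \<alpha>)"
    by (cases "k \<alpha> = 0") (auto intro!: continuous_intros continuous_on_powr')
qed

lemma continuous_on_wt: "continuous_on X wt"
  unfolding wt_def[abs_def] by (rule continuous_on_prod_powr) simp

lemma borel_measurable_wt[measurable]: "wt \<in> borel_measurable borel"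
  by (rule borel_measurable_continuous_onI[OF continuous_on_wt])

lemma wt_reflection:
  assumes "\<beta> \<in> R" shows "wt (reflection \<beta> x) = wt x"
proof -
  have inj: "inj_on (reflection \<beta>) R"
    by (rule inj_on_inverseI[of _ "reflection \<beta>"]) (simp add: reflection_involution R_nonzero[OF assms])
  let ?f = "\<lambda>\<alpha>. if k \<alpha> = 0 then 1 else \<bar>\<alpha> \<bullet> x\<bar> powr k \<alpha>"
  have "wt x = (\<Prod>\<alpha>\<in>reflection \<beta> ` R. ?f \<alpha>)" unfolding reflection_image_R[OF assms] by (simp add: wt_def)
  also have "\<dots> = (\<Prod>\<alpha>\<in>R. ?f (reflection \<beta> \<alpha>))" by (subst prod.reindex[OF inj]) simp
  also have "\<dots> = wt (reflection \<beta> x)"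
    unfolding wt_def by (rule prod.cong) (auto simp: k_reflection[OF assms] inner_reflection_swap)
  finally show ?thesis ..
qed

lemma sum_k_R: "(\<Sum>\<alpha>\<in>R. k \<alpha>) = 2 * \<gamma>"
  using sum_R_eq_sum_Rp[of k] by (simp add: k_uminus mult_index_def)

lemma wt_scaleR:
  assumes "c > 0" shows "wt (c *\<^sub>R x) = c powr (2 * \<gamma>) * wt x"
proof -
  have "wt (c *\<^sub>R x) = (\<Prod>\<alpha>\<in>R. c powr k \<alpha> * (if k \<alpha> = 0 then 1 else \<bar>\<alpha> \<bullet> x\<bar> powr k \<alpha>))"
    unfolding wt_def using assms by (intro prod.cong refl) (auto simp: abs_mult powr_mult)
  also have "\<dots> = (\<Prod>\<alpha>\<in>R. c powr k \<alpha>) * wt x" by (simp add: prod.distrib wt_def)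
  also have "(\<Prod>\<alpha>\<in>R. c powr k \<alpha>) = c powr (2 * \<gamma>)"
    unfolding sum_k_R[symmetric] by (rule powr_sum[symmetric]) (use assms in auto)
  finally show ?thesis .
qed

text \<open>Logarithmic differentiation; writing \<open>ln \<bar>y\<bar>\<close> as \<open>ln (y\<^sup>2) / 2\<close> makes all signs irrelevant.\<close>

lemma has_derivative_wt:
  assumes x: "x \<in> generic"
  shows "(wt has_derivative (\<lambda>v. wt x * (\<Sum>\<alpha>\<in>R. k \<alpha> * (\<alpha> \<bullet> v) / (\<alpha> \<bullet> x)))) (at x)"
proof -
  let ?e = "\<lambda>y. exp (\<Sum>\<alpha>\<in>R. k \<alpha> * (ln ((\<alpha> \<bullet> y)\<^sup>2) / 2))"
  have eq: "wt y = ?e y" if "y \<in> generic" for y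
  proof -
    have "?e y = (\<Prod>\<alpha>\<in>R. exp (k \<alpha> * (ln ((\<alpha> \<bullet> y)\<^sup>2) / 2)))" by (simp add: exp_sum)
    also have "\<dots> = wt y"
      unfolding wt_def
    proof (rule prod.cong[OF refl])
      fix \<alpha> assume "\<alpha> \<in> R"
      then have nz: "\<alpha> \<bullet> y \<noteq> 0" using generic_inner[OF that] by simp
      have "ln ((\<alpha> \<bullet> y)\<^sup>2) / 2 = ln \<bar>\<alpha> \<bullet> y\<bar>"
        using nz ln_realpow[of "\<bar>\<alpha> \<bullet> y\<bar>" 2] by simp
      then show "exp (k \<alpha> * (ln ((\<alpha> \<bullet> y)\<^sup>2) / 2)) = (if k \<alpha> = 0 then 1 else \<bar>\<alpha> \<bullet> y\<bar> powr k \<alpha>)"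
        using nz by (simp add: powr_def)
    qed
    finally show ?thesis ..
  qed
  have ln: "((\<lambda>y. k \<alpha> * (ln ((\<alpha> \<bullet> y)\<^sup>2) / 2)) has_derivative (\<lambda>v. k \<alpha> * (\<alpha> \<bullet> v) / (\<alpha> \<bullet> x))) (at x)"
    if "\<alpha> \<in> R" for \<alpha>
  proof -
    have nz: "\<alpha> \<bullet> x \<noteq> 0" using generic_inner[OF x that] .
    have "(ln has_real_derivative inverse ((\<alpha> \<bullet> x)\<^sup>2)) (at ((\<alpha> \<bullet> x)\<^sup>2))"
      using nz by (intro DERIV_ln) simp
    moreover have "((\<lambda>u. u\<^sup>2) has_real_derivative 2 * (\<alpha> \<bullet> x)) (at (\<alpha> \<bullet> x))"
      using DERIV_pow[of 2 "\<alpha> \<bullet> x"] by simp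
    ultimately have "((\<lambda>u. ln (u\<^sup>2)) has_real_derivative inverse ((\<alpha> \<bullet> x)\<^sup>2) * (2 * (\<alpha> \<bullet> x))) (at (\<alpha> \<bullet> x))"
      by (rule DERIV_chain2)
    then have "((\<lambda>u. k \<alpha> * (ln (u\<^sup>2) / 2)) has_real_derivative
        k \<alpha> * (inverse ((\<alpha> \<bullet> x)\<^sup>2) * (2 * (\<alpha> \<bullet> x)) / 2)) (at (\<alpha> \<bullet> x))"
      by (intro DERIV_cmult DERIV_cdivide)
    moreover have "k \<alpha> * (inverse ((\<alpha> \<bullet> x)\<^sup>2) * (2 * (\<alpha> \<bullet> x)) / 2) = k \<alpha> / (\<alpha> \<bullet> x)"
      using nz by (simp add: power2_eq_square field_simps)
    ultimately have "((\<lambda>u. k \<alpha> * (ln (u\<^sup>2) / 2)) has_real_derivative k \<alpha> / (\<alpha> \<bullet> x)) (at (\<alpha> \<bullet> x))"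
      by (simp only:)
    moreover have "((\<lambda>y. \<alpha> \<bullet> y) has_derivative (\<lambda>v. \<alpha> \<bullet> v)) (at x)"
      by (auto intro!: derivative_eq_intros)
    ultimately show ?thesis
      using has_derivative_compose[of "\<lambda>y. \<alpha> \<bullet> y" "\<lambda>v. \<alpha> \<bullet> v" x UNIV "\<lambda>u. k \<alpha> * (ln (u\<^sup>2) / 2)" "(*) (k \<alpha> / (\<alpha> \<bullet> x))"]
      by (simp add: has_field_derivative_def)
  qed
  have "(?e has_derivative (\<lambda>v. ?e x * (\<Sum>\<alpha>\<in>R. k \<alpha> * (\<alpha> \<bullet> v) / (\<alpha> \<bullet> x)))) (at x)"
    using has_derivative_exp[OF has_derivative_sum[OF ln, of R "\<lambda>\<alpha>. \<alpha>"]] by (simp only: mult.commute)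
  then have "(?e has_derivative (\<lambda>v. wt x * (\<Sum>\<alpha>\<in>R. k \<alpha> * (\<alpha> \<bullet> v) / (\<alpha> \<bullet> x)))) (at x)"
    by (simp add: eq[OF x])
  then show ?thesis
    by (rule has_derivative_transform_within_open[OF _ open_generic x]) (simp add: eq)
qed

text \<open>Both integrals are over the unit ball; the second has the logarithmic derivative of the
  weight as an additional, integrable factor.\<close>

definition ball_integral :: "(real ^ 'n \<Rightarrow> complex) \<Rightarrow> complex" where
  "ball_integral P = (LINT x|lborel. indicator (cball 0 1) x *\<^sub>R (complex_of_real (wt x) * P x))"

definition singular_integrand :: "real ^ 'n \<Rightarrow> (real ^ 'n \<Rightarrow> complex) \<Rightarrow> real ^ 'n \<Rightarrow> complex" where
  "singular_integrand \<alpha> P x =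
    indicator (cball 0 1) x *\<^sub>R (complex_of_real (wt x * (k \<alpha> / (\<alpha> \<bullet> x))) * P x)"

definition singular_integral :: "real ^ 'n \<Rightarrow> (real ^ 'n \<Rightarrow> complex) \<Rightarrow> complex" where
  "singular_integral \<alpha> P = (LINT x|lborel. singular_integrand \<alpha> P x)"

lemma integrable_ball:
  assumes "continuous_on UNIV P"
  shows "integrable lborel (\<lambda>x. indicator (cball 0 1) x *\<^sub>R (complex_of_real (wt x) * P x))"
  by (rule borel_integrable_compact)
    (auto intro!: continuous_intros continuous_on_wt continuous_on_subset[OF assms])

text \<open>The roots \<open>\<alpha>\<close> and \<open>- \<alpha>\<close> both contribute to the weight, so if \<open>k \<alpha> > 0\<close>, its quotient by
  \<open>\<alpha> \<bullet> x\<close> is bounded by a multiple of \<open>\<bar>\<alpha> \<bullet> x\<bar> powr (2 * k \<alpha> - 1)\<close>, whose exponent exceeds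
  \<open>-1\<close>.\<close>

lemma integrable_singular:
  assumes \<alpha>: "\<alpha> \<in> R" and P: "continuous_on UNIV P"
  shows "integrable lborel (singular_integrand \<alpha> P)"
proof (cases "k \<alpha> = 0")
  case True
  then show ?thesis by (simp add: singular_integrand_def[abs_def])
next
  case False
  then have kpos: "k \<alpha> > 0" using k_nonneg[OF \<alpha>] by simp
  have [measurable]: "P \<in> borel_measurable borel" by (rule borel_measurable_continuous_onI[OF P])
  let ?f = "\<lambda>\<alpha> x. if k \<alpha> = 0 then 1 else \<bar>\<alpha> \<bullet> x\<bar> powr k \<alpha>"
  define rest where "rest x = (\<Prod>\<beta>\<in>R - {\<alpha>} - {- \<alpha>}. ?f \<beta> x)" for x
  have ne: "\<alpha> \<noteq> - \<alpha>" using R_nonzero[OF \<alpha>] by (simp add: eq_neg_iff_add_eq_0 scaleR_2[symmetric])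
  have "wt x = ?f \<alpha> x * (?f (- \<alpha>) x * rest x)" for x
    unfolding wt_def rest_def using \<alpha> uminus_in_R[OF \<alpha>] ne
    by (subst prod.remove[of R \<alpha>], simp, simp, subst prod.remove[of "R - {\<alpha>}" "- \<alpha>"]) auto
  then have wt: "wt x = \<bar>\<alpha> \<bullet> x\<bar> powr (2 * k \<alpha>) * rest x" for x
    using False by (simp add: k_uminus[OF \<alpha>] powr_add[symmetric])
  have cont: "continuous_on (cball 0 1) (\<lambda>x. complex_of_real (rest x * k \<alpha>) * P x)"
    unfolding rest_def by (intro continuous_intros continuous_on_prod_powr continuous_on_subset[OF P]) auto
  have "compact ((\<lambda>x. complex_of_real (rest x * k \<alpha>) * P x) ` cball 0 1)"
    by (intro compact_continuous_image cont) auto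
  then have "bounded ((\<lambda>x. complex_of_real (rest x * k \<alpha>) * P x) ` cball 0 1)"
    by (rule compact_imp_bounded)
  then obtain C where "C > 0" "\<forall>z\<in>(\<lambda>x. complex_of_real (rest x * k \<alpha>) * P x) ` cball 0 1. norm z \<le> C"
    unfolding bounded_pos by blast
  then have C: "C > 0" "\<And>x. x \<in> cball 0 1 \<Longrightarrow> norm (complex_of_real (rest x * k \<alpha>) * P x) \<le> C"
    by auto
  show ?thesis
  proof (rule Bochner_Integration.integrable_bound)
    have "integrable lborel (\<lambda>x. indicator (cball 0 1) x * \<bar>\<alpha> \<bullet> x\<bar> powr (2 * k \<alpha> - 1))"
    proof (rule integrableI_bounded)
      have "(\<integral>\<^sup>+x. ennreal (norm (indicator (cball 0 1) x * \<bar>\<alpha> \<bullet> x\<bar> powr (2 * k \<alpha> - 1))) \<partial>lborel)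
          = (\<integral>\<^sup>+x. indicator (cball 0 1) x * ennreal (\<bar>\<alpha> \<bullet> x\<bar> powr (2 * k \<alpha> - 1)) \<partial>lborel)"
        by (intro nn_integral_cong) (auto simp: indicator_def)
      then show "(\<integral>\<^sup>+x. ennreal (norm (indicator (cball 0 1) x * \<bar>\<alpha> \<bullet> x\<bar> powr (2 * k \<alpha> - 1))) \<partial>lborel) < \<infinity>"
        using nn_integral_abs_inner_powr_finite[of "2 * k \<alpha> - 1" \<alpha> 1] kpos R_nonzero[OF \<alpha>] by simp
    qed simp
    then show "integrable lborel (\<lambda>x. C * (indicator (cball 0 1) x * \<bar>\<alpha> \<bullet> x\<bar> powr (2 * k \<alpha> - 1)))"
      by simp
    show "singular_integrand \<alpha> P \<in> borel_measurable lborel"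
      unfolding singular_integrand_def[abs_def] by measurable
    show "AE x in lborel. norm (singular_integrand \<alpha> P x)
        \<le> norm (C * (indicator (cball 0 1) x * \<bar>\<alpha> \<bullet> x\<bar> powr (2 * k \<alpha> - 1)))"
    proof (rule AE_I2)
      fix x
      show "norm (singular_integrand \<alpha> P x) \<le> norm (C * (indicator (cball 0 1) x * \<bar>\<alpha> \<bullet> x\<bar> powr (2 * k \<alpha> - 1)))"
      proof (cases "x \<in> cball 0 1 \<and> \<alpha> \<bullet> x \<noteq> 0")
        case True
        then have p: "\<bar>\<alpha> \<bullet> x\<bar> powr (2 * k \<alpha>) / \<bar>\<alpha> \<bullet> x\<bar> = \<bar>\<alpha> \<bullet> x\<bar> powr (2 * k \<alpha> - 1)"
          by (simp add: powr_diff)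
        have "norm (singular_integrand \<alpha> P x)
            = \<bar>\<alpha> \<bullet> x\<bar> powr (2 * k \<alpha>) / \<bar>\<alpha> \<bullet> x\<bar> * norm (complex_of_real (rest x * k \<alpha>) * P x)"
          using True by (simp add: singular_integrand_def wt norm_mult norm_divide abs_mult)
        also have "\<dots> \<le> \<bar>\<alpha> \<bullet> x\<bar> powr (2 * k \<alpha> - 1) * C"
          unfolding p using C(2) True by (intro mult_left_mono) auto
        finally show ?thesis using True C(1) by (simp add: mult.commute)
      next
        case False
        then have "singular_integrand \<alpha> P x = 0" by (auto simp: singular_integrand_def)
        then show ?thesis by simp
      qed
    qed
  qed
qed

lemma ball_integral_add:
  "continuous_on UNIV P \<Longrightarrow> continuous_on UNIV Q \<Longrightarrow>
    ball_integral (\<lambda>x. P x + Q x) = ball_integral P + ball_integral Q"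
  unfolding ball_integral_def
  by (subst Bochner_Integration.integral_add[symmetric]) (auto intro!: integrable_ball simp: distrib_left scaleR_add_right)

lemma ball_integral_cmult: "ball_integral (\<lambda>x. c * P x) = c * ball_integral P"
  unfolding ball_integral_def integral_mult_right_zero[symmetric]
  by (intro Bochner_Integration.integral_cong) (auto simp: indicator_def)

lemma ball_integral_sum:
  assumes "\<And>i. i \<in> I \<Longrightarrow> continuous_on UNIV (P i)"
  shows "ball_integral (\<lambda>x. \<Sum>i\<in>I. P i x) = (\<Sum>i\<in>I. ball_integral (P i))"
  unfolding ball_integral_def
  by (subst Bochner_Integration.integral_sum[symmetric])
    (auto intro!: integrable_ball assms simp: scaleR_sum_right sum_distrib_left)

lemma ball_integral_cong_generic:
  assumes "continuous_on UNIV P" "continuous_on UNIV Q" "\<And>x. x \<in> generic \<Longrightarrow> P x = Q x"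
  shows "ball_integral P = ball_integral Q"
  unfolding ball_integral_def
proof (rule integral_cong_AE)
  note [measurable] = borel_measurable_continuous_onI[OF assms(1)] borel_measurable_continuous_onI[OF assms(2)]
  show "(\<lambda>x. indicator (cball 0 1) x *\<^sub>R (complex_of_real (wt x) * P x)) \<in> borel_measurable lborel"
    "(\<lambda>x. indicator (cball 0 1) x *\<^sub>R (complex_of_real (wt x) * Q x)) \<in> borel_measurable lborel"
    by measurable
  show "AE x in lborel. indicator (cball 0 1) x *\<^sub>R (complex_of_real (wt x) * P x)
      = indicator (cball 0 1) x *\<^sub>R (complex_of_real (wt x) * Q x)"
    using AE_generic_lborel by eventually_elim (simp add: assms(3))
qed

lemma integral_lborel_reflection:
  fixes f :: "real ^ 'n \<Rightarrow> complex"
  assumes [measurable]: "f \<in> borel_measurable borel" and \<alpha>: "\<alpha> \<noteq> 0"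
  shows "(LINT x|lborel. f (reflection \<alpha> x)) = (LINT x|lborel. f x)"
proof -
  have "reflection \<alpha> \<in> borel_measurable borel"
    using linear_reflection[of \<alpha>]
    by (intro borel_measurable_continuous_onI linear_continuous_on linear_conv_bounded_linear[THEN iffD1])
  then show ?thesis
    by (subst (2) lborel_distr_orthogonal[OF orthogonal_transformation_reflection[OF \<alpha>], symmetric],
        subst integral_distr) auto
qed

lemma ball_integral_reflection:
  assumes \<alpha>: "\<alpha> \<in> R" and P: "continuous_on UNIV P"
  shows "ball_integral (\<lambda>x. P (reflection \<alpha> x)) = ball_integral P"
proof -
  have [measurable]: "P \<in> borel_measurable borel" by (rule borel_measurable_continuous_onI[OF P])
  have "ball_integral P = (LINT x|lborel. indicator (cball 0 1) (reflection \<alpha> x) *\<^sub>R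
      (complex_of_real (wt (reflection \<alpha> x)) * P (reflection \<alpha> x)))"
    unfolding ball_integral_def by (rule integral_lborel_reflection[symmetric]) (auto simp: R_nonzero[OF \<alpha>])
  also have "\<dots> = ball_integral (\<lambda>x. P (reflection \<alpha> x))"
    unfolding ball_integral_def
    by (intro Bochner_Integration.integral_cong refl)
      (simp add: wt_reflection[OF \<alpha>] indicator_def norm_reflection[OF R_nonzero[OF \<alpha>]])
  finally show ?thesis ..
qed

lemma borel_measurable_singular_integrand:
  assumes [measurable]: "P \<in> borel_measurable borel"
  shows "singular_integrand \<alpha> P \<in> borel_measurable borel"
  unfolding singular_integrand_def[abs_def] by measurable

lemma singular_integral_reflection:
  assumes \<alpha>: "\<alpha> \<in> R" and P: "continuous_on UNIV P"
  shows "singular_integral \<alpha> (\<lambda>x. P (reflection \<alpha> x)) = - singular_integral \<alpha> P"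
proof -
  have "singular_integrand \<alpha> P (reflection \<alpha> x) = - singular_integrand \<alpha> (\<lambda>x. P (reflection \<alpha> x)) x" for x
  proof -
    have "indicator (cball 0 1) (reflection \<alpha> x) = (indicator (cball 0 1) x :: real)"
      by (simp add: indicator_def norm_reflection[OF R_nonzero[OF \<alpha>]])
    then show ?thesis
      unfolding singular_integrand_def wt_reflection[OF \<alpha>] inner_self_reflection[OF R_nonzero[OF \<alpha>]]
      by simp
  qed
  moreover have "(LINT x|lborel. singular_integrand \<alpha> P (reflection \<alpha> x)) = singular_integral \<alpha> P"
    unfolding singular_integral_def
    by (intro integral_lborel_reflection borel_measurable_singular_integrand
      borel_measurable_continuous_onI[OF P] R_nonzero[OF \<alpha>])
  ultimately have "- singular_integral \<alpha> (\<lambda>x. P (reflection \<alpha> x)) = singular_integral \<alpha> P"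
    by (simp add: singular_integral_def)
  then show ?thesis by (metis add.inverse_inverse)
qed

lemma singular_integral_add:
  assumes "\<alpha> \<in> R" "continuous_on UNIV P" "continuous_on UNIV Q"
  shows "singular_integral \<alpha> (\<lambda>x. P x + Q x) = singular_integral \<alpha> P + singular_integral \<alpha> Q"
proof -
  have "singular_integrand \<alpha> (\<lambda>x. P x + Q x) = (\<lambda>x. singular_integrand \<alpha> P x + singular_integrand \<alpha> Q x)"
    by (rule ext) (simp only: singular_integrand_def distrib_left scaleR_add_right)
  then show ?thesis using integrable_singular assms by (simp add: singular_integral_def)
qed

lemma finite_affine_zeros:
  fixes a b :: real
  assumes "a \<noteq> 0 \<or> b \<noteq> 0" shows "finite {t. a + t * b = 0}"
proof (cases "b = 0")
  case False
  then have "{t. a + t * b = 0} \<subseteq> {- a / b}" by (auto simp: field_simps eq_neg_iff_add_eq_0 add.commute)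
  then show ?thesis by (rule finite_subset) simp
qed (use assms in simp)

lemma finite_line_exceptions:
  assumes x: "x \<in> generic" and \<xi>: "\<xi> \<noteq> 0"
  shows "finite {t. x + t *\<^sub>R \<xi> \<notin> generic \<or> (x + t *\<^sub>R \<xi>) \<bullet> (x + t *\<^sub>R \<xi>) = 1}"
proof -
  have 1: "finite {t. \<xi> \<bullet> x + t * (\<xi> \<bullet> \<xi>) = 0}" using \<xi> by (intro finite_affine_zeros) simp
  have 2: "finite (\<Union>\<alpha>\<in>R. {t. \<alpha> \<bullet> x + t * (\<alpha> \<bullet> \<xi>) = 0})"
    using generic_inner[OF x] by (auto intro!: finite_affine_zeros)
  let ?p = "[:x \<bullet> x - 1, 2 * (x \<bullet> \<xi>), \<xi> \<bullet> \<xi>:]"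
  have 3: "finite {t. poly ?p t = 0}" using \<xi> by (intro poly_roots_finite) auto
  have "{t. x + t *\<^sub>R \<xi> \<notin> generic \<or> (x + t *\<^sub>R \<xi>) \<bullet> (x + t *\<^sub>R \<xi>) = 1}
      \<subseteq> {t. \<xi> \<bullet> x + t * (\<xi> \<bullet> \<xi>) = 0} \<union> (\<Union>\<alpha>\<in>R. {t. \<alpha> \<bullet> x + t * (\<alpha> \<bullet> \<xi>) = 0}) \<union> {t. poly ?p t = 0}"
  proof
    fix t assume t: "t \<in> {t. x + t *\<^sub>R \<xi> \<notin> generic \<or> (x + t *\<^sub>R \<xi>) \<bullet> (x + t *\<^sub>R \<xi>) = 1}"
    have "\<xi> \<bullet> x + t * (\<xi> \<bullet> \<xi>) = \<xi> \<bullet> (x + t *\<^sub>R \<xi>)" "\<alpha> \<bullet> x + t * (\<alpha> \<bullet> \<xi>) = \<alpha> \<bullet> (x + t *\<^sub>R \<xi>)" for \<alpha>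
      by (simp_all add: inner_add_right)
    moreover have "poly ?p t = (x + t *\<^sub>R \<xi>) \<bullet> (x + t *\<^sub>R \<xi>) - 1"
      by (simp add: inner_add_left inner_add_right inner_commute algebra_simps)
    ultimately show "t \<in> {t. \<xi> \<bullet> x + t * (\<xi> \<bullet> \<xi>) = 0} \<union> (\<Union>\<alpha>\<in>R. {t. \<alpha> \<bullet> x + t * (\<alpha> \<bullet> \<xi>) = 0}) \<union> {t. poly ?p t = 0}"
      using t by (auto simp: generic_def)
  qed
  then show ?thesis by (rule finite_subset) (use 1 2 3 in blast)
qed

text \<open>The divergence theorem on the ball for the function \<open>(1 - \<parallel>x\<parallel>\<^sup>2) P wt\<close>, which vanishes on the
  sphere and hence extends continuously by \<open>0\<close>.\<close>

lemma ball_integral_derivative: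
  assumes P: "polynomial_function P" and \<xi>: "\<xi> \<noteq> 0"
  defines "G \<equiv> \<lambda>x. complex_of_real (1 - x \<bullet> x) * P x"
  shows "ball_integral (\<lambda>x. frechet_derivative G (at x) \<xi>)
    + (\<Sum>\<alpha>\<in>R. complex_of_real (\<alpha> \<bullet> \<xi>) * singular_integral \<alpha> G) = 0"
proof -
  have G: "polynomial_function G"
    unfolding G_def using P
    by (intro polynomial_function_complex_mult polynomial_function_of_real real_polynomial_function_diff
      real_polynomial_function.intros(2) real_polynomial_function_inner_self)
  have Gc: "continuous_on UNIV G" by (rule continuous_on_polynomial[OF G])
  let ?DG = "\<lambda>x. frechet_derivative G (at x) \<xi>"
  have DGc: "continuous_on UNIV ?DG"
    by (rule continuous_on_polynomial[OF polynomial_function_directional_derivative[OF G]])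
  define u where "u x = complex_of_real (max 0 (1 - x \<bullet> x) * wt x) * P x" for x
  define v where "v x = indicator (cball 0 1) x *\<^sub>R (complex_of_real (wt x) * ?DG x)
      + (\<Sum>\<alpha>\<in>R. complex_of_real (\<alpha> \<bullet> \<xi>) * singular_integrand \<alpha> G x)" for x
  have iv: "integrable lborel v"
    unfolding v_def[abs_def] using integrable_singular[OF _ Gc] integrable_ball[OF DGc]
    by (intro Bochner_Integration.integrable_add Bochner_Integration.integrable_sum integrable_mult_right) auto
  have uc: "continuous_on UNIV u"
    unfolding u_def[abs_def]
    by (intro continuous_intros continuous_on_wt continuous_on_polynomial[OF P])
  have norm1: "x \<bullet> x \<le> 1 \<longleftrightarrow> x \<in> cball 0 1" for x :: "real ^ 'n"
    by (simp add: power2_norm_eq_inner[symmetric] abs_square_le_1)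
  have u_ind: "u x = indicator (cball 0 1) x *\<^sub>R u x" for x
    using norm1[of x] by (auto simp: u_def indicator_def)
  have iu: "integrable lborel u"
    using borel_integrable_compact[of "cball 0 1" u] continuous_on_subset[OF uc] u_ind[symmetric] by simp
  have D: "(u has_derivative (\<lambda>w. if y \<bullet> y < 1 then complex_of_real (wt y) * frechet_derivative G (at y) w
        + complex_of_real (wt y * (\<Sum>\<alpha>\<in>R. k \<alpha> * (\<alpha> \<bullet> w) / (\<alpha> \<bullet> y))) * G y else 0)) (at y)"
    if y: "y \<in> generic" "y \<bullet> y \<noteq> 1" for y
  proof (cases "y \<bullet> y < 1")
    case True
    have o: "open {y::real ^ 'n. y \<bullet> y < 1}" by (intro open_Collect_less continuous_intros)
    have "((\<lambda>y. complex_of_real (wt y) * G y) has_derivative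
        (\<lambda>w. complex_of_real (wt y) * frechet_derivative G (at y) w
          + complex_of_real (wt y * (\<Sum>\<alpha>\<in>R. k \<alpha> * (\<alpha> \<bullet> w) / (\<alpha> \<bullet> y))) * G y)) (at y)"
      by (intro has_derivative_mult has_derivative_of_real has_derivative_wt y has_derivative_polynomial G)
    then have "(u has_derivative (\<lambda>w. complex_of_real (wt y) * frechet_derivative G (at y) w
          + complex_of_real (wt y * (\<Sum>\<alpha>\<in>R. k \<alpha> * (\<alpha> \<bullet> w) / (\<alpha> \<bullet> y))) * G y)) (at y)"
      by (rule has_derivative_transform_within_open[OF _ o]) (use True in \<open>auto simp: u_def G_def mult_ac\<close>)
    with True show ?thesis by simp
  next
    case False
    have o: "open {y::real ^ 'n. y \<bullet> y > 1}" by (intro open_Collect_less continuous_intros)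
    have "(u has_derivative (\<lambda>w. 0)) (at y)"
      by (rule has_derivative_transform_within_open[OF has_derivative_const o]) (use y False in \<open>auto simp: u_def\<close>)
    with False show ?thesis by simp
  qed
  have v_eq: "v y = (if y \<bullet> y < 1 then complex_of_real (wt y) * ?DG y
        + complex_of_real (wt y * (\<Sum>\<alpha>\<in>R. k \<alpha> * (\<alpha> \<bullet> \<xi>) / (\<alpha> \<bullet> y))) * G y else 0)" if "y \<bullet> y \<noteq> 1" for y
  proof (cases "y \<bullet> y < 1")
    case True
    then have "y \<in> cball 0 1" using norm1[of y] by simp
    then have "v y = complex_of_real (wt y) * ?DG y
        + (\<Sum>\<alpha>\<in>R. complex_of_real (wt y * (k \<alpha> * (\<alpha> \<bullet> \<xi>) / (\<alpha> \<bullet> y))) * G y)"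
      by (simp add: v_def singular_integrand_def mult_ac)
    then show ?thesis using True by (simp add: sum_distrib_left sum_distrib_right)
  next
    case False
    then have "y \<notin> cball 0 1" using norm1[of y] that by simp
    then show ?thesis using False by (simp add: v_def singular_integrand_def)
  qed
  have "(LINT x|lborel. v x) = 0"
  proof (rule integral_directional_derivative_eq_0[OF iu uc iv])
    show "AE x in lborel. \<exists>S. finite S \<and>
        (\<forall>t\<in>{0<..<1} - S. ((\<lambda>t. u (x + t *\<^sub>R \<xi>)) has_vector_derivative v (x + t *\<^sub>R \<xi>)) (at t))"
      using AE_generic_lborel
    proof eventually_elim
      case (elim x)
      have "((\<lambda>t. u (x + t *\<^sub>R \<xi>)) has_vector_derivative v (x + t *\<^sub>R \<xi>)) (at t)"
        if "\<not> (x + t *\<^sub>R \<xi> \<notin> generic \<or> (x + t *\<^sub>R \<xi>) \<bullet> (x + t *\<^sub>R \<xi>) = 1)" for t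
      proof -
        have "((\<lambda>t. x + t *\<^sub>R \<xi>) has_vector_derivative \<xi>) (at t)"
          by (auto intro!: derivative_eq_intros)
        from vector_derivative_diff_chain_within[OF this has_derivative_at_withinI[OF D]]
        show ?thesis using that v_eq[of "x + t *\<^sub>R \<xi>"] by (simp add: o_def)
      qed
      then show ?case using finite_line_exceptions[OF elim \<xi>]
        by (intro exI[of _ "{t. x + t *\<^sub>R \<xi> \<notin> generic \<or> (x + t *\<^sub>R \<xi>) \<bullet> (x + t *\<^sub>R \<xi>) = 1}"]) auto
    qed
  qed
  also have "(LINT x|lborel. v x) = ball_integral ?DG + (\<Sum>\<alpha>\<in>R. complex_of_real (\<alpha> \<bullet> \<xi>) * singular_integral \<alpha> G)"
  proof -
    have i: "integrable lborel (\<lambda>x. complex_of_real (\<alpha> \<bullet> \<xi>) * singular_integrand \<alpha> G x)" if "\<alpha> \<in> R" for \<alpha>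
      using integrable_singular[OF that Gc] by simp
    have "(LINT x|lborel. v x) = (LINT x|lborel. indicator (cball 0 1) x *\<^sub>R (complex_of_real (wt x) * ?DG x))
        + (LINT x|lborel. (\<Sum>\<alpha>\<in>R. complex_of_real (\<alpha> \<bullet> \<xi>) * singular_integrand \<alpha> G x))"
      unfolding v_def
      by (intro Bochner_Integration.integral_add integrable_ball[OF DGc] Bochner_Integration.integrable_sum i)
    also have "(LINT x|lborel. (\<Sum>\<alpha>\<in>R. complex_of_real (\<alpha> \<bullet> \<xi>) * singular_integrand \<alpha> G x))
        = (\<Sum>\<alpha>\<in>R. LINT x|lborel. complex_of_real (\<alpha> \<bullet> \<xi>) * singular_integrand \<alpha> G x)"
      by (intro Bochner_Integration.integral_sum i)
    finally show ?thesis by (simp add: ball_integral_def singular_integral_def)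
  qed
  finally show ?thesis .
qed

end

context dunkl
begin

lemma singular_integral_uminus: "\<alpha> \<in> R \<Longrightarrow> singular_integral (- \<alpha>) P = - singular_integral \<alpha> P"
proof -
  assume \<alpha>: "\<alpha> \<in> R"
  have "singular_integrand (- \<alpha>) P = (\<lambda>x. - singular_integrand \<alpha> P x)"
    by (rule ext) (simp add: singular_integrand_def k_uminus[OF \<alpha>])
  then show ?thesis by (simp add: singular_integral_def)
qed

lemma ball_integral_decompose:
  assumes P: "continuous_on UNIV P" and A: "continuous_on UNIV A"
    and B: "\<And>\<alpha>. \<alpha> \<in> Rp \<Longrightarrow> continuous_on UNIV (B \<alpha>)"
    and eq: "\<And>x. x \<in> generic \<Longrightarrow> P x = A x + (\<Sum>\<alpha>\<in>Rp. dunkl_coeff \<xi> x \<alpha> * B \<alpha> x)"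
  shows "ball_integral P = ball_integral A + (\<Sum>\<alpha>\<in>Rp. complex_of_real (\<alpha> \<bullet> \<xi>) * singular_integral \<alpha> (B \<alpha>))"
proof -
  have i: "integrable lborel (\<lambda>x. complex_of_real (\<alpha> \<bullet> \<xi>) * singular_integrand \<alpha> (B \<alpha>) x)" if "\<alpha> \<in> Rp" for \<alpha>
    using integrable_singular[OF _ B[OF that]] that Rp_subset by auto
  have "ball_integral P = (LINT x|lborel. indicator (cball 0 1) x *\<^sub>R (complex_of_real (wt x) * A x)
      + (\<Sum>\<alpha>\<in>Rp. complex_of_real (\<alpha> \<bullet> \<xi>) * singular_integrand \<alpha> (B \<alpha>) x))"
    unfolding ball_integral_def
  proof (rule integral_cong_AE)
    show "(\<lambda>x. indicator (cball 0 1) x *\<^sub>R (complex_of_real (wt x) * P x)) \<in> borel_measurable lborel"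
      using integrable_ball[OF P] by (rule borel_measurable_integrable)
    show "(\<lambda>x. indicator (cball 0 1) x *\<^sub>R (complex_of_real (wt x) * A x)
      + (\<Sum>\<alpha>\<in>Rp. complex_of_real (\<alpha> \<bullet> \<xi>) * singular_integrand \<alpha> (B \<alpha>) x)) \<in> borel_measurable lborel"
      by (intro borel_measurable_integrable Bochner_Integration.integrable_add integrable_ball[OF A]
        Bochner_Integration.integrable_sum i)
    show "AE x in lborel. indicator (cball 0 1) x *\<^sub>R (complex_of_real (wt x) * P x)
      = indicator (cball 0 1) x *\<^sub>R (complex_of_real (wt x) * A x)
      + (\<Sum>\<alpha>\<in>Rp. complex_of_real (\<alpha> \<bullet> \<xi>) * singular_integrand \<alpha> (B \<alpha>) x)"
      using AE_generic_lborel
    proof eventually_elim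
      case (elim x)
      have "complex_of_real (\<alpha> \<bullet> \<xi>) * singular_integrand \<alpha> (B \<alpha>) x
          = indicator (cball 0 1) x *\<^sub>R (complex_of_real (wt x) * (dunkl_coeff \<xi> x \<alpha> * B \<alpha> x))" for \<alpha>
        by (simp add: singular_integrand_def dunkl_coeff_def indicator_def)
      then show ?case
        by (simp only: eq[OF elim] distrib_left scaleR_add_right sum_distrib_left scaleR_sum_right)
    qed
  qed
  also have "\<dots> = ball_integral A + (LINT x|lborel. (\<Sum>\<alpha>\<in>Rp. complex_of_real (\<alpha> \<bullet> \<xi>) * singular_integrand \<alpha> (B \<alpha>) x))"
    unfolding ball_integral_def
    by (intro Bochner_Integration.integral_add integrable_ball[OF A] Bochner_Integration.integrable_sum i)
  also have "(LINT x|lborel. (\<Sum>\<alpha>\<in>Rp. complex_of_real (\<alpha> \<bullet> \<xi>) * singular_integrand \<alpha> (B \<alpha>) x))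
      = (\<Sum>\<alpha>\<in>Rp. LINT x|lborel. complex_of_real (\<alpha> \<bullet> \<xi>) * singular_integrand \<alpha> (B \<alpha>) x)"
    by (intro Bochner_Integration.integral_sum i)
  finally show ?thesis by (simp add: singular_integral_def)
qed

text \<open>
  The Dunkl operators are skew-adjoint up to a boundary term. The difference quotients of the
  two factors produce twice the logarithmic derivative of the weight, because the mixed terms
  are exchanged by the reflection and cancel.
\<close>

lemma T_skew_adjoint:
  assumes f: "polynomial_function f" and g: "polynomial_function g" and \<xi>: "\<xi> \<noteq> 0"
  shows "ball_integral (\<lambda>x. complex_of_real (1 - x \<bullet> x) * (T \<xi> f x * g x + f x * T \<xi> g x))
    = 2 * ball_integral (\<lambda>x. complex_of_real (\<xi> \<bullet> x) * (f x * g x))"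
proof -
  define Q where "Q x = complex_of_real (1 - x \<bullet> x)" for x :: "real ^ 'n"
  have Q: "polynomial_function Q"
    unfolding Q_def[abs_def]
    by (intro polynomial_function_of_real real_polynomial_function_diff
      real_polynomial_function.intros(2) real_polynomial_function_inner_self)
  define P where "P x = f x * g x" for x
  have P: "polynomial_function P" unfolding P_def[abs_def] by (rule polynomial_function_complex_mult[OF f g])
  define G where "G x = Q x * P x" for x
  define DP where "DP x = frechet_derivative P (at x) \<xi>" for x
  have DP: "polynomial_function DP"
    unfolding DP_def[abs_def] by (rule polynomial_function_directional_derivative[OF P])
  have DP_eq: "DP x = f x * frechet_derivative g (at x) \<xi> + frechet_derivative f (at x) \<xi> * g x" for x
    unfolding DP_def P_def[abs_def]
    by (rule frechet_derivativeI) (intro has_derivative_mult has_derivative_polynomial f g)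
  have DG: "frechet_derivative G (at x) \<xi> = Q x * DP x + (- 2) * (complex_of_real (\<xi> \<bullet> x) * P x)" for x
  proof -
    have "(Q has_derivative (\<lambda>v. complex_of_real (- 2 * (v \<bullet> x)))) (at x)"
      unfolding Q_def[abs_def] by (intro has_derivative_of_real) (auto intro!: derivative_eq_intros simp: inner_commute)
    from has_derivative_mult[OF this has_derivative_polynomial[OF P]]
    have "frechet_derivative G (at x) \<xi> = Q x * frechet_derivative P (at x) \<xi> + complex_of_real (- 2 * (\<xi> \<bullet> x)) * P x"
      unfolding G_def[abs_def] by (rule frechet_derivativeI)
    then show ?thesis by (simp add: DP_def)
  qed
  note cp = continuous_on_polynomial
  have cQ: "continuous_on S Q" and cP: "continuous_on S P" and cDP: "continuous_on S DP"
    and cf: "continuous_on S f" and cg: "continuous_on S g" for S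
    by (intro cp Q P DP f g)+
  have cG: "continuous_on UNIV G" unfolding G_def[abs_def] by (intro continuous_intros cQ cP)
  have cr: "continuous_on UNIV (\<lambda>x. h (reflection \<alpha> x))" if "continuous_on UNIV h" for h :: "real ^ 'n \<Rightarrow> complex" and \<alpha>
    by (rule continuous_on_compose2[OF that linear_continuous_on])
      (use linear_reflection in \<open>auto simp: linear_conv_bounded_linear\<close>)
  have boundary: "ball_integral (\<lambda>x. Q x * DP x) + (\<Sum>\<alpha>\<in>Rp. complex_of_real (\<alpha> \<bullet> \<xi>) * (2 * singular_integral \<alpha> G))
      = 2 * ball_integral (\<lambda>x. complex_of_real (\<xi> \<bullet> x) * P x)"
  proof -
    have "ball_integral (\<lambda>x. Q x * DP x + (- 2) * (complex_of_real (\<xi> \<bullet> x) * P x))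
        = ball_integral (\<lambda>x. Q x * DP x) + (- 2) * ball_integral (\<lambda>x. complex_of_real (\<xi> \<bullet> x) * P x)"
      unfolding ball_integral_cmult[symmetric]
      by (intro ball_integral_add continuous_intros cQ cDP cP)
    moreover have "(\<Sum>\<alpha>\<in>R. complex_of_real (\<alpha> \<bullet> \<xi>) * singular_integral \<alpha> G)
        = (\<Sum>\<alpha>\<in>Rp. complex_of_real (\<alpha> \<bullet> \<xi>) * (2 * singular_integral \<alpha> G))"
      by (subst sum_R_eq_sum_Rp) (auto simp: singular_integral_uminus sum.distrib[symmetric] intro!: sum.cong)
    moreover have "ball_integral (\<lambda>x. frechet_derivative G (at x) \<xi>)
        + (\<Sum>\<alpha>\<in>R. complex_of_real (\<alpha> \<bullet> \<xi>) * singular_integral \<alpha> G) = 0"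
      using ball_integral_derivative[OF P \<xi>] unfolding G_def[abs_def] Q_def .
    ultimately show ?thesis
      unfolding DG by (simp add: add_eq_0_iff)
  qed
  define b where "b \<alpha> x = Q x * ((f x - f (reflection \<alpha> x)) * g x + f x * (g x - g (reflection \<alpha> x)))" for \<alpha> x
  have cb: "continuous_on UNIV (b \<alpha>)" for \<alpha>
    unfolding b_def[abs_def] by (intro continuous_intros cQ cf cg cr)
  have sb: "singular_integral \<alpha> (b \<alpha>) = 2 * singular_integral \<alpha> G" if "\<alpha> \<in> Rp" for \<alpha>
  proof -
    have \<alpha>: "\<alpha> \<in> R" "\<alpha> \<noteq> 0" using that Rp_subset R_nonzero by auto
    define e where "e x = (-1) * (Q x * (f (reflection \<alpha> x) * g x))" for x
    have ce: "continuous_on UNIV e" unfolding e_def[abs_def] by (intro continuous_intros cQ cf cg cr)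
    have b_eq: "b \<alpha> = (\<lambda>x. (G x + G x) + (e x + e (reflection \<alpha> x)))"
      by (rule ext) (simp add: b_def G_def P_def e_def Q_def reflection_involution[OF \<alpha>(2)]
          inner_reflection_reflection[OF \<alpha>(2)] algebra_simps)
    have "singular_integral \<alpha> (b \<alpha>) = (singular_integral \<alpha> G + singular_integral \<alpha> G)
        + (singular_integral \<alpha> e + singular_integral \<alpha> (\<lambda>x. e (reflection \<alpha> x)))"
      unfolding b_eq
      by (simp only: singular_integral_add[OF \<alpha>(1)] cG ce cr[OF ce] continuous_on_add)
    then show ?thesis by (simp only: singular_integral_reflection[OF \<alpha>(1) ce]) simp
  qed
  have "ball_integral (\<lambda>x. Q x * (T \<xi> f x * g x + f x * T \<xi> g x))
      = ball_integral (\<lambda>x. Q x * DP x) + (\<Sum>\<alpha>\<in>Rp. complex_of_real (\<alpha> \<bullet> \<xi>) * singular_integral \<alpha> (b \<alpha>))"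
  proof (rule ball_integral_decompose)
    show "continuous_on UNIV (\<lambda>x. Q x * (T \<xi> f x * g x + f x * T \<xi> g x))"
      by (intro continuous_intros cQ cf cg cp polynomial_function_T f g)
    show "continuous_on UNIV (\<lambda>x. Q x * DP x)" by (intro continuous_intros cQ cDP)
    fix x assume x: "x \<in> generic"
    have "dunkl_coeff \<xi> x \<alpha> * b \<alpha> x = Q x * (dunkl_coeff \<xi> x \<alpha> * (f x - f (reflection \<alpha> x)) * g x
        + f x * (dunkl_coeff \<xi> x \<alpha> * (g x - g (reflection \<alpha> x))))" for \<alpha>
      unfolding b_def by (simp only: distrib_left mult_ac)
    then show "Q x * (T \<xi> f x * g x + f x * T \<xi> g x) = Q x * DP x + (\<Sum>\<alpha>\<in>Rp. dunkl_coeff \<xi> x \<alpha> * b \<alpha> x)"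
      unfolding T_generic[OF x] DP_eq
      by (simp only: sum_distrib_left[symmetric] sum.distrib sum_distrib_right[symmetric]) (simp add: algebra_simps)
  qed (rule cb)
  also have "\<dots> = 2 * ball_integral (\<lambda>x. complex_of_real (\<xi> \<bullet> x) * P x)"
    using boundary by (simp add: sb)
  finally show ?thesis by (simp add: Q_def P_def)
qed

text \<open>
  Summing skew-adjointness over a basis expresses the Dirichlet form of \<open>p\<close> and \<open>q\<close>, for harmonic
  \<open>p\<close>, by the Euler operator, that is by the degree of \<open>p\<close>, and a term symmetric in \<open>p\<close> and \<open>q\<close>.
\<close>

lemma dirichlet_form_harmonic:
  assumes p: "p \<in> H m" and q: "polynomial_function q"
  shows "(\<Sum>\<xi>\<in>Basis. ball_integral (\<lambda>x. complex_of_real (1 - x \<bullet> x) * (T \<xi> p x * T \<xi> q x)))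
    = 2 * (of_nat m + complex_of_real \<gamma>) * ball_integral (\<lambda>x. p x * q x)
      - 2 * (\<Sum>\<alpha>\<in>Rp. complex_of_real (k \<alpha>) * ball_integral (\<lambda>x. p (reflection \<alpha> x) * q x))"
proof -
  have p': "polynomial_function p" "homogeneous m p" "\<And>x. lap p x = 0" using p by (auto simp: H_iff)
  note cp = continuous_on_polynomial
  have cp': "continuous_on S p" "continuous_on S q" "continuous_on S (T \<xi> p)" "continuous_on S (T \<xi> q)"
    "continuous_on S (T \<xi> (T \<xi> p))" for S \<xi>
    by (intro cp p' q polynomial_function_T)+
  have cr: "continuous_on UNIV (\<lambda>x. p (reflection \<alpha> x))" for \<alpha>
    by (rule continuous_on_compose2[OF cp'(1) linear_continuous_on])
      (use linear_reflection in \<open>auto simp: linear_conv_bounded_linear\<close>)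
  have cQ: "continuous_on S (\<lambda>x::real ^ 'n. complex_of_real (1 - x \<bullet> x))" for S by (intro continuous_intros)
  have cl: "continuous_on S (\<lambda>x::real ^ 'n. complex_of_real (\<xi> \<bullet> x))" for S \<xi> by (intro continuous_intros)
  have "ball_integral (\<lambda>x. complex_of_real (1 - x \<bullet> x) * (T \<xi> (T \<xi> p) x * q x))
      + ball_integral (\<lambda>x. complex_of_real (1 - x \<bullet> x) * (T \<xi> p x * T \<xi> q x))
      = 2 * ball_integral (\<lambda>x. complex_of_real (\<xi> \<bullet> x) * (T \<xi> p x * q x))" if "\<xi> \<in> Basis" for \<xi>
    unfolding T_skew_adjoint[OF polynomial_function_T[OF p'(1)] q nonzero_Basis[OF that], symmetric] distrib_left
    by (rule ball_integral_add[symmetric]) (intro continuous_on_mult cQ cp')+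
  then have e1: "(\<Sum>\<xi>\<in>Basis. ball_integral (\<lambda>x. complex_of_real (1 - x \<bullet> x) * (T \<xi> (T \<xi> p) x * q x)))
      + (\<Sum>\<xi>\<in>Basis. ball_integral (\<lambda>x. complex_of_real (1 - x \<bullet> x) * (T \<xi> p x * T \<xi> q x)))
      = 2 * (\<Sum>\<xi>\<in>Basis. ball_integral (\<lambda>x. complex_of_real (\<xi> \<bullet> x) * (T \<xi> p x * q x)))"
    by (simp add: sum.distrib[symmetric] sum_distrib_left)
  have e2: "(\<Sum>\<xi>\<in>Basis. ball_integral (\<lambda>x. complex_of_real (1 - x \<bullet> x) * (T \<xi> (T \<xi> p) x * q x))) = 0"
  proof -
    have "(\<Sum>\<xi>\<in>Basis. ball_integral (\<lambda>x. complex_of_real (1 - x \<bullet> x) * (T \<xi> (T \<xi> p) x * q x)))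
        = ball_integral (\<lambda>x. \<Sum>\<xi>\<in>Basis. complex_of_real (1 - x \<bullet> x) * (T \<xi> (T \<xi> p) x * q x))"
      by (rule ball_integral_sum[symmetric]) (intro continuous_on_mult cQ cp')
    also have "(\<lambda>x. \<Sum>\<xi>\<in>Basis. complex_of_real (1 - x \<bullet> x) * (T \<xi> (T \<xi> p) x * q x)) = (\<lambda>x. 0)"
      using p'(3) by (simp add: sum_distrib_left[symmetric] sum_distrib_right[symmetric] dunkl_laplacian_def)
    finally show ?thesis by (simp add: ball_integral_def)
  qed
  have e3: "(\<Sum>\<xi>\<in>Basis. ball_integral (\<lambda>x. complex_of_real (\<xi> \<bullet> x) * (T \<xi> p x * q x)))
      = (of_nat m + complex_of_real \<gamma>) * ball_integral (\<lambda>x. p x * q x)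
        + (-1) * (\<Sum>\<alpha>\<in>Rp. complex_of_real (k \<alpha>) * ball_integral (\<lambda>x. p (reflection \<alpha> x) * q x))"
  proof -
    have "(\<Sum>\<xi>\<in>Basis. ball_integral (\<lambda>x. complex_of_real (\<xi> \<bullet> x) * (T \<xi> p x * q x)))
        = ball_integral (\<lambda>x. \<Sum>\<xi>\<in>Basis. complex_of_real (\<xi> \<bullet> x) * (T \<xi> p x * q x))"
      by (rule ball_integral_sum[symmetric]) (intro continuous_on_mult cl cp')
    also have "\<dots> = ball_integral (\<lambda>x. (of_nat m + complex_of_real \<gamma>) * (p x * q x)
        + (-1) * (\<Sum>\<alpha>\<in>Rp. complex_of_real (k \<alpha>) * (p (reflection \<alpha> x) * q x)))"
    proof (rule ball_integral_cong_generic)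
      show "continuous_on UNIV (\<lambda>x. \<Sum>\<xi>\<in>Basis. complex_of_real (\<xi> \<bullet> x) * (T \<xi> p x * q x))"
        by (intro continuous_on_sum continuous_on_mult cl cp')
      show "continuous_on UNIV (\<lambda>x. (of_nat m + complex_of_real \<gamma>) * (p x * q x)
          + (-1) * (\<Sum>\<alpha>\<in>Rp. complex_of_real (k \<alpha>) * (p (reflection \<alpha> x) * q x)))"
        by (intro continuous_on_add continuous_on_sum continuous_on_mult continuous_on_const cr cp')
      fix x assume x: "x \<in> generic"
      have "(\<Sum>\<xi>\<in>Basis. complex_of_real (\<xi> \<bullet> x) * (T \<xi> p x * q x))
          = (\<Sum>\<xi>\<in>Basis. complex_of_real (\<xi> \<bullet> x) * T \<xi> p x) * q x"
        by (simp add: sum_distrib_right mult.assoc)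
      also have "(\<Sum>\<xi>\<in>Basis. complex_of_real (\<xi> \<bullet> x) * T \<xi> p x)
          = (of_nat m + complex_of_real \<gamma>) * p x - (\<Sum>\<alpha>\<in>Rp. complex_of_real (k \<alpha>) * p (reflection \<alpha> x))"
        unfolding sum_coordinate_T[OF x p'(1,2)]
        by (simp add: right_diff_distrib sum_subtractf mult_index_def sum_distrib_right distrib_right)
      finally show "(\<Sum>\<xi>\<in>Basis. complex_of_real (\<xi> \<bullet> x) * (T \<xi> p x * q x))
          = (of_nat m + complex_of_real \<gamma>) * (p x * q x)
          + (-1) * (\<Sum>\<alpha>\<in>Rp. complex_of_real (k \<alpha>) * (p (reflection \<alpha> x) * q x))"
        by (simp add: left_diff_distrib sum_distrib_right mult.assoc)
    qed
    also have "\<dots> = ball_integral (\<lambda>x. (of_nat m + complex_of_real \<gamma>) * (p x * q x))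
        + ball_integral (\<lambda>x. (-1) * (\<Sum>\<alpha>\<in>Rp. complex_of_real (k \<alpha>) * (p (reflection \<alpha> x) * q x)))"
      by (intro ball_integral_add continuous_on_sum continuous_on_mult continuous_on_const cr cp')
    also have "ball_integral (\<lambda>x. (-1) * (\<Sum>\<alpha>\<in>Rp. complex_of_real (k \<alpha>) * (p (reflection \<alpha> x) * q x)))
        = (-1) * (\<Sum>\<alpha>\<in>Rp. ball_integral (\<lambda>x. complex_of_real (k \<alpha>) * (p (reflection \<alpha> x) * q x)))"
      unfolding ball_integral_cmult
      by (subst ball_integral_sum) (intro continuous_on_mult continuous_on_const cr cp', simp add: ball_integral_cmult)
    finally show ?thesis by (simp only: ball_integral_cmult)
  qed
  have "S2 = 2 * u * B - 2 * W" if "S1 + S2 = 2 * S3" "S1 = 0" "S3 = u * B + (-1) * W"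
    for S1 S2 S3 u B W :: complex
    using that by (simp add: algebra_simps)
  from this[OF e1 e2 e3] show ?thesis .
qed

text \<open>The Dirichlet form is symmetric. Evaluated in both orders it leaves
  \<open>2 (m - n)\<close> times the integral of \<open>p q\<close>, since the reflection terms agree.\<close>

theorem harmonics_orthogonal:
  assumes p: "p \<in> H m" and q: "q \<in> H n" and "m \<noteq> n"
  shows "ball_integral (\<lambda>x. p x * q x) = 0"
proof -
  have p': "polynomial_function p" and q': "polynomial_function q" using p q by (auto simp: H_iff)
  have "ball_integral (\<lambda>x. p (reflection \<alpha> x) * q x) = ball_integral (\<lambda>x. q (reflection \<alpha> x) * p x)"
    if "\<alpha> \<in> Rp" for \<alpha>
  proof -
    have \<alpha>: "\<alpha> \<in> R" "\<alpha> \<noteq> 0" using that Rp_subset R_nonzero by auto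
    have "continuous_on UNIV (\<lambda>x. q (reflection \<alpha> x) * p x)"
      using linear_reflection[of \<alpha>]
      by (intro continuous_on_mult continuous_on_polynomial[OF p']
          continuous_on_compose2[OF continuous_on_polynomial[OF q'] linear_continuous_on])
        (auto simp: linear_conv_bounded_linear)
    from ball_integral_reflection[OF \<alpha>(1) this] show ?thesis
      by (simp add: reflection_involution[OF \<alpha>(2)] mult.commute)
  qed
  then have "(\<Sum>\<alpha>\<in>Rp. complex_of_real (k \<alpha>) * ball_integral (\<lambda>x. p (reflection \<alpha> x) * q x))
      = (\<Sum>\<alpha>\<in>Rp. complex_of_real (k \<alpha>) * ball_integral (\<lambda>x. q (reflection \<alpha> x) * p x))"
    by (intro sum.cong) auto
  moreover have "ball_integral (\<lambda>x. q x * p x) = ball_integral (\<lambda>x. p x * q x)"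
    by (simp add: mult.commute)
  moreover have "(\<Sum>\<xi>\<in>Basis. ball_integral (\<lambda>x. complex_of_real (1 - x \<bullet> x) * (T \<xi> p x * T \<xi> q x)))
      = (\<Sum>\<xi>\<in>Basis. ball_integral (\<lambda>x. complex_of_real (1 - x \<bullet> x) * (T \<xi> q x * T \<xi> p x)))"
    by (simp only: mult.commute)
  ultimately have "of_nat m * ball_integral (\<lambda>x. p x * q x) = of_nat n * ball_integral (\<lambda>x. p x * q x)"
    using dirichlet_form_harmonic[OF p q'] dirichlet_form_harmonic[OF q p'] by (simp add: distrib_right)
  then show ?thesis using assms(3) by simp
qed

lemma H_cnj: "p \<in> H m \<Longrightarrow> (\<lambda>x. cnj (p x)) \<in> H m"
  by (auto simp: H_iff homogeneous_def polynomial_function_cnj lap_cnj)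

end

section \<open>The radial operator and Laguerre polynomials\<close>

text \<open>On a function \<open>f(t) = Q(t) exp(-t/a)\<close> of \<open>t = \<parallel>x\<parallel>^a\<close> the operator of the theorem acts, after
  separation of a harmonic factor with parameter \<open>\<nu>\<close>, through this operator on \<open>Q\<close>.\<close>

definition radial_op :: "real \<Rightarrow> real \<Rightarrow> real poly \<Rightarrow> real poly" where
  "radial_op a \<nu> Q = smult (a\<^sup>2) (pCons 0 (pderiv (pderiv Q)) + smult (\<nu> + 1) (pderiv Q))
    - smult (2 * a) (pCons 0 (pderiv Q)) - smult (a * (\<nu> + 1)) Q"

definition laguerre_poly :: "real \<Rightarrow> nat \<Rightarrow> real \<Rightarrow> real poly" where
  "laguerre_poly a l \<nu> = (\<Sum>j\<le>l. monom ((- 1) ^ j * Gamma (\<nu> + real l + 1) /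
     (fact (l - j) * Gamma (\<nu> + real j + 1)) / fact j * (2 / a) ^ j) j)"

lemma poly_laguerre_poly: "poly (laguerre_poly a l \<nu>) t = laguerre l \<nu> (2 / a * t)"
  unfolding laguerre_poly_def laguerre_def poly_sum
  by (intro sum.cong refl) (simp add: poly_monom power_mult_distrib power_divide mult_ac)

lemma coeff_laguerre_poly:
  "coeff (laguerre_poly a l \<nu>) j = (if j \<le> l then (- 1) ^ j * Gamma (\<nu> + real l + 1) /
     (fact (l - j) * Gamma (\<nu> + real j + 1)) / fact j * (2 / a) ^ j else 0)"
proof -
  have "coeff (laguerre_poly a l \<nu>) j = (\<Sum>i\<le>l. if i = j then (- 1) ^ i * Gamma (\<nu> + real l + 1) /
     (fact (l - i) * Gamma (\<nu> + real i + 1)) / fact i * (2 / a) ^ i else 0)"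
    by (simp add: laguerre_poly_def coeff_sum)
  also have "\<dots> = (if j \<le> l then (- 1) ^ j * Gamma (\<nu> + real l + 1) /
     (fact (l - j) * Gamma (\<nu> + real j + 1)) / fact j * (2 / a) ^ j else 0)"
    by (subst sum.delta) auto
  finally show ?thesis .
qed

lemma coeff_laguerre_poly_Suc:
  assumes "a > 0" "\<nu> > -1" "j < l"
  shows "a * (real j + \<nu> + 1) * real (Suc j) * coeff (laguerre_poly a l \<nu>) (Suc j)
    = - 2 * (real l - real j) * coeff (laguerre_poly a l \<nu>) j"
proof -
  have pos: "\<nu> + real j + 1 > 0" using assms(2) by linarith
  have G: "Gamma (\<nu> + real (Suc j) + 1) = (real j + \<nu> + 1) * Gamma (\<nu> + real j + 1)"
    using Gamma_plus1[of "\<nu> + real j + 1"] pos by (simp add: add_ac nonpos_Ints_def)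
  have Gnz: "Gamma (\<nu> + real j + 1) > 0" using pos by (rule Gamma_real_pos)
  obtain d where d: "l - j = Suc d" "l - Suc j = d" "real l - real j = real (Suc d)"
    using assms(3) by (metis Suc_diff_Suc of_nat_diff less_imp_le)
  define w g P where "w = real j + \<nu> + 1" and "g = Gamma (\<nu> + real j + 1)" and "P = Gamma (\<nu> + real l + 1)"
  have nz: "w \<noteq> 0" "g \<noteq> 0"
    using less_imp_neq[OF pos] less_imp_neq[OF Gnz] unfolding w_def g_def by (metis add.commute)+
  have c1: "coeff (laguerre_poly a l \<nu>) (Suc j)
      = (- 1 * (- 1) ^ j) * P / (fact d * (w * g)) / (real (Suc j) * fact j) * ((2 / a) * (2 / a) ^ j)"
    using assms(3) unfolding coeff_laguerre_poly d(2) G w_def g_def P_def by simp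
  have c0: "coeff (laguerre_poly a l \<nu>) j
      = (- 1) ^ j * P / ((real (Suc d) * fact d) * g) / fact j * (2 / a) ^ j"
    using assms(3) unfolding coeff_laguerre_poly d(1) g_def P_def by simp
  have "a * w * S * ((- 1 * e) * P / (F * (w * g)) / (S * J) * ((2 / a) * B)) = - 2 * D * (e * P / ((D * F) * g) / J * B)"
    if "S \<noteq> 0" "F \<noteq> 0" "J \<noteq> 0" "D \<noteq> 0" for S e F J B D :: real
    using that nz assms(1) by (simp add: divide_simps)
  note cancel = this
  show ?thesis unfolding c1 c0 d(3) w_def[symmetric] by (rule cancel) simp_all
qed

text \<open>Laguerre's differential equation, compared coefficient by coefficient through the two-term
  recursion of the Laguerre coefficients.\<close>

lemma radial_op_laguerre_poly:
  assumes "a > 0" "\<nu> > -1"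
  shows "radial_op a \<nu> (laguerre_poly a l \<nu>) = smult (- a * (2 * real l + \<nu> + 1)) (laguerre_poly a l \<nu>)"
proof (rule poly_eqI)
  fix j
  define q where "q = coeff (laguerre_poly a l \<nu>)"
  have c0: "coeff (pCons 0 (pderiv (pderiv Q))) j = real j * real (Suc j) * coeff Q (Suc j)"
    "coeff (pCons 0 (pderiv Q)) j = real j * coeff Q j" for Q :: "real poly"
    by (cases j; simp add: coeff_pderiv)+
  have "coeff (radial_op a \<nu> (laguerre_poly a l \<nu>)) j
      = a * (a * (real j + \<nu> + 1) * real (Suc j) * q (Suc j)) - 2 * a * real j * q j - a * (\<nu> + 1) * q j"
    unfolding radial_op_def coeff_diff coeff_add coeff_smult c0 coeff_pderiv q_def
    by (simp add: power2_eq_square algebra_simps)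
  also have "a * (real j + \<nu> + 1) * real (Suc j) * q (Suc j) = - 2 * (real l - real j) * q j"
  proof (cases "j < l")
    case True
    then show ?thesis unfolding q_def by (rule coeff_laguerre_poly_Suc[OF assms])
  next
    case False
    then have "q (Suc j) = 0" "real l - real j = 0 \<or> q j = 0" by (auto simp: q_def coeff_laguerre_poly)
    then show ?thesis by auto
  qed
  also have "a * (- 2 * (real l - real j) * q j) - 2 * a * real j * q j - a * (\<nu> + 1) * q j
      = - a * (2 * real l + \<nu> + 1) * q j"
    by (simp add: algebra_simps)
  finally show "coeff (radial_op a \<nu> (laguerre_poly a l \<nu>)) j = coeff (smult (- a * (2 * real l + \<nu> + 1)) (laguerre_poly a l \<nu>)) j"
    by (simp add: q_def)
qed

text \<open>A polynomial functional with the recursion of the moments of \<open>t^\<nu> exp(-2t/a)\<close> annihilates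
  the derivative of \<open>t^(\<nu>+1) V(t) exp(-2t/a)\<close>; the radial operator is symmetric for it by
  Lagrange's identity.\<close>

lemma pderiv_sum_real: "pderiv (\<Sum>i\<in>S. f i) = (\<Sum>i\<in>S. pderiv (f i :: real poly))"
  by (induction S rule: infinite_finite_induct) (auto simp: pderiv_add)

locale moment_functional =
  fixes a \<nu> :: real and I :: "real poly \<Rightarrow> real"
  assumes a_pos: "a > 0"
    and I_add: "I (P + Q) = I P + I Q"
    and I_smult: "I (smult c P) = c * I P"
    and I_monom: "I (monom 1 (Suc n)) = a / 2 * (\<nu> + real n + 1) * I (monom 1 n)"
begin

lemma I_diff: "I (P - Q) = I P - I Q"
  using I_add[of P "smult (-1) Q"] I_smult[of "-1" Q] by simp

lemma I_zero: "I 0 = 0"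
  using I_smult[of 0 0] by simp

lemma I_divergence:
  "I (pCons 0 (pderiv V) + smult (\<nu> + 1) V - smult (2 / a) (pCons 0 V)) = 0"
proof -
  have monom: "I (pCons 0 (pderiv (monom c n)) + smult (\<nu> + 1) (monom c n) - smult (2 / a) (pCons 0 (monom c n))) = 0" for c n
  proof -
    have "pCons 0 (pderiv (monom c n)) + smult (\<nu> + 1) (monom c n) - smult (2 / a) (pCons 0 (monom c n))
        = smult (c * (\<nu> + real n + 1)) (monom 1 n) - smult (c * (2 / a)) (monom 1 (Suc n))"
      by (rule poly_eqI, cases n) (auto simp: coeff_pderiv coeff_pCons algebra_simps split: nat.splits)
    then show ?thesis
      using a_pos by (simp add: I_diff I_smult I_monom)
  qed
  have sum: "I (\<Sum>i\<in>S. f i) = (\<Sum>i\<in>S. I (f i))" if "finite S" for S and f :: "nat \<Rightarrow> real poly"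
    using that by (induction S) (auto simp: I_zero I_add)
  have "V = (\<Sum>i\<le>degree V. monom (coeff V i) i)" by (simp add: poly_as_sum_of_monoms)
  then have "pCons 0 (pderiv V) + smult (\<nu> + 1) V - smult (2 / a) (pCons 0 V)
      = pCons 0 (pderiv (\<Sum>i\<le>degree V. monom (coeff V i) i)) + smult (\<nu> + 1) (\<Sum>i\<le>degree V. monom (coeff V i) i)
        - smult (2 / a) (pCons 0 (\<Sum>i\<le>degree V. monom (coeff V i) i))"
    by simp
  also have "\<dots> = (\<Sum>i\<le>degree V. pCons 0 (pderiv (monom (coeff V i) i)) + smult (\<nu> + 1) (monom (coeff V i) i)
        - smult (2 / a) (pCons 0 (monom (coeff V i) i)))"
  proof -
    have pC: "pCons 0 p = monom 1 1 * p" for p :: "real poly" by (simp add: monom_altdef)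
    have sm: "smult c p = [:c:] * p" for c and p :: "real poly" by simp
    show ?thesis unfolding pC sm
      by (simp only: pderiv_sum_real sum_distrib_left sum.distrib sum_subtractf)
  qed
  finally show ?thesis by (simp only: sum[OF finite_atMost] monom sum.neutral_const)
qed

lemma I_radial_op_symmetric: "I (radial_op a \<nu> P * Q) = I (P * radial_op a \<nu> Q)"
proof -
  define V where "V = pderiv P * Q - P * pderiv Q"
  have pV: "pderiv V = pderiv (pderiv P) * Q - P * pderiv (pderiv Q)"
    by (simp add: V_def pderiv_diff pderiv_mult algebra_simps)
  have "radial_op a \<nu> P * Q - P * radial_op a \<nu> Q
      = smult (a\<^sup>2) (pCons 0 (pderiv V) + smult (\<nu> + 1) V - smult (2 / a) (pCons 0 V))"
  proof (rule poly_eq_poly_eq_iff[THEN iffD1], rule ext)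
    fix t
    have "a\<^sup>2 * ((2 / a) * X) = 2 * a * X" for X using a_pos by (simp add: power2_eq_square)
    then show "poly (radial_op a \<nu> P * Q - P * radial_op a \<nu> Q) t
        = poly (smult (a\<^sup>2) (pCons 0 (pderiv V) + smult (\<nu> + 1) V - smult (2 / a) (pCons 0 V))) t"
      unfolding pV unfolding V_def radial_op_def
      by (simp only: poly_diff poly_add poly_smult poly_mult poly_pCons right_diff_distrib[of "a\<^sup>2"])
        (simp add: algebra_simps)
  qed
  then have "I (radial_op a \<nu> P * Q) - I (P * radial_op a \<nu> Q) = 0"
    unfolding I_diff[symmetric] by (simp only: I_smult I_divergence)
  then show ?thesis by simp
qed

text \<open>Eigenvectors of a symmetric operator for the distinct eigenvalues \<open>-a (2 l + \<nu> + 1)\<close>.\<close>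

lemma I_laguerre_orthogonal:
  assumes "\<nu> > -1" "l \<noteq> n"
  shows "I (laguerre_poly a l \<nu> * laguerre_poly a n \<nu>) = 0"
proof -
  have "- a * (2 * real l + \<nu> + 1) * I (laguerre_poly a l \<nu> * laguerre_poly a n \<nu>)
      = - a * (2 * real n + \<nu> + 1) * I (laguerre_poly a l \<nu> * laguerre_poly a n \<nu>)"
    using I_radial_op_symmetric[of "laguerre_poly a l \<nu>" "laguerre_poly a n \<nu>"]
    by (simp only: radial_op_laguerre_poly[OF a_pos assms(1)] mult_smult_left mult_smult_right I_smult)
  then have "2 * a * (real l - real n) * I (laguerre_poly a l \<nu> * laguerre_poly a n \<nu>) = 0"
    by (simp add: left_diff_distrib right_diff_distrib distrib_left distrib_right)
  moreover have "2 * a * (real l - real n) \<noteq> 0" using a_pos assms(2) by simp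
  ultimately show ?thesis by (metis mult_eq_0_iff)
qed

end

section \<open>Eigenfunctions\<close>

locale dunkl_a = dunkl R Rp k for R Rp :: "(real ^ 'n) set" and k +
  fixes a :: real
  assumes a_pos: "a > 0" and index_pos: "a + 2 * mult_index Rp k + real CARD('n) - 2 > 0"
begin

abbreviation \<Delta> where "\<Delta> \<equiv> Delta_ka Rp k a"

abbreviation lam where "lam \<equiv> lambda_kam Rp k a"

lemma a_lam: "a * lam m = 2 * real m + 2 * \<gamma> + real CARD('n) - 2"
  using a_pos by (simp add: lambda_kam_def)

text \<open>The assumption on the index is equivalent to the case \<open>m = 0\<close>.\<close>

lemma lam_gt: "lam m > -1"
proof -
  have "a * lam m > a * (-1)" using index_pos unfolding a_lam by simp
  then show ?thesis using a_pos by (simp only: mult_less_cancel_left_pos)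
qed

lemma inner_self_powr: "(x \<bullet> x) powr (a / 2) = norm x powr a"
proof (cases "x = 0")
  case False
  then have "x \<bullet> x = norm x powr 2"
    by (simp add: power2_norm_eq_inner)
  then show ?thesis by (simp only: powr_powr) simp
qed simp

text \<open>The regularity under which the composite operator is additive: the operators use the total
  derivative, which is additive on differentiable functions only.\<close>

definition twice_differentiable_T :: "(real ^ 'n \<Rightarrow> complex) \<Rightarrow> bool" where
  "twice_differentiable_T f \<longleftrightarrow>
    (\<forall>x\<in>generic. f differentiable (at x) \<and> (\<forall>\<xi>. T \<xi> f differentiable (at x)))"

lemma \<Delta>_add:
  assumes "twice_differentiable_T f" "twice_differentiable_T g"
  shows "twice_differentiable_T (\<lambda>x. f x + g x)"
    and "x \<in> generic \<Longrightarrow> \<Delta> (\<lambda>x. f x + g x) x = \<Delta> f x + \<Delta> g x"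
proof -
  have T: "T \<xi> (\<lambda>x. f x + g x) x = T \<xi> f x + T \<xi> g x" if "x \<in> generic" for \<xi> x
    using assms that by (intro T_add) (auto simp: twice_differentiable_T_def)
  have "T \<xi> (\<lambda>x. f x + g x) differentiable (at x)" if "x \<in> generic" for \<xi> x
    by (rule differentiable_cong_generic[OF that, of "\<lambda>x. T \<xi> f x + T \<xi> g x"])
      (use assms that T in \<open>auto simp: twice_differentiable_T_def intro!: differentiable_add\<close>)
  then show "twice_differentiable_T (\<lambda>x. f x + g x)"
    using assms by (auto simp: twice_differentiable_T_def intro!: differentiable_add)
  assume x: "x \<in> generic"
  have "T \<xi> (T \<xi> (\<lambda>x. f x + g x)) x = T \<xi> (T \<xi> f) x + T \<xi> (T \<xi> g) x" for \<xi>
  proof -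
    have "T \<xi> (T \<xi> (\<lambda>x. f x + g x)) x = T \<xi> (\<lambda>x. T \<xi> f x + T \<xi> g x) x" by (rule T_cong_generic[OF x T])
    also have "\<dots> = T \<xi> (T \<xi> f) x + T \<xi> (T \<xi> g) x"
      using assms x by (intro T_add) (auto simp: twice_differentiable_T_def)
    finally show ?thesis .
  qed
  then show "\<Delta> (\<lambda>x. f x + g x) x = \<Delta> f x + \<Delta> g x"
    by (simp add: Delta_ka_def dunkl_laplacian_def sum.distrib algebra_simps)
qed

lemma \<Delta>_cmult:
  assumes "twice_differentiable_T f"
  shows "twice_differentiable_T (\<lambda>x. c * f x)"
    and "x \<in> generic \<Longrightarrow> \<Delta> (\<lambda>x. c * f x) x = c * \<Delta> f x"
proof -
  have T: "T \<xi> (\<lambda>x. c * f x) x = c * T \<xi> f x" if "x \<in> generic" for \<xi> x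
    using assms that by (intro T_cmult) (auto simp: twice_differentiable_T_def)
  have "T \<xi> (\<lambda>x. c * f x) differentiable (at x)" if "x \<in> generic" for \<xi> x
    by (rule differentiable_cong_generic[OF that, of "\<lambda>x. c * T \<xi> f x"])
      (use assms that T in \<open>auto simp: twice_differentiable_T_def intro!: differentiable_mult\<close>)
  then show "twice_differentiable_T (\<lambda>x. c * f x)"
    using assms by (auto simp: twice_differentiable_T_def intro!: differentiable_mult)
  assume x: "x \<in> generic"
  have "T \<xi> (T \<xi> (\<lambda>x. c * f x)) x = c * T \<xi> (T \<xi> f) x" for \<xi>
  proof -
    have "T \<xi> (T \<xi> (\<lambda>x. c * f x)) x = T \<xi> (\<lambda>x. c * T \<xi> f x) x" by (rule T_cong_generic[OF x T])
    also have "\<dots> = c * T \<xi> (T \<xi> f) x"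
      using assms x by (intro T_cmult) (auto simp: twice_differentiable_T_def)
    finally show ?thesis .
  qed
  then show "\<Delta> (\<lambda>x. c * f x) x = c * \<Delta> f x"
    by (simp add: Delta_ka_def dunkl_laplacian_def sum_distrib_left[symmetric] right_diff_distrib)
qed

definition separated :: "(real ^ 'n \<Rightarrow> complex) \<Rightarrow> (real \<Rightarrow> real) \<Rightarrow> real ^ 'n \<Rightarrow> complex" where
  "separated p f x = p x * complex_of_real (f (norm x powr a))"

text \<open>Separation of variables. With \<open>t = \<parallel>x\<parallel>^a\<close> the factor \<open>\<parallel>x\<parallel>^(2-a)\<close> exactly compensates the powers
  of \<open>\<parallel>x\<parallel>\<close> produced by differentiating \<open>f(\<parallel>x\<parallel>^a)\<close> twice, and leaves an ordinary differential
  operator in \<open>t\<close> that depends on the harmonic factor only through its degree.\<close>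

lemma
  assumes p: "p \<in> H m"
    and f: "\<And>t. t > 0 \<Longrightarrow> (f has_real_derivative f' t) (at t)"
    and f': "\<And>t. t > 0 \<Longrightarrow> (f' has_real_derivative f'' t) (at t)"
  shows twice_differentiable_T_separated: "twice_differentiable_T (separated p f)"
    and \<Delta>_separated: "x \<in> generic \<Longrightarrow> \<Delta> (separated p f) x = separated p
      (\<lambda>t. a\<^sup>2 * (t * f'' t + (lam m + 1) * f' t) - t * f t) x"
proof -
  have p': "polynomial_function p" "homogeneous m p" "\<And>x. lap p x = 0" using p by (auto simp: H_iff)
  define \<phi> where "\<phi> s = f (s powr (a / 2))" for s
  define \<phi>' where "\<phi>' s = f' (s powr (a / 2)) * (a / 2 * s powr (a / 2 - 1))" for s
  define \<phi>'' where "\<phi>'' s = f' (s powr (a / 2)) * (a / 2 * ((a / 2 - 1) * s powr (a / 2 - 1 - 1)))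
      + f'' (s powr (a / 2)) * (a / 2 * s powr (a / 2 - 1)) * (a / 2 * s powr (a / 2 - 1))" for s
  have pw: "((\<lambda>s. s powr r) has_real_derivative r * s powr (r - 1)) (at s)" if "s > 0" for r s :: real
    using that by (rule has_real_derivative_powr)
  have d1: "(\<phi> has_real_derivative \<phi>' s) (at s)" if "s > 0" for s
    unfolding \<phi>_def[abs_def] \<phi>'_def using that by (intro DERIV_chain2[OF f] pw) auto
  have d2: "(\<phi>' has_real_derivative \<phi>'' s) (at s)" if "s > 0" for s
    unfolding \<phi>'_def[abs_def] \<phi>''_def using that
    by (intro DERIV_mult' DERIV_chain2[OF f'] DERIV_cmult pw) auto
  have sep: "separated p f = (\<lambda>x. complex_of_real (\<phi> (x \<bullet> x)) * p x)"
    by (rule ext) (simp add: separated_def \<phi>_def inner_self_powr mult.commute)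
  have pos: "x \<bullet> x > 0" if "x \<in> generic" for x using generic_nonzero[OF that] by simp
  show "twice_differentiable_T (separated p f)"
    unfolding twice_differentiable_T_def sep
    by (intro ballI conjI allI differentiable_radial_mult[OF differentiable_polynomial[OF p'(1)] d1[OF pos]]
      differentiable_T_radial_polynomial[OF p'(1) d1 d2]) auto
  assume x: "x \<in> generic"
  define s where "s = x \<bullet> x"
  define t where "t = norm x powr a"
  have s: "s > 0" using pos[OF x] by (simp add: s_def)
  have t: "t > 0" using generic_nonzero[OF x] by (simp add: t_def)
  have st: "s powr (a / 2) = t" by (simp add: s_def t_def inner_self_powr)
  have st1: "s powr (a / 2 - 1) = t / s" using s by (simp add: powr_diff st)
  have st2: "s powr (a / 2 - 1 - 1) = t / s / s" using s unfolding powr_diff st by simp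
  have ns: "norm x powr (2 - a) = s / t"
    using generic_nonzero[OF x] by (simp add: powr_diff s_def t_def power2_norm_eq_inner[symmetric] powr_numeral)
  have "s / t * (2 * \<phi>' s * (2 * real m + 2 * \<gamma> + real CARD('n)) + 4 * s * \<phi>'' s)
      = a * f' t * (a * lam m + 2) + a\<^sup>2 * t * f'' t + a * (a - 2) * f' t"
  proof -
    have "s / t * (2 * (F * (a / 2 * (t / s))) * (c + 2) + 4 * s *
          (F * (a / 2 * ((a / 2 - 1) * (t / s / s))) + F2 * (a / 2 * (t / s)) * (a / 2 * (t / s))))
        = a * F * (c + 2) + a\<^sup>2 * t * F2 + a * (a - 2) * F" for F F2 c :: real
    proof -
      have "s / t * (2 * (F * (a / 2 * (t / s))) * (c + 2)) = a * F * (c + 2)"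
        "s / t * (4 * s * (F * (a / 2 * ((a / 2 - 1) * (t / s / s))))) = a * (a - 2) * F"
        "s / t * (4 * s * (F2 * (a / 2 * (t / s)) * (a / 2 * (t / s)))) = a * a * t * F2"
        using s t by (simp_all add: divide_simps)
      then show ?thesis by (simp only: distrib_left power2_eq_square)
    qed
    from this[of "f' t" "2 * real m + 2 * \<gamma> + real CARD('n) - 2" "f'' t"] show ?thesis
      unfolding a_lam \<phi>'_def \<phi>''_def st st1 st2 by simp
  qed
  also have "\<dots> = a\<^sup>2 * (t * f'' t + (lam m + 1) * f' t)"
    by (simp add: power2_eq_square algebra_simps)
  finally have main: "s / t * (2 * \<phi>' s * (2 * real m + 2 * \<gamma> + real CARD('n)) + 4 * s * \<phi>'' s)
      = a\<^sup>2 * (t * f'' t + (lam m + 1) * f' t)" .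
  have lr: "lap (\<lambda>x. complex_of_real (\<phi> (x \<bullet> x)) * p x) x = complex_of_real (\<phi> s) * lap p x
      + complex_of_real (2 * \<phi>' s * (2 * real m + 2 * \<gamma> + real CARD('n)) + 4 * s * \<phi>'' s) * p x"
    unfolding s_def using p'(1) d1 d2 x p'(2) by (rule lap_radial_polynomial)
  have "\<Delta> (separated p f) x = complex_of_real (s / t * (2 * \<phi>' s * (2 * real m + 2 * \<gamma> + real CARD('n)) + 4 * s * \<phi>'' s)) * p x
      - complex_of_real t * (complex_of_real (f t) * p x)"
    unfolding Delta_ka_def sep lr p'(3) ns s_def[symmetric] t_def[symmetric]
    by (simp add: scaleR_conv_of_real \<phi>_def st)
  then show "\<Delta> (separated p f) x = separated p (\<lambda>t. a\<^sup>2 * (t * f'' t + (lam m + 1) * f' t) - t * f t) x"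
    unfolding main by (simp add: separated_def t_def[symmetric] right_diff_distrib mult.left_commute mult.commute)
qed

definition poly_exp :: "real poly \<Rightarrow> real \<Rightarrow> real" where
  "poly_exp Q t = poly Q t * exp (- (1 / a) * t)"

lemma poly_exp_deriv: "(poly_exp Q has_real_derivative poly_exp (pderiv Q - smult (1 / a) Q) t) (at t)"
proof -
  have "((\<lambda>t. poly Q t * exp (- (1 / a) * t)) has_real_derivative
      poly Q t * (exp (- (1 / a) * t) * (- (1 / a))) + poly (pderiv Q) t * exp (- (1 / a) * t)) (at t)"
    by (intro DERIV_mult' DERIV_chain2[OF DERIV_exp] poly_DERIV DERIV_cmult_Id)
  then show ?thesis unfolding poly_exp_def[abs_def] by (simp add: algebra_simps)
qed

lemma
  assumes "p \<in> H m"
  shows twice_differentiable_T_poly_exp: "twice_differentiable_T (separated p (poly_exp Q))"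
    and \<Delta>_poly_exp: "x \<in> generic \<Longrightarrow> \<Delta> (separated p (poly_exp Q)) x = separated p (poly_exp (radial_op a (lam m) Q)) x"
proof -
  let ?Q' = "pderiv Q - smult (1 / a) Q"
  show "twice_differentiable_T (separated p (poly_exp Q))"
    by (rule twice_differentiable_T_separated[OF assms poly_exp_deriv poly_exp_deriv])
  assume x: "x \<in> generic"
  have "a\<^sup>2 * (t * poly_exp (pderiv ?Q' - smult (1 / a) ?Q') t + (lam m + 1) * poly_exp ?Q' t) - t * poly_exp Q t
      = poly_exp (radial_op a (lam m) Q) t" for t
  proof -
    have "a\<^sup>2 * (t * poly (pderiv ?Q' - smult (1 / a) ?Q') t + (lam m + 1) * poly ?Q' t) - t * poly Q t
        = poly (radial_op a (lam m) Q) t"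
      using a_pos unfolding radial_op_def
      by (simp add: pderiv_diff pderiv_smult power2_eq_square field_simps)
    note eq = this
    have factor: "a\<^sup>2 * (t * (A * e) + c * (B * e)) - t * (C * e) = (a\<^sup>2 * (t * A + c * B) - t * C) * e"
      for A B C c e :: real
      by (simp add: algebra_simps)
    show ?thesis unfolding poly_exp_def factor eq ..
  qed
  then show "\<Delta> (separated p (poly_exp Q)) x = separated p (poly_exp (radial_op a (lam m) Q)) x"
    unfolding \<Delta>_separated[OF assms poly_exp_deriv poly_exp_deriv x] by simp
qed

abbreviation "\<Phi> \<equiv> Phi Rp k a"

lemma \<Phi>_separated: "\<Phi> l m p = separated p (poly_exp (laguerre_poly a l (lam m)))"
  by (rule ext) (simp add: Phi_def separated_def poly_exp_def poly_laguerre_poly)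

definition eigval :: "nat \<Rightarrow> nat \<Rightarrow> real" where
  "eigval l m = - a * (2 * real l + lam m + 1)"

lemma \<Delta>_\<Phi>:
  assumes "p \<in> H m" "x \<in> generic"
  shows "\<Delta> (\<Phi> l m p) x = complex_of_real (eigval l m) * \<Phi> l m p x"
  unfolding \<Phi>_separated \<Delta>_poly_exp[OF assms] radial_op_laguerre_poly[OF a_pos lam_gt]
  by (simp add: separated_def poly_exp_def eigval_def)

lemma eigval_neg: "eigval l m < 0"
proof -
  have "2 * real l + lam m + 1 > 0" using lam_gt[of m] by linarith
  then show ?thesis using a_pos by (simp add: eigval_def mult_pos_pos)
qed

end

section \<open>Integration against the weighted measure\<close>

lemmas has_bochner_integral_imp_integrable = has_bochner_integral_iff[THEN iffD1, THEN conjunct1]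

lemma nn_integral_Gamma_scaled:
  fixes s b :: real
  assumes "s > -1" "b > 0"
  shows "(\<integral>\<^sup>+t. ennreal (indicator {0<..} t * (t powr s * exp (- b * t))) \<partial>lborel)
    = ennreal (Gamma (s + 1) / b powr (s + 1))"
proof -
  have "ennreal (Gamma (s + 1)) = (\<integral>\<^sup>+t. ennreal (indicator {0..} t * t powr s / exp t) \<partial>lborel)"
    using Gamma_conv_nn_integral_real[of "s + 1"] assms(1) by simp
  also have "\<dots> = ennreal b * (\<integral>\<^sup>+t. ennreal (indicator {0..} (0 + b * t) * (0 + b * t) powr s / exp (0 + b * t)) \<partial>lborel)"
    using assms(2) by (subst nn_integral_real_affine[of _ b 0]) auto
  also have "\<dots> = ennreal b * (\<integral>\<^sup>+t. ennreal (b powr s) * ennreal (indicator {0<..} t * (t powr s * exp (- b * t))) \<partial>lborel)"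
  proof (intro arg_cong[where f = "(*) (ennreal b)"] nn_integral_cong)
    fix t :: real
    have "indicator {0..} (0 + b * t) * (0 + b * t) powr s / exp (0 + b * t)
        = b powr s * (indicator {0<..} t * (t powr s * exp (- b * t)))"
    proof (cases "t > 0")
      case True
      have "(b * t) powr s = b powr s * t powr s" by (rule powr_mult)
      then show ?thesis using True assms(2) by (simp add: exp_minus divide_inverse)
    next
      case False
      then have "b * t < 0 \<or> t = 0" using assms(2) by (auto simp: mult_less_0_iff)
      then show ?thesis using False by auto
    qed
    then show "ennreal (indicator {0..} (0 + b * t) * (0 + b * t) powr s / exp (0 + b * t))
        = ennreal (b powr s) * ennreal (indicator {0<..} t * (t powr s * exp (- b * t)))"
      by (simp only: ennreal_mult'[OF powr_ge_zero])
  qed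
  also have "\<dots> = ennreal b * (ennreal (b powr s) * (\<integral>\<^sup>+t. ennreal (indicator {0<..} t * (t powr s * exp (- b * t))) \<partial>lborel))"
    by (subst nn_integral_cmult) measurable
  also have "\<dots> = ennreal (b powr (s + 1)) * (\<integral>\<^sup>+t. ennreal (indicator {0<..} t * (t powr s * exp (- b * t))) \<partial>lborel)"
  proof -
    have "b powr (s + 1) = b * b powr s" using assms(2) by (simp add: powr_add)
    then have "ennreal b * ennreal (b powr s) = ennreal (b powr (s + 1))"
      using assms(2) by (simp only: ennreal_mult'[of b])
    then show ?thesis by (simp only: mult.assoc[symmetric])
  qed
  finally have eq: "ennreal (Gamma (s + 1)) = ennreal (b powr (s + 1)) *
    (\<integral>\<^sup>+t. ennreal (indicator {0<..} t * (t powr s * exp (- b * t))) \<partial>lborel)" .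
  have "ennreal (1 / b powr (s + 1)) * ennreal (b powr (s + 1)) = 1"
    using assms(2) by (subst ennreal_mult[symmetric]) auto
  then have "(\<integral>\<^sup>+t. ennreal (indicator {0<..} t * (t powr s * exp (- b * t))) \<partial>lborel)
      = ennreal (1 / b powr (s + 1)) * ennreal (Gamma (s + 1))"
    unfolding eq mult.assoc[symmetric] by (simp only: mult_1)
  also have "\<dots> = ennreal (Gamma (s + 1) / b powr (s + 1))"
    by (subst ennreal_mult'[symmetric]) (auto simp: mult.commute)
  finally show ?thesis .
qed

lemma has_bochner_integral_Gamma_scaled:
  fixes s b :: real
  assumes "s > -1" "b > 0"
  shows "has_bochner_integral lborel (\<lambda>t. indicator {0<..} t * (t powr s * exp (- b * t)))
    (Gamma (s + 1) / b powr (s + 1))"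
proof (rule has_bochner_integral_nn_integral[OF _ _ _ nn_integral_Gamma_scaled[OF assms]])
  show "0 \<le> Gamma (s + 1) / b powr (s + 1)" using Gamma_real_pos[of "s + 1"] assms by simp
qed auto

lemma borel_measurable_poly[measurable]: "poly (Q :: real poly) \<in> borel_measurable borel"
  by (intro borel_measurable_continuous_onI continuous_on_poly continuous_on_id)

text \<open>The moment functional of the weight \<open>t^\<nu> exp(-b t)\<close> on the half-line.\<close>

definition half_line_integrand :: "real \<Rightarrow> real \<Rightarrow> real poly \<Rightarrow> real \<Rightarrow> real" where
  "half_line_integrand \<nu> b Q t = indicator {0<..} t * (t powr \<nu> * (poly Q t * exp (- b * t)))"

definition half_line_integral :: "real \<Rightarrow> real \<Rightarrow> real poly \<Rightarrow> real" where
  "half_line_integral \<nu> b Q = (LINT t|lborel. half_line_integrand \<nu> b Q t)"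

lemma half_line_monom:
  assumes "\<nu> > -1" "b > 0"
  shows "has_bochner_integral lborel (half_line_integrand \<nu> b (monom 1 n))
    (Gamma (\<nu> + real n + 1) / b powr (\<nu> + real n + 1))"
proof -
  have "half_line_integrand \<nu> b (monom 1 n) = (\<lambda>t. indicator {0<..} t * (t powr (\<nu> + real n) * exp (- b * t)))"
  proof (rule ext)
    fix t :: real
    show "half_line_integrand \<nu> b (monom 1 n) t = indicator {0<..} t * (t powr (\<nu> + real n) * exp (- b * t))"
    proof (cases "t > 0")
      case True
      then have "t powr (\<nu> + real n) = t powr \<nu> * t ^ n" by (simp only: powr_add powr_realpow)
      then show ?thesis by (simp add: half_line_integrand_def poly_monom)
    qed (simp add: half_line_integrand_def)
  qed
  moreover have "\<nu> + real n > -1" using assms(1) by linarith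
  ultimately show ?thesis using has_bochner_integral_Gamma_scaled[OF _ assms(2), of "\<nu> + real n"] by simp
qed

lemma half_line_integrand_add:
  "half_line_integrand \<nu> b (P + Q) = (\<lambda>t. half_line_integrand \<nu> b P t + half_line_integrand \<nu> b Q t)"
  unfolding half_line_integrand_def poly_add distrib_right distrib_left ..

lemma half_line_integrand_smult:
  "half_line_integrand \<nu> b (smult c P) = (\<lambda>t. c * half_line_integrand \<nu> b P t)"
  unfolding half_line_integrand_def poly_smult by (rule ext) (simp only: mult.assoc mult.left_commute[of c])

lemma integrable_half_line:
  assumes "\<nu> > -1" "b > 0" shows "integrable lborel (half_line_integrand \<nu> b Q)"
proof -
  have "integrable lborel (half_line_integrand \<nu> b (\<Sum>i\<in>S. monom (c i) i))" if "finite S" for S c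
    using that
  proof (induction S)
    case empty
    show ?case by (simp add: half_line_integrand_def[abs_def])
  next
    case (insert i S)
    have "monom (c i) i = smult (c i) (monom 1 i)" by (simp add: smult_monom)
    then have "integrable lborel (half_line_integrand \<nu> b (monom (c i) i))"
      using has_bochner_integral_imp_integrable[OF half_line_monom[OF assms]]
      by (simp add: half_line_integrand_smult)
    then show ?case using insert by (simp add: half_line_integrand_add)
  qed
  from this[of "{..degree Q}" "coeff Q"] show ?thesis by (simp add: poly_as_sum_of_monoms)
qed

lemma moment_functional_half_line:
  assumes "\<nu> > -1" "a > 0"
  shows "moment_functional a \<nu> (half_line_integral \<nu> (2 / a))"
proof
  have b: "2 / a > 0" using assms(2) by simp
  show "a > 0" by fact
  show "half_line_integral \<nu> (2 / a) (P + Q) = half_line_integral \<nu> (2 / a) P + half_line_integral \<nu> (2 / a) Q" for P Q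
    using integrable_half_line[OF assms(1) b] by (simp add: half_line_integral_def half_line_integrand_add)
  show "half_line_integral \<nu> (2 / a) (smult c P) = c * half_line_integral \<nu> (2 / a) P" for c P
    by (simp add: half_line_integral_def half_line_integrand_smult)
  fix n
  have pos: "\<nu> + real n + 1 > 0" using assms(1) by linarith
  have "Gamma (\<nu> + real (Suc n) + 1) = (\<nu> + real n + 1) * Gamma (\<nu> + real n + 1)"
    using Gamma_plus1[of "\<nu> + real n + 1"] pos by (simp add: add_ac nonpos_Ints_def)
  moreover have "(2 / a) powr (\<nu> + real (Suc n) + 1) = (2 / a) powr (\<nu> + real n + 1) * (2 / a)"
    using assms(2) powr_add[of "2 / a" "\<nu> + real n + 1" 1] by (simp add: add_ac)
  ultimately show "half_line_integral \<nu> (2 / a) (monom 1 (Suc n))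
      = a / 2 * (\<nu> + real n + 1) * half_line_integral \<nu> (2 / a) (monom 1 n)"
    unfolding half_line_integral_def has_bochner_integral_integral_eq[OF half_line_monom[OF assms(1) b]]
    using assms(2) by (simp add: mult_ac)
qed

context dunkl_a
begin

abbreviation "M \<equiv> dunkl_measure R k a"

lemma borel_measurable_weight[measurable]: "dunkl_weight R k a \<in> borel_measurable borel"
  unfolding dunkl_weight_def[abs_def] by measurable

lemma weight_generic: "x \<in> generic \<Longrightarrow> dunkl_weight R k a x = norm x powr (a - 2) * wt x"
  unfolding dunkl_weight_def wt_def by (auto simp: generic_inner intro!: prod.cong)

lemma space_M[simp]: "space M = UNIV" and sets_M[simp, measurable_cong]: "sets M = sets lebesgue"
  by (simp_all add: dunkl_measure_def)

lemma borel_measurable_M: "f \<in> borel_measurable borel \<Longrightarrow> f \<in> borel_measurable M"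
  unfolding measurable_cong_sets[OF sets_M refl] by (rule measurable_completion) simp

lemma weight_measurable_lebesgue: "dunkl_weight R k a \<in> borel_measurable lebesgue"
  by (rule measurable_completion) simp

lemma AE_M_generic: "AE x in M. x \<in> generic"
  unfolding dunkl_measure_def using AE_generic weight_measurable_lebesgue by (subst AE_density) auto

lemma nn_integral_M:
  assumes [measurable]: "f \<in> borel_measurable borel"
  shows "(\<integral>\<^sup>+x. f x \<partial>M) = (\<integral>\<^sup>+x. ennreal (norm x powr (a - 2) * wt x) * f x \<partial>lborel)"
proof -
  have "(\<integral>\<^sup>+x. f x \<partial>M) = (\<integral>\<^sup>+x. ennreal (dunkl_weight R k a x) * f x \<partial>lebesgue)"
    unfolding dunkl_measure_def using weight_measurable_lebesgue measurable_completion[of f lborel borel]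
    by (subst nn_integral_density) auto
  also have "\<dots> = (\<integral>\<^sup>+x. ennreal (dunkl_weight R k a x) * f x \<partial>lborel)"
    by (rule nn_integral_completion)
  also have "\<dots> = (\<integral>\<^sup>+x. ennreal (norm x powr (a - 2) * wt x) * f x \<partial>lborel)"
    using AE_generic_lborel by (intro nn_integral_cong_AE) (auto elim!: eventually_mono simp: weight_generic)
  finally show ?thesis .
qed

text \<open>The exponent that the weighted measure induces on \<open>t = \<parallel>x\<parallel>^a\<close> in degree \<open>e\<close>.\<close>

definition exponent :: "nat \<Rightarrow> real" where
  "exponent e = (real e + 2 * \<gamma> + real CARD('n) - 2) / a"

lemma exponent_double: "exponent (2 * m) = lam m"
  by (simp add: exponent_def lambda_kam_def)

lemma exponent_gt: "exponent e > -1"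
proof -
  have "a * exponent e > a * (-1)" using index_pos a_pos by (simp add: exponent_def)
  then show ?thesis using a_pos by (simp only: mult_less_cancel_left_pos)
qed

text \<open>The factor \<open>exponent e + 2 / a\<close> normalises the density to a ball integral taken without the
  factor \<open>\<parallel>x\<parallel>^(a-2)\<close> of the weight.\<close>

definition radial_density :: "nat \<Rightarrow> real \<Rightarrow> real" where
  "radial_density e t = indicator {0<..} t * ((exponent e + 2 / a) * t powr exponent e)"

lemma exponent_add_pos: "exponent e + 2 / a > 0"
proof -
  have "0 < real CARD('n)" by simp
  then have "0 < real e + 2 * \<gamma> + real CARD('n)" using \<gamma>_nonneg by linarith
  then show ?thesis using a_pos by (simp add: exponent_def add_divide_distrib[symmetric])
qed

lemma radial_density_nonneg: "0 \<le> radial_density e t"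
  using exponent_add_pos[of e] by (simp add: radial_density_def)

lemma borel_measurable_radial_density[measurable]: "radial_density e \<in> borel_measurable borel"
  unfolding radial_density_def[abs_def] by measurable

definition real_ball_integral :: "(real ^ 'n \<Rightarrow> real) \<Rightarrow> real" where
  "real_ball_integral P = (LINT x|lborel. indicator (cball 0 1) x * (wt x * P x))"

lemma integrable_real_ball:
  assumes "continuous_on UNIV P"
  shows "integrable lborel (\<lambda>x. indicator (cball 0 1) x * (wt x * P x))"
proof -
  have "integrable lborel (\<lambda>x. indicator (cball 0 1) x *\<^sub>R (wt x * P x))"
    by (rule borel_integrable_compact)
      (auto intro!: continuous_intros continuous_on_wt continuous_on_subset[OF assms])
  then show ?thesis by simp
qed

text \<open>Integration in polar coordinates. The weighted density times a homogeneous \<open>P\<close> is homogeneous,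
  so its image under \<open>t = \<parallel>x\<parallel>^a\<close> has a power as density; only the constant, an integral of \<open>P\<close> over the unit
  ball, depends on \<open>P\<close>.\<close>

lemma nn_integral_M_radial:
  fixes P :: "real ^ 'n \<Rightarrow> real"
  assumes P: "continuous_on UNIV P" "\<And>x. 0 \<le> P x"
    and hom: "\<And>c x. c > 0 \<Longrightarrow> P (c *\<^sub>R x) = c ^ e * P x"
    and [measurable]: "g \<in> borel_measurable borel"
  shows "(\<integral>\<^sup>+x. ennreal (P x) * g (norm x powr a) \<partial>M)
    = (\<integral>\<^sup>+t. ennreal (real_ball_integral P * radial_density e t) * g t \<partial>lborel)"
proof -
  have [measurable]: "P \<in> borel_measurable borel" by (rule borel_measurable_continuous_onI[OF P(1)])
  define D where "D = real e + 2 * \<gamma> + real CARD('n)"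
  have D: "D > 0"
  proof -
    have "0 < real CARD('n)" by simp
    then show ?thesis using \<gamma>_nonneg unfolding D_def by linarith
  qed
  define C where "C = real_ball_integral P"
  have C0: "C \<ge> 0"
    unfolding C_def real_ball_integral_def using P(2) wt_nonneg by (intro Bochner_Integration.integral_nonneg) auto
  have norm_pow: "norm x powr (a - 2) = (norm x powr a) powr (1 - 2 / a)" for x :: "real ^ 'n"
  proof -
    have "a * (1 - 2 / a) = a - 2" using a_pos by (simp add: field_simps)
    then show ?thesis by (simp add: powr_powr)
  qed
  have "(\<integral>\<^sup>+x. ennreal (P x) * g (norm x powr a) \<partial>M)
      = (\<integral>\<^sup>+x. ennreal (norm x powr (a - 2) * wt x) * (ennreal (P x) * g (norm x powr a)) \<partial>lborel)"
    by (rule nn_integral_M) measurable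
  also have "\<dots> = (\<integral>\<^sup>+x. ennreal (wt x * P x) * (ennreal ((norm x powr a) powr (1 - 2 / a)) * g (norm x powr a)) \<partial>lborel)"
    using wt_nonneg P(2) by (intro nn_integral_cong) (simp add: norm_pow ennreal_mult mult_ac)
  also have "\<dots> = (\<integral>\<^sup>+t. ennreal (indicator {0<..} t * (C * (D / a) * t powr (D / a - 1))) *
      (ennreal (t powr (1 - 2 / a)) * g t) \<partial>lborel)"
  proof (rule nn_integral_homogeneous_radial[where d = "2 * \<gamma> + real e"])
    show "0 \<le> wt x * P x" for x using wt_nonneg P(2) by simp
    show "wt (c *\<^sub>R x) * P (c *\<^sub>R x) = c powr (2 * \<gamma> + real e) * (wt x * P x)" if "c > 0" for c x
      using that by (simp add: wt_scaleR hom powr_add powr_realpow mult_ac)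
    show "D = 2 * \<gamma> + real e + real DIM(real ^ 'n)" by (simp add: D_def)
    have "(\<integral>\<^sup>+x. indicator (cball 0 1) x * ennreal (wt x * P x) \<partial>lborel)
        = (\<integral>\<^sup>+x. ennreal (indicator (cball 0 1) x * (wt x * P x)) \<partial>lborel)"
      by (intro nn_integral_cong) (auto simp: indicator_def)
    also have "\<dots> = ennreal C"
      unfolding C_def real_ball_integral_def using wt_nonneg P(2)
      by (intro nn_integral_eq_integral integrable_real_ball P(1)) auto
    finally show "(\<integral>\<^sup>+x. indicator (cball 0 1) x * ennreal (wt x * P x) \<partial>lborel) = ennreal C" .
  qed (use D a_pos C0 in auto)
  also have "\<dots> = (\<integral>\<^sup>+t. ennreal (C * radial_density e t) * g t \<partial>lborel)"
  proof (rule nn_integral_cong)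
    fix t :: real
    have "D / a - 1 + (1 - 2 / a) = exponent e" "D / a = exponent e + 2 / a"
      by (simp_all add: exponent_def D_def add_divide_distrib[symmetric] diff_divide_distrib)
    then have "indicator {0<..} t * (C * (D / a) * t powr (D / a - 1)) * t powr (1 - 2 / a) = C * radial_density e t"
      by (simp add: radial_density_def powr_add[symmetric] mult.assoc)
    then have "ennreal (indicator {0<..} t * (C * (D / a) * t powr (D / a - 1))) * ennreal (t powr (1 - 2 / a))
        = ennreal (C * radial_density e t)"
      using C0 D a_pos by (subst ennreal_mult[symmetric]) auto
    then show "ennreal (indicator {0<..} t * (C * (D / a) * t powr (D / a - 1))) * (ennreal (t powr (1 - 2 / a)) * g t)
        = ennreal (C * radial_density e t) * g t"
      by (simp only: mult.assoc[symmetric])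
  qed
  finally show ?thesis by (simp add: C_def)
qed

text \<open>Positive and negative parts of both factors reduce the general case to the previous lemma.\<close>

lemma has_bochner_integral_M_radial_real:
  fixes P :: "real ^ 'n \<Rightarrow> real"
  assumes P: "continuous_on UNIV P" and hom: "\<And>c x. c > 0 \<Longrightarrow> P (c *\<^sub>R x) = c ^ e * P x"
    and [measurable]: "g \<in> borel_measurable borel"
    and int: "integrable lborel (\<lambda>t. radial_density e t * g t)"
  shows "has_bochner_integral M (\<lambda>x. P x * g (norm x powr a))
    (real_ball_integral P * (LINT t|lborel. radial_density e t * g t))"
proof -
  have pos: "has_bochner_integral M (\<lambda>x. P x * g (norm x powr a))
      (real_ball_integral P * (LINT t|lborel. radial_density e t * g t))"
    if P: "continuous_on UNIV P" "\<And>x. 0 \<le> P x" and hom: "\<And>c x. c > 0 \<Longrightarrow> P (c *\<^sub>R x) = c ^ e * P x"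
      and [measurable]: "g \<in> borel_measurable borel" and g0: "\<And>t. 0 \<le> g t"
      and int: "integrable lborel (\<lambda>t. radial_density e t * g t)" for P :: "real ^ 'n \<Rightarrow> real" and g
  proof (rule has_bochner_integral_nn_integral)
    have [measurable]: "P \<in> borel_measurable borel" by (rule borel_measurable_continuous_onI[OF P(1)])
    show "(\<lambda>x. P x * g (norm x powr a)) \<in> borel_measurable M"
      by (rule borel_measurable_M) measurable
    show "AE x in M. 0 \<le> P x * g (norm x powr a)" using P(2) g0 by simp
    have C0: "real_ball_integral P \<ge> 0"
      unfolding real_ball_integral_def using P(2) wt_nonneg by (intro Bochner_Integration.integral_nonneg) auto
    have K0: "(LINT t|lborel. radial_density e t * g t) \<ge> 0"
      using radial_density_nonneg g0 by (intro Bochner_Integration.integral_nonneg) auto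
    show "0 \<le> real_ball_integral P * (LINT t|lborel. radial_density e t * g t)" using C0 K0 by simp
    have "(\<integral>\<^sup>+x. ennreal (P x * g (norm x powr a)) \<partial>M) = (\<integral>\<^sup>+x. ennreal (P x) * ennreal (g (norm x powr a)) \<partial>M)"
      using P(2) g0 by (simp add: ennreal_mult)
    also have "\<dots> = (\<integral>\<^sup>+t. ennreal (real_ball_integral P * radial_density e t) * ennreal (g t) \<partial>lborel)"
      by (rule nn_integral_M_radial[OF P hom]) auto
    also have "\<dots> = (\<integral>\<^sup>+t. ennreal (real_ball_integral P) * ennreal (radial_density e t * g t) \<partial>lborel)"
      using C0 g0 radial_density_nonneg by (intro nn_integral_cong) (simp add: ennreal_mult mult.assoc)
    also have "\<dots> = ennreal (real_ball_integral P) * ennreal (LINT t|lborel. radial_density e t * g t)"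
      using int g0 radial_density_nonneg by (subst nn_integral_cmult) (auto simp: nn_integral_eq_integral)
    finally show "(\<integral>\<^sup>+x. ennreal (P x * g (norm x powr a)) \<partial>M)
        = ennreal (real_ball_integral P * (LINT t|lborel. radial_density e t * g t))"
      using C0 K0 by (simp add: ennreal_mult)
  qed
  define gp gn where "gp t = max 0 (g t)" and "gn t = max 0 (- g t)" for t
  define Pp Pn where "Pp x = max 0 (P x)" and "Pn x = max 0 (- P x)" for x
  have g_parts: "gp \<in> borel_measurable borel" "gn \<in> borel_measurable borel"
    "\<And>t. 0 \<le> gp t" "\<And>t. 0 \<le> gn t" "\<And>t. g t = gp t - gn t"
    by (auto simp: gp_def[abs_def] gn_def[abs_def])
  note [measurable] = g_parts(1,2)
  have part: "integrable lborel (\<lambda>t. radial_density e t * h t)"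
    if [measurable]: "h \<in> borel_measurable borel" and h: "\<And>t. \<bar>h t\<bar> \<le> \<bar>g t\<bar>" for h
  proof (rule Bochner_Integration.integrable_bound[OF int])
    show "AE t in lborel. norm (radial_density e t * h t) \<le> norm (radial_density e t * g t)"
      using h by (auto simp: abs_mult intro!: mult_left_mono)
  qed measurable
  have int_parts: "integrable lborel (\<lambda>t. radial_density e t * gp t)" "integrable lborel (\<lambda>t. radial_density e t * gn t)"
    by (rule part[OF g_parts(1)], simp add: gp_def) (rule part[OF g_parts(2)], simp add: gn_def)
  have P_parts: "continuous_on UNIV Pp" "continuous_on UNIV Pn" "\<And>x. 0 \<le> Pp x" "\<And>x. 0 \<le> Pn x"
    "\<And>x. P x = Pp x - Pn x"
    using P by (auto simp: Pp_def[abs_def] Pn_def[abs_def] intro!: continuous_intros)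
  have hom_parts: "Pp (c *\<^sub>R x) = c ^ e * Pp x" "Pn (c *\<^sub>R x) = c ^ e * Pn x" if "c > 0" for c x
  proof -
    have ce: "0 \<le> c ^ e" using that by simp
    have "max 0 (c ^ e * y) = c ^ e * max 0 y" for y
      using ce by (cases "y \<ge> 0") (simp_all add: max.absorb1 max.absorb2 mult_nonneg_nonpos)
    from this[of "P x"] this[of "- P x"] show "Pp (c *\<^sub>R x) = c ^ e * Pp x" "Pn (c *\<^sub>R x) = c ^ e * Pn x"
      by (simp_all add: Pp_def Pn_def hom[OF that])
  qed
  have K: "(LINT t|lborel. radial_density e t * g t)
      = (LINT t|lborel. radial_density e t * gp t) - (LINT t|lborel. radial_density e t * gn t)"
    using int_parts by (subst Bochner_Integration.integral_diff[symmetric]) (auto simp: g_parts(5) right_diff_distrib)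
  have C: "real_ball_integral P = real_ball_integral Pp - real_ball_integral Pn"
    unfolding real_ball_integral_def using integrable_real_ball[OF P_parts(1)] integrable_real_ball[OF P_parts(2)]
    by (subst Bochner_Integration.integral_diff[symmetric]) (auto simp: P_parts(5) right_diff_distrib)
  have "has_bochner_integral M (\<lambda>x. (Pp x * gp (norm x powr a) - Pp x * gn (norm x powr a))
        - (Pn x * gp (norm x powr a) - Pn x * gn (norm x powr a)))
      ((real_ball_integral Pp * (LINT t|lborel. radial_density e t * gp t)
        - real_ball_integral Pp * (LINT t|lborel. radial_density e t * gn t))
       - (real_ball_integral Pn * (LINT t|lborel. radial_density e t * gp t)
        - real_ball_integral Pn * (LINT t|lborel. radial_density e t * gn t)))"
    by (intro has_bochner_integral_diff pos P_parts g_parts int_parts hom_parts)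
  moreover have "(Pp x * gp (norm x powr a) - Pp x * gn (norm x powr a))
        - (Pn x * gp (norm x powr a) - Pn x * gn (norm x powr a)) = P x * g (norm x powr a)" for x
    by (simp add: P_parts(5) g_parts(5) algebra_simps)
  moreover have "(real_ball_integral Pp * (LINT t|lborel. radial_density e t * gp t)
        - real_ball_integral Pp * (LINT t|lborel. radial_density e t * gn t))
       - (real_ball_integral Pn * (LINT t|lborel. radial_density e t * gp t)
        - real_ball_integral Pn * (LINT t|lborel. radial_density e t * gn t))
      = real_ball_integral P * (LINT t|lborel. radial_density e t * g t)"
    unfolding C K by (simp add: algebra_simps)
  ultimately show ?thesis by simp
qed

lemma has_bochner_integral_M_radial:
  fixes P :: "real ^ 'n \<Rightarrow> complex"
  assumes P: "continuous_on UNIV P" and hom: "homogeneous e P"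
    and g: "g \<in> borel_measurable borel"
    and int: "integrable lborel (\<lambda>t. radial_density e t * g t)"
  shows "has_bochner_integral M (\<lambda>x. P x * complex_of_real (g (norm x powr a)))
    (ball_integral P * complex_of_real (LINT t|lborel. radial_density e t * g t))"
proof -
  define K where "K = (LINT t|lborel. radial_density e t * g t)"
  have hom': "Re (P (c *\<^sub>R x)) = c ^ e * Re (P x)" "Im (P (c *\<^sub>R x)) = c ^ e * Im (P x)" for c x
    using hom by (simp_all add: homogeneous_def)
  have cP: "continuous_on UNIV (\<lambda>x. Re (P x))" "continuous_on UNIV (\<lambda>x. Im (P x))"
    using P by (auto intro!: continuous_intros)
  have "has_bochner_integral M
      (\<lambda>x. complex_of_real (Re (P x) * g (norm x powr a)) + \<i> * complex_of_real (Im (P x) * g (norm x powr a)))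
      (complex_of_real (real_ball_integral (\<lambda>x. Re (P x)) * K) + \<i> * complex_of_real (real_ball_integral (\<lambda>x. Im (P x)) * K))"
    unfolding K_def
    by (intro has_bochner_integral_add has_bochner_integral_mult_right has_bochner_integral_of_real
      has_bochner_integral_M_radial_real cP hom' g int)
  moreover have "complex_of_real (Re (P x) * g (norm x powr a)) + \<i> * complex_of_real (Im (P x) * g (norm x powr a))
      = P x * complex_of_real (g (norm x powr a))" for x
    by (simp add: complex_eq_iff)
  moreover have "ball_integral P = complex_of_real (real_ball_integral (\<lambda>x. Re (P x))) + \<i> * complex_of_real (real_ball_integral (\<lambda>x. Im (P x)))"
  proof -
    have "has_bochner_integral lborel
        (\<lambda>x. complex_of_real (indicator (cball 0 1) x * (wt x * Re (P x))) + \<i> * complex_of_real (indicator (cball 0 1) x * (wt x * Im (P x))))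
        (complex_of_real (real_ball_integral (\<lambda>x. Re (P x))) + \<i> * complex_of_real (real_ball_integral (\<lambda>x. Im (P x))))"
      unfolding real_ball_integral_def
      by (intro has_bochner_integral_add has_bochner_integral_mult_right has_bochner_integral_of_real
        has_bochner_integral_integrable integrable_real_ball cP)
    moreover have "complex_of_real (indicator (cball 0 1) x * (wt x * Re (P x))) + \<i> * complex_of_real (indicator (cball 0 1) x * (wt x * Im (P x)))
        = indicator (cball 0 1) x *\<^sub>R (complex_of_real (wt x) * P x)" for x
      by (simp add: complex_eq_iff)
    ultimately show ?thesis
      unfolding ball_integral_def by (simp add: has_bochner_integral_integral_eq)
  qed
  ultimately show ?thesis by (simp add: K_def distrib_right mult.assoc)
qed

lemma separated_L2:
  assumes p: "polynomial_function p" "homogeneous m p" and [measurable]: "g \<in> borel_measurable borel"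
    and int: "integrable lborel (\<lambda>t. radial_density (2 * m) t * (g t)\<^sup>2)"
  shows "separated p g \<in> L2 M"
proof (rule L2_I)
  have cp: "continuous_on UNIV p" by (rule continuous_on_polynomial[OF p(1)])
  have [measurable]: "p \<in> borel_measurable borel" by (rule borel_measurable_continuous_onI[OF cp])
  show "separated p g \<in> borel_measurable M"
    unfolding separated_def[abs_def] by (rule borel_measurable_M) measurable
  have "integrable M (\<lambda>x. (cmod (p x))\<^sup>2 * (g (norm x powr a))\<^sup>2)"
  proof (rule has_bochner_integral_imp_integrable[OF has_bochner_integral_M_radial_real[where e = "2 * m" and g = "\<lambda>t. (g t)\<^sup>2"]])
    show "continuous_on UNIV (\<lambda>x. (cmod (p x))\<^sup>2)" by (intro continuous_intros cp)
    show "(cmod (p (c *\<^sub>R x)))\<^sup>2 = c ^ (2 * m) * (cmod (p x))\<^sup>2" if "c > 0" for c x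
      using that by (simp add: homogeneousD[OF p(2)] norm_mult norm_power power_mult_distrib power_mult power_commutes[symmetric] mult.commute[of 2])
  qed (use int in auto)
  then show "integrable M (\<lambda>x. (cmod (separated p g x))\<^sup>2)"
    by (simp add: separated_def norm_mult power_mult_distrib)
qed

lemma integrable_radial_density_poly_exp:
  assumes "b > 0"
  shows "integrable lborel (\<lambda>t. radial_density e t * (poly Q t * exp (- b * t)))"
proof -
  have "(\<lambda>t. radial_density e t * (poly Q t * exp (- b * t)))
      = (\<lambda>t. (exponent e + 2 / a) * half_line_integrand (exponent e) b Q t)"
    by (rule ext) (simp add: radial_density_def half_line_integrand_def mult_ac)
  then show ?thesis using integrable_half_line[OF exponent_gt assms] by simp
qed

lemma separated_poly_exp_L2:
  assumes "polynomial_function p" "homogeneous m p" "s > 0"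
  shows "separated p (\<lambda>t. poly Q t * exp (- s * t)) \<in> L2 M"
proof (rule separated_L2[OF assms(1,2)])
  have "(poly Q t * exp (- s * t))\<^sup>2 = poly (Q * Q) t * exp (- (2 * s) * t)" for t
    by (simp add: power2_eq_square exp_add[symmetric] mult_ac)
  then show "integrable lborel (\<lambda>t. radial_density (2 * m) t * (poly Q t * exp (- s * t))\<^sup>2)"
    using integrable_radial_density_poly_exp[of "2 * s" "2 * m" "Q * Q"] assms(3) by simp
qed measurable

lemma \<Phi>_L2: "p \<in> H m \<Longrightarrow> \<Phi> l m p \<in> L2 M"
  unfolding \<Phi>_separated poly_exp_def[abs_def]
  using a_pos by (intro separated_poly_exp_L2) (auto simp: H_iff)

text \<open>For \<open>m \<noteq> n\<close> the angular integral vanishes, for \<open>m = n\<close> and \<open>l \<noteq> j\<close> the radial one.\<close>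

lemma \<Phi>_orthogonal:
  assumes p: "p \<in> H m" and q: "q \<in> H n" and ne: "l \<noteq> j \<or> m \<noteq> n"
  shows "L2_inner M (\<Phi> l m p) (\<Phi> j n q) = 0"
proof -
  define L where "L = laguerre_poly a l (lam m) * laguerre_poly a j (lam n)"
  have p': "polynomial_function p" "homogeneous m p" and q': "polynomial_function q" "homogeneous n q"
    using p q by (auto simp: H_iff)
  have pq: "polynomial_function (\<lambda>x. p x * cnj (q x))" "homogeneous (m + n) (\<lambda>x. p x * cnj (q x))"
  proof -
    show "polynomial_function (\<lambda>x. p x * cnj (q x))"
      by (intro polynomial_function_complex_mult polynomial_function_cnj p' q')
    show "homogeneous (m + n) (\<lambda>x. p x * cnj (q x))"
      unfolding homogeneous_def homogeneousD[OF p'(2)] homogeneousD[OF q'(2)]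
      by (simp add: scaleR_conv_of_real power_add mult_ac)
  qed
  have b: "2 / a > 0" using a_pos by simp
  have "exp (- (1 / a) * t) * exp (- (1 / a) * t) = exp (- (2 / a) * t)" for t
    by (simp add: exp_add[symmetric])
  moreover have "(A * E) * (B * E) = (A * B) * (E * E)" for A B E :: real
    by (simp add: mult_ac)
  ultimately have prod: "poly_exp (laguerre_poly a l (lam m)) t * poly_exp (laguerre_poly a j (lam n)) t
      = poly L t * exp (- (2 / a) * t)" for t
    unfolding poly_exp_def L_def poly_mult by simp
  have eq: "\<Phi> l m p x * cnj (\<Phi> j n q x)
      = p x * cnj (q x) * complex_of_real (poly L (norm x powr a) * exp (- (2 / a) * (norm x powr a)))" for x
    unfolding prod[symmetric] \<Phi>_separated separated_def by (simp add: mult_ac)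
  have "L2_inner M (\<Phi> l m p) (\<Phi> j n q) = ball_integral (\<lambda>x. p x * cnj (q x)) *
      complex_of_real (LINT t|lborel. radial_density (m + n) t * (poly L t * exp (- (2 / a) * t)))"
    unfolding L2_inner_def eq
    by (rule has_bochner_integral_integral_eq, rule has_bochner_integral_M_radial[OF continuous_on_polynomial[OF pq(1)] pq(2)])
      (auto intro!: integrable_radial_density_poly_exp[OF b, simplified] simp del: mult_minus_left)
  also have "\<dots> = 0"
  proof (cases "m = n")
    case False
    then show ?thesis using harmonics_orthogonal[OF p H_cnj[OF q]] by simp
  next
    case True
    interpret moment_functional a "lam m" "half_line_integral (lam m) (2 / a)"
      by (rule moment_functional_half_line[OF lam_gt a_pos])
    have "(\<lambda>t. radial_density (m + n) t * (poly L t * exp (- (2 / a) * t)))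
        = (\<lambda>t. (lam m + 2 / a) * half_line_integrand (lam m) (2 / a) L t)"
      using True exponent_double[of m]
      by (intro ext) (simp add: radial_density_def half_line_integrand_def mult_ac mult_2[symmetric])
    moreover have "(LINT t|lborel. half_line_integrand (lam m) (2 / a) L t) = 0"
      using I_laguerre_orthogonal[OF lam_gt, of l j] ne True unfolding half_line_integral_def L_def by simp
    ultimately show ?thesis by simp
  qed
  finally show ?thesis .
qed

end

section \<open>Density of the span of the eigenfunctions\<close>

definition lincomb :: "('a \<Rightarrow> complex) set \<Rightarrow> ('a \<Rightarrow> complex) set" where
  "lincomb B = {(\<lambda>x. \<Sum>\<phi>\<in>S. c \<phi> * \<phi> x) | S c. finite S \<and> S \<subseteq> B}"

lemma lincombI: "finite S \<Longrightarrow> S \<subseteq> B \<Longrightarrow> (\<lambda>x. \<Sum>\<phi>\<in>S. c \<phi> * \<phi> x) \<in> lincomb B"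
  unfolding lincomb_def by blast

lemma lincombE:
  assumes "f \<in> lincomb B"
  obtains S c where "finite S" "S \<subseteq> B" "f = (\<lambda>x. \<Sum>\<phi>\<in>S. c \<phi> * \<phi> x)"
  using assms unfolding lincomb_def by blast

lemma lincomb_zero: "(\<lambda>x. 0) \<in> lincomb B"
  using lincombI[of "{}" B] by simp

lemma lincomb_base: "\<phi> \<in> B \<Longrightarrow> \<phi> \<in> lincomb B"
  using lincombI[of "{\<phi>}" B "\<lambda>_. 1"] by simp

lemma lincomb_scale: "f \<in> lincomb B \<Longrightarrow> (\<lambda>x. z * f x) \<in> lincomb B"
proof (elim lincombE)
  fix S c assume S: "finite S" "S \<subseteq> B" "f = (\<lambda>x. \<Sum>\<phi>\<in>S. c \<phi> * \<phi> x)"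
  have "(\<lambda>x. z * f x) = (\<lambda>x. \<Sum>\<phi>\<in>S. (z * c \<phi>) * \<phi> x)"
    unfolding S(3) by (simp add: sum_distrib_left mult.assoc)
  then show ?thesis using lincombI[OF S(1,2)] by simp
qed

lemma lincomb_add:
  assumes "f \<in> lincomb B" "g \<in> lincomb B" shows "(\<lambda>x. f x + g x) \<in> lincomb B"
proof -
  obtain S c where S: "finite S" "S \<subseteq> B" "f = (\<lambda>x. \<Sum>\<phi>\<in>S. c \<phi> * \<phi> x)"
    using assms(1) by (rule lincombE)
  obtain T d where T: "finite T" "T \<subseteq> B" "g = (\<lambda>x. \<Sum>\<phi>\<in>T. d \<phi> * \<phi> x)"
    using assms(2) by (rule lincombE)
  define e where "e \<phi> = (if \<phi> \<in> S then c \<phi> else 0) + (if \<phi> \<in> T then d \<phi> else 0)" for \<phi>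
  have "(\<Sum>\<phi>\<in>S \<union> T. (if \<phi> \<in> S then c \<phi> else 0) * \<phi> x) = (\<Sum>\<phi>\<in>S. c \<phi> * \<phi> x)" for x
    using S(1) T(1) by (intro sum.mono_neutral_cong_right) auto
  moreover have "(\<Sum>\<phi>\<in>S \<union> T. (if \<phi> \<in> T then d \<phi> else 0) * \<phi> x) = (\<Sum>\<phi>\<in>T. d \<phi> * \<phi> x)" for x
    using S(1) T(1) by (intro sum.mono_neutral_cong_right) auto
  ultimately have "(\<lambda>x. f x + g x) = (\<lambda>x. \<Sum>\<phi>\<in>S \<union> T. e \<phi> * \<phi> x)"
    by (simp only: e_def distrib_right sum.distrib S(3) T(3))
  then show ?thesis using lincombI[of "S \<union> T" B e] S T by simp
qed

text \<open>Induction on the number of terms, in the form suited to linear statements.\<close>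

lemma lincomb_induct[consumes 1, case_names zero step]:
  assumes "f \<in> lincomb B" and zero: "P (\<lambda>x. 0)"
    and step: "\<And>\<phi> c g. \<phi> \<in> B \<Longrightarrow> g \<in> lincomb B \<Longrightarrow> P g \<Longrightarrow> P (\<lambda>x. c * \<phi> x + g x)"
  shows "P f"
proof -
  obtain S c where S: "finite S" "S \<subseteq> B" "f = (\<lambda>x. \<Sum>\<phi>\<in>S. c \<phi> * \<phi> x)"
    using assms(1) by (rule lincombE)
  have "P (\<lambda>x. \<Sum>\<phi>\<in>S. c \<phi> * \<phi> x)"
    using S(1,2)
  proof (induction S)
    case (insert \<phi> S)
    then have "P (\<lambda>x. c \<phi> * \<phi> x + (\<Sum>\<phi>\<in>S. c \<phi> * \<phi> x))" by (intro step lincombI) auto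
    then show ?case using insert.hyps by simp
  qed (simp add: zero)
  then show ?thesis using S(3) by simp
qed

inductive hom_sum :: "(real ^ 'n \<Rightarrow> complex) \<Rightarrow> bool" where
  hom: "polynomial_function p \<Longrightarrow> homogeneous n p \<Longrightarrow> hom_sum p"
| add: "hom_sum p \<Longrightarrow> hom_sum q \<Longrightarrow> hom_sum (\<lambda>x. p x + q x)"

lemma hom_sum_mult:
  assumes "hom_sum p" "hom_sum q" shows "hom_sum (\<lambda>x. p x * q x)"
  using assms
proof (induction p)
  case (hom p n)
  show ?case
    using hom.prems
  proof (induction q)
    case (hom q m)
    have "homogeneous (n + m) (\<lambda>x. p x * q x)"
      unfolding homogeneous_def homogeneousD[OF \<open>homogeneous n p\<close>] homogeneousD[OF \<open>homogeneous m q\<close>]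
      by (simp add: scaleR_conv_of_real power_add mult_ac)
    then show ?case
      using hom.hyps \<open>polynomial_function p\<close> by (intro hom_sum.hom polynomial_function_complex_mult)
  next
    case (add q r)
    then show ?case unfolding distrib_left by (intro hom_sum.add)
  qed
next
  case (add p r)
  then show ?case unfolding distrib_right by (intro hom_sum.add) auto
qed

lemma polynomial_hom_sum:
  fixes p :: "real ^ 'n \<Rightarrow> complex"
  assumes "polynomial_function p" shows "hom_sum p"
  using assms
proof (induction rule: complex_polynomial_induct)
  case (const c)
  show ?case by (rule hom_sum.hom[of _ 0]) (auto simp: homogeneous_def)
next
  case (inner v)
  show ?case
    by (rule hom_sum.hom[of _ 1], rule polynomial_function_of_real[OF real_polynomial_function_inner])
      (simp add: homogeneous_def scaleR_conv_of_real[where 'a=complex])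
qed (auto intro: hom_sum.add hom_sum_mult)

lemma polynomial_approximating_sequence:
  fixes f :: "'a::euclidean_space \<Rightarrow> real"
  assumes S: "compact S" and f: "continuous_on S f"
  obtains P B where "\<And>n. real_polynomial_function (P n)" "\<And>n x. x \<in> S \<Longrightarrow> \<bar>P n x\<bar> \<le> B"
    "\<And>x. x \<in> S \<Longrightarrow> (\<lambda>n::nat. P n x) \<longlonglongrightarrow> f x"
proof -
  define e where "e n = 1 / real (Suc n)" for n
  have e: "0 < e n" "e n \<le> 1" for n by (simp_all add: e_def)
  have "\<exists>P. real_polynomial_function P \<and> (\<forall>x\<in>S. \<bar>f x - P x\<bar> < e n)" for n
  proof -
    obtain P where P: "real_polynomial_function P" "\<And>x. x \<in> S \<Longrightarrow> \<bar>f x - P x\<bar> < e n"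
      by (rule Stone_Weierstrass_real_polynomial_function[OF S f e(1)[of n]]) (rule that)
    then have "real_polynomial_function P \<and> (\<forall>x\<in>S. \<bar>f x - P x\<bar> < e n)" by simp
    then show ?thesis by (rule exI[of _ P])
  qed
  then have "\<forall>n. \<exists>P. real_polynomial_function P \<and> (\<forall>x\<in>S. \<bar>f x - P x\<bar> < e n)" by (rule allI)
  from choice[OF this] obtain P where P: "\<forall>n. real_polynomial_function (P n) \<and> (\<forall>x\<in>S. \<bar>f x - P n x\<bar> < e n)"
    by (rule exE)
  have "bounded (f ` S)" by (intro compact_imp_bounded compact_continuous_image f S)
  then obtain B where B: "\<forall>u\<in>f ` S. norm u \<le> B" unfolding bounded_iff by (rule exE)
  show thesis
  proof (rule that[of P "B + 1"])
    show "real_polynomial_function (P n)" for n using P by simp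
    fix x assume x: "x \<in> S"
    have d: "\<bar>f x - P n x\<bar> < e n" for n using P x by simp
    have "\<bar>f x\<bar> \<le> B" using B[rule_format, OF imageI[OF x]] by simp
    then show "\<bar>P n x\<bar> \<le> B + 1" for n using d[of n] e(2)[of n] by linarith
    have "(\<lambda>n. P n x - f x) \<longlonglongrightarrow> 0"
    proof (rule Lim_null_comparison)
      show "e \<longlonglongrightarrow> 0"
        unfolding e_def[abs_def] using LIMSEQ_Suc[OF lim_1_over_n[where 'a = real]] by simp
      have "norm (P n x - f x) \<le> e n" for n using d[of n] by simp
      then show "\<forall>\<^sub>F n in sequentially. norm (P n x - f x) \<le> e n" by simp
    qed
    then show "(\<lambda>n. P n x) \<longlonglongrightarrow> f x" by (simp only: Lim_null[symmetric])
  qed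
qed

context dunkl_a
begin

definition "eigenfunctions = {\<Phi> l m p | l m p. p \<in> H m}"

abbreviation "W \<equiv> W_ka Rp k a"

lemma W_lincomb: "W = lincomb eigenfunctions"
  unfolding W_ka_def lincomb_def eigenfunctions_def ..

lemma W_L2: "f \<in> W \<Longrightarrow> f \<in> L2 M"
  unfolding W_lincomb
proof (induction rule: lincomb_induct)
  case (step \<phi> c g)
  then have "\<phi> \<in> L2 M" using \<Phi>_L2 unfolding eigenfunctions_def by blast
  with step show ?case by (intro L2_add L2_scale)
qed simp

text \<open>The members of the closure of \<open>W\<close>.\<close>

definition approx :: "(real ^ 'n \<Rightarrow> complex) \<Rightarrow> bool" where
  "approx f \<longleftrightarrow> f \<in> L2 M \<and> (\<forall>\<epsilon>>0. \<exists>u\<in>W. L2_norm M (\<lambda>x. f x - u x) < \<epsilon>)"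

lemma approx_L2: "approx f \<Longrightarrow> f \<in> L2 M"
  by (simp add: approx_def)

lemma approxE:
  assumes "approx f" "\<epsilon> > 0"
  obtains u where "u \<in> W" "u \<in> L2 M" "L2_norm M (\<lambda>x. f x - u x) < \<epsilon>"
  using assms W_L2 unfolding approx_def by blast

lemma approx_W: "u \<in> W \<Longrightarrow> approx u"
  using W_L2 by (auto simp: approx_def intro!: bexI[of _ u])

lemma approx_zero: "approx (\<lambda>x. 0)"
  by (rule approx_W) (simp add: W_lincomb lincomb_zero)

lemma approx_add:
  assumes "approx f" "approx g" shows "approx (\<lambda>x. f x + g x)"
  unfolding approx_def
proof (intro conjI allI impI)
  note L = approx_L2[OF assms(1)] approx_L2[OF assms(2)]
  show "(\<lambda>x. f x + g x) \<in> L2 M" by (intro L2_add L)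
  fix \<epsilon> :: real assume "\<epsilon> > 0"
  then have "\<epsilon> / 2 > 0" by simp
  obtain u where u: "u \<in> W" "u \<in> L2 M" "L2_norm M (\<lambda>x. f x - u x) < \<epsilon> / 2"
    by (rule approxE[OF assms(1) \<open>\<epsilon> / 2 > 0\<close>])
  obtain v where v: "v \<in> W" "v \<in> L2 M" "L2_norm M (\<lambda>x. g x - v x) < \<epsilon> / 2"
    by (rule approxE[OF assms(2) \<open>\<epsilon> / 2 > 0\<close>])
  have "L2_norm M (\<lambda>x. (f x + g x) - (u x + v x)) \<le> L2_norm M (\<lambda>x. f x - u x) + L2_norm M (\<lambda>x. g x - v x)"
    using L2_norm_triangle[OF L2_diff[OF L(1) u(2)] L2_diff[OF L(2) v(2)]] by (simp add: algebra_simps)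
  then have "L2_norm M (\<lambda>x. (f x + g x) - (u x + v x)) < \<epsilon>" using u v by linarith
  moreover have "(\<lambda>x. u x + v x) \<in> W" using u v unfolding W_lincomb by (intro lincomb_add)
  ultimately show "\<exists>u\<in>W. L2_norm M (\<lambda>x. (f x + g x) - u x) < \<epsilon>" by (intro bexI[of _ "\<lambda>x. u x + v x"])
qed

lemma approx_scale:
  assumes "approx f" shows "approx (\<lambda>x. c * f x)"
  unfolding approx_def
proof (intro conjI allI impI)
  show "(\<lambda>x. c * f x) \<in> L2 M" by (intro L2_scale approx_L2 assms)
  fix \<epsilon> :: real assume \<epsilon>: "\<epsilon> > 0"
  then have "\<epsilon> / (cmod c + 1) > 0" by (simp add: add_nonneg_pos)
  then obtain u where u: "u \<in> W" "u \<in> L2 M" "L2_norm M (\<lambda>x. f x - u x) < \<epsilon> / (cmod c + 1)"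
    by (rule approxE[OF assms])
  have "L2_norm M (\<lambda>x. c * f x - c * u x) = cmod c * L2_norm M (\<lambda>x. f x - u x)"
    unfolding right_diff_distrib[symmetric] by (rule L2_norm_scale)
  also have "\<dots> \<le> (cmod c + 1) * L2_norm M (\<lambda>x. f x - u x)" by (intro mult_right_mono) auto
  also have "\<dots> < \<epsilon>"
    using u(3) by (simp add: pos_less_divide_eq add_nonneg_pos mult.commute)
  finally have "L2_norm M (\<lambda>x. c * f x - c * u x) < \<epsilon>" .
  then show "\<exists>u\<in>W. L2_norm M (\<lambda>x. c * f x - u x) < \<epsilon>"
    using lincomb_scale[of u eigenfunctions c] u(1) unfolding W_lincomb by (intro bexI[of _ "\<lambda>x. c * u x"])
qed

lemma approx_sum:
  "(\<And>i. i \<in> I \<Longrightarrow> approx (f i)) \<Longrightarrow> approx (\<lambda>x. \<Sum>i\<in>I. f i x)"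
proof (induction I rule: infinite_finite_induct)
  case (insert i I)
  then show ?case by (simp add: approx_add)
qed (simp_all add: approx_zero)

text \<open>The closure is closed under dominated convergence, which drives every further extension step.\<close>

lemma approx_dominated:
  assumes f: "\<And>n. approx (f n)" and [measurable]: "g \<in> borel_measurable M"
    and h: "integrable M (\<lambda>x. (h x)\<^sup>2)"
    and lim: "AE x in M. (\<lambda>n. f n x) \<longlonglongrightarrow> g x" and bd: "\<And>n. AE x in M. cmod (f n x) \<le> h x"
  shows "approx g"
proof -
  note conv = L2_norm_dominated_convergence[OF L2_measurable[OF approx_L2[OF f]] assms(2) h lim bd]
  show ?thesis
    unfolding approx_def
  proof (intro conjI allI impI)
    show g: "g \<in> L2 M" by (rule conv(2))
    fix \<epsilon> :: real assume "\<epsilon> > 0"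
    then have "\<epsilon> / 2 > 0" by simp
    then have "\<forall>\<^sub>F n in sequentially. L2_norm M (\<lambda>x. f n x - g x) < \<epsilon> / 2"
      by (rule order_tendstoD(2)[OF conv(1)])
    then obtain n where n: "L2_norm M (\<lambda>x. f n x - g x) < \<epsilon> / 2"
      by (rule eventually_happens'[OF sequentially_bot, THEN exE])
    obtain u where u: "u \<in> W" "u \<in> L2 M" "L2_norm M (\<lambda>x. f n x - u x) < \<epsilon> / 2"
      by (rule approxE[OF f \<open>\<epsilon> / 2 > 0\<close>])
    have "L2_norm M (\<lambda>x. g x - u x) \<le> L2_norm M (\<lambda>x. g x - f n x) + L2_norm M (\<lambda>x. f n x - u x)"
      by (intro L2_norm_triangle_diff g u approx_L2[OF f])
    then have "L2_norm M (\<lambda>x. g x - u x) < \<epsilon>"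
      using n u(3) L2_norm_minus_commute[of M g "f n"] by linarith
    then show "\<exists>u\<in>W. L2_norm M (\<lambda>x. g x - u x) < \<epsilon>" using u(1) by (rule bexI)
  qed
qed

lemma approx_AE_cong:
  assumes "approx f" "g \<in> borel_measurable M" "AE x in M. f x = g x" shows "approx g"
proof (rule approx_dominated[where f = "\<lambda>_. f" and h = "\<lambda>x. cmod (f x)"])
  show "AE x in M. (\<lambda>n. f x) \<longlonglongrightarrow> g x" using assms(3) by eventually_elim simp
qed (use assms L2_integrable[OF approx_L2[OF assms(1)]] in auto)

text \<open>The \<open>l\<close>-th Laguerre polynomial has degree \<open>l\<close>, so for a fixed harmonic polynomial the
  Laguerre polynomials span all polynomials in \<open>t\<close>.\<close>

lemma approx_poly_exp:
  assumes p: "p \<in> H m" shows "approx (separated p (poly_exp Q))"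
proof (induction "degree Q" arbitrary: Q rule: less_induct)
  case less
  define n where "n = degree Q"
  define L where "L = laguerre_poly a n (lam m)"
  have degL: "degree L \<le> n" unfolding L_def by (rule degree_le) (simp add: coeff_laguerre_poly)
  have "Gamma (lam m + real n + 1) > 0" using lam_gt[of m] by (intro Gamma_real_pos) linarith
  then have cL: "coeff L n \<noteq> 0" using a_pos unfolding L_def coeff_laguerre_poly by simp
  define c where "c = coeff Q n / coeff L n"
  define Q' where "Q' = Q - smult c L"
  have "degree Q' \<le> n" unfolding Q'_def n_def[symmetric]
    by (intro degree_diff_le) (use degL degree_smult_le[of c L] n_def in auto)
  moreover have "coeff Q' n = 0" using cL by (simp add: Q'_def c_def)
  ultimately have "Q' = 0 \<or> degree Q' < degree Q" unfolding n_def by (rule eq_zero_or_degree_less)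
  then have "approx (separated p (poly_exp Q'))"
  proof
    assume "Q' = 0"
    then have "separated p (poly_exp Q') = (\<lambda>x. 0)" by (auto simp: separated_def poly_exp_def)
    then show ?thesis by (simp only: approx_zero)
  qed (rule less)
  moreover have "approx (separated p (poly_exp L))"
    unfolding L_def \<Phi>_separated[symmetric]
    by (rule approx_W) (use p in \<open>auto simp: W_lincomb eigenfunctions_def intro!: lincomb_base\<close>)
  moreover have "separated p (poly_exp Q) = (\<lambda>x. separated p (poly_exp Q') x + complex_of_real c * separated p (poly_exp L) x)"
  proof (rule ext)
    fix x
    have "poly_exp Q t = poly_exp Q' t + c * poly_exp L t" for t
      by (simp add: Q'_def poly_exp_def left_diff_distrib)
    then show "separated p (poly_exp Q) x = separated p (poly_exp Q') x + complex_of_real c * separated p (poly_exp L) x"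
      by (simp add: separated_def distrib_left mult_ac)
  qed
  ultimately show ?case by (simp add: approx_add approx_scale)
qed

text \<open>The Taylor series of \<open>exp((s - s') t)\<close> times \<open>exp(-s t)\<close> converges dominatedly as long as
  \<open>\<bar>s - s'\<bar> < s\<close>, so the rate can be changed from \<open>s\<close> to any positive \<open>s' < 2 s\<close>.\<close>

lemma approx_change_rate:
  assumes p: "p \<in> H m" and s: "s > 0" "0 < s'" "s' < 2 * s"
    and approx: "\<And>Q. approx (separated p (\<lambda>t. poly Q t * exp (- s * t)))"
  shows "approx (separated p (\<lambda>t. poly Q t * exp (- s' * t)))"
proof -
  have p': "polynomial_function p" "homogeneous m p" using p by (auto simp: H_iff)
  define c where "c = s - s'"
  (* The partial sums of the series of exp (c t) are bounded by exp (|c| t), so r is the rate of decay of the common bound. *)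
  define r where "r = s - \<bar>c\<bar>"
  have r: "r > 0" using s by (auto simp: r_def c_def abs_if)
  define E where "E n = (\<Sum>j<n. monom (c ^ j / fact j) j)" for n
  have E: "poly (E n) t = (\<Sum>j<n. (c * t) ^ j /\<^sub>R fact j)" for n t
    unfolding E_def poly_sum by (intro sum.cong refl) (simp add: poly_monom power_mult_distrib divide_inverse mult_ac)
  let ?h = "separated p (\<lambda>t. poly Q t * exp (- r * t))"
  show ?thesis
  proof (rule approx_dominated[where f = "\<lambda>n. separated p (\<lambda>t. poly (Q * E n) t * exp (- s * t))" and h = "\<lambda>x. cmod (?h x)"])
    show "approx (separated p (\<lambda>t. poly (Q * E n) t * exp (- s * t)))" for n by (rule approx)
    show "separated p (\<lambda>t. poly Q t * exp (- s' * t)) \<in> borel_measurable M"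
      by (intro L2_measurable separated_poly_exp_L2[OF p'] s)
    show "integrable M (\<lambda>x. (cmod (?h x))\<^sup>2)"
      by (intro L2_integrable separated_poly_exp_L2[OF p'] r)
    have "(\<lambda>n. separated p (\<lambda>t. poly (Q * E n) t * exp (- s * t)) x) \<longlonglongrightarrow> separated p (\<lambda>t. poly Q t * exp (- s' * t)) x" for x
    proof -
      define t where "t = norm x powr a"
      have "(\<lambda>n. poly (E n) t) \<longlonglongrightarrow> exp (c * t)"
        unfolding E using exp_converges[of "c * t"] by (simp add: sums_def)
      then have "(\<lambda>n. p x * complex_of_real (poly Q t * (poly (E n) t * exp (- s * t))))
          \<longlonglongrightarrow> p x * complex_of_real (poly Q t * (exp (c * t) * exp (- s * t)))"
        by (intro tendsto_intros)
      moreover have "exp (c * t) * exp (- s * t) = exp (- s' * t)"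
        unfolding exp_add[symmetric] by (simp add: c_def algebra_simps)
      ultimately show ?thesis by (simp only: separated_def t_def[symmetric] poly_mult mult.assoc)
    qed
    then show "AE x in M. (\<lambda>n. separated p (\<lambda>t. poly (Q * E n) t * exp (- s * t)) x) \<longlonglongrightarrow> separated p (\<lambda>t. poly Q t * exp (- s' * t)) x"
      by simp
    have "cmod (separated p (\<lambda>t. poly (Q * E n) t * exp (- s * t)) x) \<le> cmod (?h x)" for n x
    proof -
      define t where "t = norm x powr a"
      have "\<bar>poly (E n) t\<bar> \<le> (\<Sum>j<n. \<bar>(c * t) ^ j /\<^sub>R fact j\<bar>)" unfolding E by (rule sum_abs)
      also have "\<dots> = (\<Sum>j<n. \<bar>c * t\<bar> ^ j /\<^sub>R fact j)" by (simp add: power_abs abs_mult)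
      also have "\<dots> \<le> exp \<bar>c * t\<bar>"
        unfolding sums_unique[OF exp_converges[of "\<bar>c * t\<bar>"]]
        by (intro sum_le_suminf sums_summable[OF exp_converges[of "\<bar>c * t\<bar>"]]) auto
      also have "\<bar>c * t\<bar> = \<bar>c\<bar> * t" by (simp add: abs_mult t_def)
      finally have "\<bar>poly (E n) t\<bar> * exp (- s * t) \<le> exp (\<bar>c\<bar> * t) * exp (- s * t)"
        by (intro mult_right_mono) auto
      also have "\<dots> = exp (- r * t)" unfolding exp_add[symmetric] by (simp add: r_def algebra_simps)
      finally have "cmod (p x) * \<bar>poly Q t\<bar> * (\<bar>poly (E n) t\<bar> * exp (- s * t)) \<le> cmod (p x) * \<bar>poly Q t\<bar> * exp (- r * t)"
        by (intro mult_left_mono) auto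
      then show ?thesis by (simp add: separated_def t_def[symmetric] norm_mult abs_mult mult.assoc)
    qed
    then show "AE x in M. cmod (separated p (\<lambda>t. poly (Q * E n) t * exp (- s * t)) x) \<le> cmod (?h x)" for n
      by simp
  qed
qed

text \<open>Starting from the rate \<open>1 / a\<close>, the rate can be multiplied repeatedly by \<open>3/2 < 2\<close> to exceed
  half of any given rate.\<close>

lemma approx_exp:
  assumes p: "p \<in> H m" and s: "s > 0"
  shows "approx (separated p (\<lambda>t. poly Q t * exp (- s * t)))"
proof -
  have "approx (separated p (\<lambda>t. poly Q t * exp (- ((3/2) ^ n / a) * t)))" for n Q
  proof (induction n arbitrary: Q)
    case 0
    show ?case using approx_poly_exp[OF p] by (simp add: poly_exp_def[abs_def])
  next
    case (Suc n)
    have pos: "(3/2) ^ n / a > 0" using a_pos by simp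
    have "(3/2) ^ Suc n / a = 3/2 * ((3/2) ^ n / a)" by simp
    then have "0 < (3/2) ^ Suc n / a" "(3/2) ^ Suc n / a < 2 * ((3/2) ^ n / a)" using pos by linarith+
    then show ?case by (rule approx_change_rate[OF p pos _ _ Suc])
  qed
  moreover obtain n where "a * s < (3/2) ^ n" using real_arch_pow[of "3/2" "a * s"] by auto
  then have "s < 2 * ((3/2) ^ n / a)"
    using a_pos s by (simp add: pos_less_divide_eq mult.commute) (smt (verit) mult_pos_pos)
  ultimately show ?thesis
    using a_pos by (intro approx_change_rate[OF p _ s, of "(3/2) ^ n / a"]) auto
qed

text \<open>With \<open>y = exp(-t)\<close>, a compactly supported function of \<open>t\<close> becomes a function on \<open>{0..1}\<close>
  divisible by \<open>y\<close>, to which the Weierstrass theorem applies.\<close>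

lemma approx_compact_radial:
  assumes p: "p \<in> H m" and g: "continuous_on UNIV g" and b: "b \<ge> 0" "\<And>t. t \<ge> b \<Longrightarrow> g t = 0"
  shows "approx (separated p g)"
proof -
  have p': "polynomial_function p" "homogeneous m p" using p by (auto simp: H_iff)
  have [measurable]: "p \<in> borel_measurable borel" "g \<in> borel_measurable borel"
    by (intro borel_measurable_continuous_onI continuous_on_polynomial p' g)+
  define \<delta> where "\<delta> = exp (- b)"
  have \<delta>: "\<delta> > 0" "- ln \<delta> = b" by (simp_all add: \<delta>_def)
  (* G y = g (- ln y) / y for y >= exp (- b); below, it keeps its value 0 at exp (- b), which avoids the singularity at 0. *)
  define G where "G y = g (- ln (max y \<delta>)) / max y \<delta>" for y
  have "continuous_on {0..1} G"
    unfolding G_def using \<delta>(1)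
    by (intro continuous_intros continuous_on_compose2[OF g]) auto
  then obtain P B where P: "\<And>n. real_polynomial_function (P n)" "\<And>n y. y \<in> {0..1} \<Longrightarrow> \<bar>P n y\<bar> \<le> B"
      "\<And>y. y \<in> {0..1} \<Longrightarrow> (\<lambda>n. P n y) \<longlonglongrightarrow> G y"
    by (rule polynomial_approximating_sequence[OF compact_Icc]) (rule that)
  let ?f = "\<lambda>n. separated p (\<lambda>t. exp (- t) * P n (exp (- t)))"
  let ?h = "separated p (\<lambda>t. poly [:B:] t * exp (- 1 * t))"
  show ?thesis
  proof (rule approx_dominated[where f = ?f and h = "\<lambda>x. cmod (?h x)"])
    show "approx (?f n)" for n
    proof -
      obtain c N where cN: "P n = (\<lambda>y. \<Sum>i\<le>N. c i * y ^ i)"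
        using P(1)[of n] unfolding real_polynomial_function_iff_sum by (elim exE) (rule that)
      have eq: "?f n = (\<lambda>x. \<Sum>i\<le>N. complex_of_real (c i) * separated p (\<lambda>t. poly 1 t * exp (- real (Suc i) * t)) x)"
      proof (rule ext)
        fix x
        have e: "exp (- t) * (c i * exp (- t) ^ i) = c i * exp (- real (Suc i) * t)" for t i
        proof -
          have "exp (- t) * exp (- t) ^ i = exp (- real (Suc i) * t)"
            unfolding exp_of_nat_mult[symmetric] exp_add[symmetric] by (simp add: algebra_simps)
          then show ?thesis by (metis mult.left_commute)
        qed
        show "?f n x = (\<Sum>i\<le>N. complex_of_real (c i) * separated p (\<lambda>t. poly 1 t * exp (- real (Suc i) * t)) x)"
          unfolding separated_def cN sum_distrib_left e of_real_sum by (simp add: mult_ac)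
      qed
      show ?thesis unfolding eq by (intro approx_sum approx_scale approx_exp[OF p]) simp_all
    qed
    show "separated p g \<in> borel_measurable M"
      unfolding separated_def[abs_def] by (rule borel_measurable_M) measurable
    show "integrable M (\<lambda>x. (cmod (?h x))\<^sup>2)"
      by (intro L2_integrable separated_poly_exp_L2[OF p']) simp
    have y01: "exp (- (norm x powr a)) \<in> {0..1}" for x :: "real ^ 'n" by simp
    have "(\<lambda>n. ?f n x) \<longlonglongrightarrow> separated p g x" for x
    proof -
      define t where "t = norm x powr a"
      have "(\<lambda>n. P n (exp (- t))) \<longlonglongrightarrow> G (exp (- t))" using P(3)[OF y01] by (simp add: t_def)
      then have "(\<lambda>n. p x * complex_of_real (exp (- t) * P n (exp (- t)))) \<longlonglongrightarrow> p x * complex_of_real (exp (- t) * G (exp (- t)))"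
        by (intro tendsto_intros)
      moreover have "exp (- t) * G (exp (- t)) = g t"
      proof (cases "t \<le> b")
        case True
        then have "max (exp (- t)) \<delta> = exp (- t)" by (simp add: \<delta>_def)
        then show ?thesis by (simp add: G_def)
      next
        case False
        then have "max (exp (- t)) \<delta> = \<delta>" by (simp add: \<delta>_def)
        then show ?thesis using False b(2)[of b] b(2)[of t] by (simp add: G_def \<delta>(2))
      qed
      ultimately show ?thesis by (simp add: separated_def t_def[symmetric])
    qed
    then show "AE x in M. (\<lambda>n. ?f n x) \<longlonglongrightarrow> separated p g x" by simp
    have "cmod (?f n x) \<le> cmod (?h x)" for n x
    proof -
      define t where "t = norm x powr a"
      have y: "exp (- t) \<in> {0..1}" using y01 by (simp add: t_def)
      have Pb: "\<bar>P n (exp (- t))\<bar> \<le> B" using P(2)[OF y] .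
      then have B0: "B \<ge> 0" by linarith
      have "cmod (p x) * (exp (- t) * \<bar>P n (exp (- t))\<bar>) \<le> cmod (p x) * (exp (- t) * B)"
        using Pb by (intro mult_left_mono) auto
      then show ?thesis using B0 by (simp add: separated_def t_def[symmetric] norm_mult abs_mult mult.commute)
    qed
    then show "AE x in M. cmod (?f n x) \<le> cmod (?h x)" for n by simp
  qed
qed

text \<open>In the Fischer decomposition the factors \<open>\<parallel>x\<parallel>^(2j)\<close> are absorbed into the radial function.\<close>

lemma approx_polynomial_radial:
  assumes p: "polynomial_function p" and g: "continuous_on UNIV g" and b: "b \<ge> 0" "\<And>t. t \<ge> b \<Longrightarrow> g t = 0"
  shows "approx (separated p g)"
  using polynomial_hom_sum[OF p]
proof induction
  case (hom p n)
  obtain h where h: "\<And>j. j \<le> n div 2 \<Longrightarrow> h j \<in> H (n - 2 * j)"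
    "\<And>x. p x = (\<Sum>j\<le>n div 2. complex_of_real ((x \<bullet> x) ^ j) * h j x)"
    using fischer_decomposition[OF hom] by blast
  (* The maximum makes gj continuous on the whole line. *)
  define gj where "gj j t = (max 0 t powr (1 / a)) ^ (2 * j) * g t" for j t
  have gj: "(x \<bullet> x) ^ j * g (norm x powr a) = gj j (norm x powr a)" for j x
  proof -
    have "(norm x powr a) powr (1 / a) = norm x" using a_pos by (simp add: powr_powr)
    then show ?thesis by (simp add: gj_def power_mult power2_norm_eq_inner)
  qed
  have "complex_of_real ((x \<bullet> x) ^ j) * h j x * complex_of_real (g (norm x powr a)) = separated (h j) (gj j) x" for j x
    unfolding separated_def gj[symmetric] of_real_mult by (simp only: mult_ac)
  then have "separated p g = (\<lambda>x. \<Sum>j\<le>n div 2. separated (h j) (gj j) x)"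
    by (intro ext) (simp only: separated_def[of p] h(2) sum_distrib_right)
  moreover have cgj: "continuous_on UNIV (gj j)" for j
    unfolding gj_def[abs_def] using a_pos by (intro continuous_intros continuous_on_powr' g) auto
  moreover have "approx (separated (h j) (gj j))" if "j \<le> n div 2" for j
    by (rule approx_compact_radial[OF h(1)[OF that] cgj b(1)]) (simp add: gj_def b(2))
  ultimately show ?case by (simp only:) (intro approx_sum, simp)
next
  case (add p q)
  have "separated (\<lambda>x. p x + q x) g = (\<lambda>x. separated p g x + separated q g x)"
    by (rule ext) (simp add: separated_def distrib_right)
  then show ?case using add by (simp add: approx_add)
qed

text \<open>A continuous radial cut-off. Multiplied by it, bounded functions become square-integrable, so
  that dominated convergence applies to them.\<close>

definition cut :: "real \<Rightarrow> real ^ 'n \<Rightarrow> real" where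
  "cut r x = max 0 (min 1 (r + 1 - norm x powr a))"

lemma cut_range: "0 \<le> cut r x" "cut r x \<le> 1"
  by (auto simp: cut_def)

lemma borel_measurable_cut[measurable]: "cut r \<in> borel_measurable borel"
  unfolding cut_def[abs_def] by measurable

lemma H_one: "(\<lambda>x. 1) \<in> H 0"
  unfolding H_iff
  using lap_homogeneous_less_2[of "\<lambda>x. 1" 0] by (auto simp: homogeneous_def)

lemma cut_separated: "separated p (\<lambda>t. max 0 (min 1 (r + 1 - t))) x = p x * complex_of_real (cut r x)"
  by (simp add: separated_def cut_def)

lemma integrable_cut_sq:
  assumes "r \<ge> 0" shows "integrable M (\<lambda>x. (C * cut r x)\<^sup>2)"
proof -
  have "approx (separated (\<lambda>x. 1) (\<lambda>t. max 0 (min 1 (r + 1 - t))))"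
    by (rule approx_compact_radial[OF H_one, of _ "r + 1"]) (use assms in \<open>auto intro!: continuous_intros\<close>)
  from L2_integrable[OF approx_L2[OF this]] have "integrable M (\<lambda>x. (cut r x)\<^sup>2)"
    by (simp add: cut_separated)
  then show ?thesis by (simp add: power_mult_distrib)
qed

lemma approx_continuous_cut:
  assumes f: "continuous_on UNIV f" and r: "r \<ge> 0"
  shows "approx (\<lambda>x. complex_of_real (f x * cut r x))"
proof -
  define \<rho> where "\<rho> = (r + 1) powr (1 / a)"
  have out: "cut r x = 0" if "x \<notin> cball 0 \<rho>" for x
  proof -
    have "\<rho> powr a < norm x powr a" using that a_pos by (intro powr_less_mono2) (auto simp: \<rho>_def)
    then show ?thesis using a_pos r by (simp add: \<rho>_def powr_powr cut_def)
  qed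
  have [measurable]: "f \<in> borel_measurable borel" by (rule borel_measurable_continuous_onI[OF f])
  have cf: "continuous_on (cball 0 \<rho>) f" using f by (rule continuous_on_subset) simp
  obtain P B where P: "\<And>n. real_polynomial_function (P n)" "\<And>n x. x \<in> cball 0 \<rho> \<Longrightarrow> \<bar>P n x\<bar> \<le> B"
      "\<And>x. x \<in> cball 0 \<rho> \<Longrightarrow> (\<lambda>n. P n x) \<longlonglongrightarrow> f x"
    by (rule polynomial_approximating_sequence[OF compact_cball cf]) (rule that)
  show ?thesis
  proof (rule approx_dominated[where f = "\<lambda>n x. complex_of_real (P n x) * complex_of_real (cut r x)" and h = "\<lambda>x. B * cut r x"])
    show "approx (\<lambda>x. complex_of_real (P n x) * complex_of_real (cut r x))" for n
      unfolding cut_separated[symmetric, of "\<lambda>x. complex_of_real (P n x)"]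
      by (rule approx_polynomial_radial[of _ _ "r + 1"])
        (use r in \<open>auto intro!: continuous_intros polynomial_function_of_real P(1)\<close>)
    show "(\<lambda>x. complex_of_real (f x * cut r x)) \<in> borel_measurable M" by (rule borel_measurable_M) measurable
    show "integrable M (\<lambda>x. (B * cut r x)\<^sup>2)" by (rule integrable_cut_sq[OF r])
    have "(\<lambda>n. complex_of_real (P n x) * complex_of_real (cut r x)) \<longlonglongrightarrow> complex_of_real (f x * cut r x)" for x
    proof (cases "x \<in> cball 0 \<rho>")
      case True
      have "(\<lambda>n. P n x) \<longlonglongrightarrow> f x" by (rule P(3)[OF True])
      then show ?thesis unfolding of_real_mult by (intro tendsto_intros)
    qed (simp add: out)
    then show "AE x in M. (\<lambda>n. complex_of_real (P n x) * complex_of_real (cut r x)) \<longlonglongrightarrow> complex_of_real (f x * cut r x)"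
      by simp
    have "cmod (complex_of_real (P n x) * complex_of_real (cut r x)) \<le> B * cut r x" for n x
    proof (cases "x \<in> cball 0 \<rho>")
      case True
      have "\<bar>P n x\<bar> \<le> B" using P(2)[OF True] .
      then show ?thesis using cut_range[of r x] by (simp add: norm_mult mult_right_mono)
    qed (simp add: out)
    then show "AE x in M. cmod (complex_of_real (P n x) * complex_of_real (cut r x)) \<le> B * cut r x" for n
      by simp
  qed
qed

lemma approx_dominated_cut:
  assumes "\<And>n. approx (\<lambda>x. complex_of_real (f n x * cut r x))" "r \<ge> 0"
    and [measurable]: "g \<in> borel_measurable borel"
    and "\<And>x. (\<lambda>n. f n x) \<longlonglongrightarrow> g x" "\<And>n x. \<bar>f n x\<bar> \<le> 1"
  shows "approx (\<lambda>x. complex_of_real (g x * cut r x))"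
proof (rule approx_dominated[OF assms(1) _ integrable_cut_sq[OF assms(2), of 1]])
  show "(\<lambda>x. complex_of_real (g x * cut r x)) \<in> borel_measurable M" by (rule borel_measurable_M) measurable
  show "AE x in M. (\<lambda>n. complex_of_real (f n x * cut r x)) \<longlonglongrightarrow> complex_of_real (g x * cut r x)"
    using assms(4) by (intro AE_I2 tendsto_intros)
  show "AE x in M. cmod (complex_of_real (f n x * cut r x)) \<le> 1 * cut r x" for n
    using assms(5)
    by (intro AE_I2) (simp add: abs_mult mult_left_le_one_le cut_range del: of_real_mult)
qed

text \<open>The indicator of a closed set is the limit of the functions \<open>max 0 (1 - n d(x, F))\<close>.\<close>

lemma approx_closed_cut:
  assumes F: "closed F" and r: "r \<ge> 0"
  shows "approx (\<lambda>x. complex_of_real (indicator F x * cut r x))"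
proof (cases "F = {}")
  case True
  then show ?thesis by (simp add: approx_zero)
next
  case False
  define f where "f n x = max 0 (1 - real n * infdist x F)" for n x
  show ?thesis
  proof (rule approx_dominated_cut[of f])
    show "approx (\<lambda>x. complex_of_real (f n x * cut r x))" for n
      unfolding f_def by (intro approx_continuous_cut r continuous_intros)
    show "indicator F \<in> borel_measurable borel" using F by (intro borel_measurable_indicator) simp
    show "(\<lambda>n. f n x) \<longlonglongrightarrow> indicator F x" for x
    proof (cases "x \<in> F")
      case True
      then have "f n x = 1" for n by (simp add: f_def)
      then show ?thesis using True by simp
    next
      case 2: False
      then have d: "infdist x F > 0"
        using in_closed_iff_infdist_zero[OF F False, of x] infdist_nonneg[of x F] by linarith
      obtain N :: nat where N: "1 / infdist x F < real N" using reals_Archimedean2 by blast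
      have "f n x = 0" if "n \<ge> N" for n
      proof -
        have "1 / infdist x F < real n" using N that by linarith
        then have "1 < real n * infdist x F" using d by (simp add: pos_divide_less_eq)
        then show ?thesis by (simp add: f_def)
      qed
      then have "\<forall>\<^sub>F n in sequentially. f n x = indicator F x"
        using 2 by (intro eventually_sequentiallyI[of N]) simp
      then show ?thesis by (rule tendsto_eventually)
    qed
    show "\<bar>f n x\<bar> \<le> 1" for n x using infdist_nonneg[of x F] by (simp add: f_def)
  qed (rule r)
qed

text \<open>Dynkin's argument, starting from the closed sets.\<close>

lemma approx_borel_cut:
  assumes B: "B \<in> sets borel" and r: "r \<ge> 0"
  shows "approx (\<lambda>x. complex_of_real (indicator B x * cut r x))"
proof -
  have "Int_stable (Collect closed :: (real ^ 'n) set set)" by (auto simp: Int_stable_def)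
  moreover have "Collect closed \<subseteq> Pow (UNIV :: (real ^ 'n) set)" by simp
  moreover have "B \<in> sigma_sets UNIV (Collect closed)"
    using B unfolding borel_eq_closed by simp
  ultimately show ?thesis
  proof (induction rule: sigma_sets_induct_disjoint)
    case (basic A)
    then show ?case using approx_closed_cut r by simp
  next
    case empty
    show ?case using approx_closed_cut[of "{}"] r by simp
  next
    case (compl A)
    have "(\<lambda>x. complex_of_real (indicator (UNIV - A) x * cut r x))
        = (\<lambda>x. complex_of_real (indicator UNIV x * cut r x) + (- 1) * complex_of_real (indicator A x * cut r x))"
      by (rule ext) (simp add: indicator_def)
    moreover have "approx (\<lambda>x. complex_of_real (indicator UNIV x * cut r x) + (- 1) * complex_of_real (indicator A x * cut r x))"
      by (intro approx_add approx_scale compl.IH approx_closed_cut r) simp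
    ultimately show ?case by simp
  next
    case (union A)
    have sets: "A i \<in> sets borel" for i 
      using subsetD[OF union.hyps(2) rangeI[of A i]] unfolding borel_eq_closed by simp
    show ?case
    proof (rule approx_dominated_cut[of "\<lambda>n. indicator (\<Union>i<n. A i)"])
      show "approx (\<lambda>x. complex_of_real (indicator (\<Union>i<n. A i) x * cut r x))" for n
      proof -
        have "indicator (\<Union>i<n. A i) x = (\<Sum>i<n. indicator (A i) x :: real)" for x
          by (rule indicator_UN_disjoint[OF finite_lessThan disjoint_family_on_mono[OF subset_UNIV union.hyps(1)]])
        then have "(\<lambda>x. complex_of_real (indicator (\<Union>i<n. A i) x * cut r x))
            = (\<lambda>x. \<Sum>i<n. complex_of_real (indicator (A i) x * cut r x))"
          by (simp only: sum_distrib_right of_real_sum)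
        moreover have "approx (\<lambda>x. \<Sum>i<n. complex_of_real (indicator (A i) x * cut r x))"
          by (rule approx_sum) (rule union.IH)
        ultimately show ?thesis by simp
      qed
      show "indicator (\<Union> (range A)) \<in> borel_measurable borel"
        using sets by (intro borel_measurable_indicator) auto
      show "(\<lambda>n. indicator (\<Union>i<n. A i) x) \<longlonglongrightarrow> (indicator (\<Union> (range A)) x :: real)" for x
        by (rule LIMSEQ_indicator_UN)
      show "\<bar>indicator (\<Union>i<n. A i) x\<bar> \<le> (1 :: real)" for n x by (simp split: split_indicator)
    qed (rule r)
  qed
qed

lemma AE_M_lebesgue: "AE x in lebesgue. P x \<Longrightarrow> AE x in M. P x"
  unfolding dunkl_measure_def using weight_measurable_lebesgue by (subst AE_density) auto

text \<open>Lebesgue sets are Borel sets up to null sets.\<close>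

lemma approx_lebesgue_cut:
  assumes B: "B \<in> sets lebesgue" and r: "r \<ge> 0"
  shows "approx (\<lambda>x. complex_of_real (indicator B x * cut r x))"
proof -
  obtain C Z where CZ: "fsigma C" "Z \<in> null_sets lebesgue" "C \<union> Z = B"
    by (rule lebesgue_set_almost_fsigma[OF B]) (rule that)
  have C: "C \<in> sets borel" 
    using CZ(1) by cases (auto intro!: sets.countable_UN borel_closed)
  have ind: "indicator B \<in> borel_measurable M" using B by (intro borel_measurable_indicator) simp
  have [measurable]: "cut r \<in> borel_measurable M" by (rule borel_measurable_M) simp
  show ?thesis
  proof (rule approx_AE_cong[OF approx_borel_cut[OF C r]])
    show "(\<lambda>x. complex_of_real (indicator B x * cut r x)) \<in> borel_measurable M"
      using ind by measurable
    have "AE x in lebesgue. x \<notin> Z" using CZ(2) by (rule AE_not_in)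
    then show "AE x in M. complex_of_real (indicator C x * cut r x) = complex_of_real (indicator B x * cut r x)"
      using CZ(3) by (intro AE_M_lebesgue) (auto elim!: eventually_mono simp: indicator_def)
  qed
qed

text \<open>Simple functions, cut off in space, converge to any square-integrable function with a
  square-integrable bound.\<close>

theorem approx_all:
  assumes f: "f \<in> L2 M" shows "approx f"
proof -
  note [measurable] = L2_measurable[OF f]
  have [measurable]: "cut r \<in> borel_measurable M" for r by (rule borel_measurable_M) simp
  from borel_measurable_implies_sequence_metric[OF L2_measurable[OF f], of 0]
  obtain F where F0: "(\<forall>i. simple_function M (F i)) \<and> (\<forall>x\<in>space M. (\<lambda>i. F i x) \<longlonglongrightarrow> f x) \<and>
      (\<forall>i. \<forall>x\<in>space M. dist (F i x) 0 \<le> 2 * dist (f x) 0)"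
    by (rule exE)
  have F: "\<And>i. simple_function M (F i)" "\<And>x. x \<in> space M \<Longrightarrow> (\<lambda>i. F i x) \<longlonglongrightarrow> f x"
    "\<And>i x. x \<in> space M \<Longrightarrow> dist (F i x) 0 \<le> 2 * dist (f x) 0"
    using F0 by simp_all
  have int: "integrable M (\<lambda>x. (2 * cmod (f x))\<^sup>2)" using L2_integrable[OF f] by (simp add: power_mult_distrib)
  have approx_simple: "approx (\<lambda>x. F i x * complex_of_real (cut r x))" if r: "r \<ge> 0" for i r
  proof -
    have "(\<lambda>x. F i x * complex_of_real (cut r x))
        = (\<lambda>x. \<Sum>y\<in>F i ` space M. y * complex_of_real (indicator (F i -` {y} \<inter> space M) x * cut r x))"
    proof (rule ext)
      fix x
      have "(\<Sum>y\<in>F i ` space M. y * complex_of_real (indicator (F i -` {y} \<inter> space M) x * cut r x))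
          = (\<Sum>y\<in>F i ` space M. if y = F i x then y * complex_of_real (cut r x) else 0)"
        by (intro sum.cong) (auto simp: indicator_def)
      also have "\<dots> = F i x * complex_of_real (cut r x)"
        using simple_functionD(1)[OF F(1)] by (subst sum.delta) auto
      finally show "F i x * complex_of_real (cut r x)
          = (\<Sum>y\<in>F i ` space M. y * complex_of_real (indicator (F i -` {y} \<inter> space M) x * cut r x))" ..
    qed
    moreover have "F i -` {y} \<inter> space M \<in> sets lebesgue" for y
      using simple_functionD(2)[OF F(1)] by simp
    ultimately show ?thesis by (simp only:) (intro approx_sum approx_scale approx_lebesgue_cut r)
  qed
  have bound: "cmod (z * complex_of_real (cut r x)) \<le> cmod z" for z r x
    using cut_range[of r x] by (simp add: norm_mult mult_left_le)
  have approx_cut: "approx (\<lambda>x. f x * complex_of_real (cut r x))" if r: "r \<ge> 0" for r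
  proof (rule approx_dominated[OF approx_simple[OF r] _ int])
    show "AE x in M. (\<lambda>i. F i x * complex_of_real (cut r x)) \<longlonglongrightarrow> f x * complex_of_real (cut r x)"
      using F(2) by (intro AE_I2 tendsto_intros) simp
    show "AE x in M. cmod (F i x * complex_of_real (cut r x)) \<le> 2 * cmod (f x)" for i
    proof (rule AE_I2)
      fix x :: "real ^ 'n"
      have "cmod (F i x) \<le> 2 * cmod (f x)" using F(3)[of x i] by simp
      then show "cmod (F i x * complex_of_real (cut r x)) \<le> 2 * cmod (f x)" using bound[of "F i x" r x] by linarith
    qed
  qed measurable
  show ?thesis
  proof (rule approx_dominated[where f = "\<lambda>n x. f x * complex_of_real (cut (real n) x)", OF approx_cut _ L2_integrable[OF f]])
    show "AE x in M. (\<lambda>n. f x * complex_of_real (cut (real n) x)) \<longlonglongrightarrow> f x"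
    proof (rule AE_I2)
      fix x :: "real ^ 'n"
      obtain N :: nat where N: "norm x powr a < real N" using reals_Archimedean2 by blast
      have "cut (real n) x = 1" if "n \<ge> N" for n using N that by (simp add: cut_def)
      then have "\<forall>\<^sub>F n in sequentially. f x * complex_of_real (cut (real n) x) = f x"
        by (intro eventually_sequentiallyI[of N]) simp
      then show "(\<lambda>n. f x * complex_of_real (cut (real n) x)) \<longlonglongrightarrow> f x" by (rule tendsto_eventually)
    qed
    show "AE x in M. cmod (f x * complex_of_real (cut (real n) x)) \<le> cmod (f x)" for n
      by (intro AE_I2 bound)
  qed auto
qed

end

section \<open>The spectral theorem\<close>

context dunkl_a
begin

text \<open>Different pairs \<open>(l, m)\<close> can have the same eigenvalue, so the eigenspaces collect all of them.\<close>

definition E :: "real \<Rightarrow> (real ^ 'n \<Rightarrow> complex) set" where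
  "E \<mu> = lincomb {\<Phi> l m p | l m p. p \<in> H m \<and> eigval l m = \<mu>}"

lemma E_subset_W: "E \<mu> \<subseteq> W"
  unfolding E_def W_lincomb lincomb_def eigenfunctions_def by blast

lemma \<Delta>_zero: "twice_differentiable_T (\<lambda>x. 0)" "\<Delta> (\<lambda>x. 0) x = 0"
proof -
  have T0: "T \<xi> (\<lambda>x. 0) = (\<lambda>x. 0)" for \<xi> by (rule ext) (rule T_const)
  show "twice_differentiable_T (\<lambda>x. 0)" by (simp add: twice_differentiable_T_def T0)
  show "\<Delta> (\<lambda>x. 0) x = 0" by (simp add: Delta_ka_def dunkl_laplacian_def T0)
qed

lemma \<Delta>_E:
  assumes "f \<in> E \<mu>"
  shows "twice_differentiable_T f \<and> (\<forall>x\<in>generic. \<Delta> f x = complex_of_real \<mu> * f x)"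
  using assms unfolding E_def
proof (induction rule: lincomb_induct)
  case zero
  show ?case by (simp add: \<Delta>_zero)
next
  case (step \<phi> c g)
  obtain l m p where \<phi>: "\<phi> = \<Phi> l m p" "p \<in> H m" "eigval l m = \<mu>" using step.hyps(1) by blast
  have d\<phi>: "twice_differentiable_T \<phi>"
    unfolding \<phi>(1) \<Phi>_separated by (rule twice_differentiable_T_poly_exp[OF \<phi>(2)])
  have \<Delta>\<phi>: "\<Delta> \<phi> x = complex_of_real \<mu> * \<phi> x" if "x \<in> generic" for x
    unfolding \<phi>(1) \<phi>(3)[symmetric] by (rule \<Delta>_\<Phi>[OF \<phi>(2) that])
  have dc: "twice_differentiable_T (\<lambda>x. c * \<phi> x)" by (rule \<Delta>_cmult(1)[OF d\<phi>])
  have dg: "twice_differentiable_T g" and \<Delta>g: "\<And>x. x \<in> generic \<Longrightarrow> \<Delta> g x = complex_of_real \<mu> * g x"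
    using step.IH by auto
  show ?case
    using \<Delta>_add(1)[OF dc dg]
    by (simp add: \<Delta>_add(2)[OF dc dg] \<Delta>_cmult(2)[OF d\<phi>] \<Delta>\<phi> \<Delta>g distrib_left mult.left_commute)
qed

lemma E_orthogonal:
  assumes "f \<in> E \<mu>" "g \<in> E \<nu>" "\<mu> \<noteq> \<nu>"
  shows "L2_inner M f g = 0"
proof -
  obtain S c where S: "finite S" "S \<subseteq> {\<Phi> l m p | l m p. p \<in> H m \<and> eigval l m = \<mu>}" "f = (\<lambda>x. \<Sum>\<phi>\<in>S. c \<phi> * \<phi> x)"
    using assms(1) unfolding E_def by (rule lincombE)
  obtain Z d where Z: "finite Z" "Z \<subseteq> {\<Phi> l m p | l m p. p \<in> H m \<and> eigval l m = \<nu>}" "g = (\<lambda>x. \<Sum>\<psi>\<in>Z. d \<psi> * \<psi> x)"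
    using assms(2) unfolding E_def by (rule lincombE)
  have LS: "\<phi> \<in> L2 M" if "\<phi> \<in> S" for \<phi> using subsetD[OF S(2) that] \<Phi>_L2 by blast
  have LZ: "\<psi> \<in> L2 M" if "\<psi> \<in> Z" for \<psi> using subsetD[OF Z(2) that] \<Phi>_L2 by blast
  have zero: "L2_inner M \<phi> \<psi> = 0" if \<phi>S: "\<phi> \<in> S" and \<psi>Z: "\<psi> \<in> Z" for \<phi> \<psi>
  proof -
    obtain l m p where \<phi>: "\<phi> = \<Phi> l m p" "p \<in> H m" "eigval l m = \<mu>" using subsetD[OF S(2) \<phi>S] by blast
    obtain j n q where \<psi>: "\<psi> = \<Phi> j n q" "q \<in> H n" "eigval j n = \<nu>" using subsetD[OF Z(2) \<psi>Z] by blast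
    have "l \<noteq> j \<or> m \<noteq> n" using \<phi>(3) \<psi>(3) assms(3) by auto
    then show ?thesis unfolding \<phi>(1) \<psi>(1) by (rule \<Phi>_orthogonal[OF \<phi>(2) \<psi>(2)])
  qed
  have "L2_inner M f g = (\<Sum>\<phi>\<in>S. \<Sum>\<psi>\<in>Z. L2_inner M (\<lambda>x. c \<phi> * \<phi> x) (\<lambda>x. d \<psi> * \<psi> x))"
    unfolding S(3) Z(3) by (simp add: L2_inner_sum_left L2_inner_sum_right L2_sum L2_scale LS LZ)
  also have "\<dots> = 0"
    by (intro sum.neutral ballI) (simp add: L2_inner_scale_left L2_inner_scale_right zero)
  finally show ?thesis .
qed

lemma orthogonal_eigenspaces_E: "orthogonal_eigenspaces M E"
proof
  show "f \<in> L2 M" if "f \<in> E \<mu>" for f \<mu> using W_L2 E_subset_W that by blast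
  show "(\<lambda>x. 0) \<in> E \<mu>" for \<mu> unfolding E_def by (rule lincomb_zero)
  show "(\<lambda>x. f x + g x) \<in> E \<mu>" if "f \<in> E \<mu>" "g \<in> E \<mu>" for f g \<mu>
    using that unfolding E_def by (rule lincomb_add)
  show "(\<lambda>x. c * f x) \<in> E \<mu>" if "f \<in> E \<mu>" for f c \<mu>
    using that unfolding E_def by (rule lincomb_scale)
  show "L2_inner M f g = 0" if "f \<in> E \<mu>" "g \<in> E \<nu>" "\<mu> \<noteq> \<nu>" for f g \<mu> \<nu>
    using that by (rule E_orthogonal)
qed

sublocale orthogonal_eigenspaces M E
  by (rule orthogonal_eigenspaces_E)

lemma graph_eigenvector:
  assumes "F \<in> E \<mu>" shows "(F, \<lambda>x. complex_of_real \<mu> * F x) \<in> graph"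
  unfolding graph_def mem_Collect_eq
  by (rule exI[of _ "{\<mu>}"], rule exI[of _ "\<lambda>\<nu>. if \<nu> = \<mu> then F else (\<lambda>x. 0)"])
    (use assms E_zero in auto)

lemma W_Domain_graph: "f \<in> W \<Longrightarrow> \<exists>g. (f, g) \<in> graph"
  unfolding W_lincomb
proof (induction rule: lincomb_induct)
  case zero
  show ?case using graph_eigenvector[OF E_zero] by blast
next
  case (step \<phi> c f)
  obtain l m p where \<phi>: "\<phi> = \<Phi> l m p" "p \<in> H m" using step.hyps(1) unfolding eigenfunctions_def by blast
  have "\<phi> \<in> E (eigval l m)" unfolding E_def \<phi>(1) by (rule lincomb_base) (use \<phi>(2) in blast)
  then have e: "((\<lambda>x. - c * \<phi> x), (\<lambda>x. complex_of_real (eigval l m) * (- c * \<phi> x))) \<in> graph"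
    by (intro graph_eigenvector E_scale)
  obtain g where "(f, g) \<in> graph" using step.IH by blast
  from graph_diff[OF this e] have "((\<lambda>x. f x - (- c * \<phi> x)), (\<lambda>x. g x - complex_of_real (eigval l m) * (- c * \<phi> x))) \<in> graph" .
  moreover have "(\<lambda>x. f x - (- c * \<phi> x)) = (\<lambda>x. c * \<phi> x + f x)" by (rule ext) simp
  ultimately show ?case by metis
qed

text \<open>On \<open>W\<close> the differential-difference operator is the diagonal one; the identity holds at generic
  points, hence almost everywhere.\<close>

lemma graph_\<Delta>:
  assumes "(f, g) \<in> graph"
  shows "f \<in> W" and "x \<in> generic \<Longrightarrow> \<Delta> f x = g x"
proof -
  obtain S F where SF: "finite S" "\<And>\<mu>. F \<mu> \<in> E \<mu>"
    and fg: "f = (\<lambda>x. \<Sum>\<mu>\<in>S. F \<mu> x)" "g = (\<lambda>x. \<Sum>\<mu>\<in>S. complex_of_real \<mu> * F \<mu> x)"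
    using assms unfolding graph_def by blast
  have "(\<lambda>x. \<Sum>\<mu>\<in>S. F \<mu> x) \<in> W \<and> twice_differentiable_T (\<lambda>x. \<Sum>\<mu>\<in>S. F \<mu> x) \<and>
      (\<forall>x\<in>generic. \<Delta> (\<lambda>x. \<Sum>\<mu>\<in>S. F \<mu> x) x = (\<Sum>\<mu>\<in>S. complex_of_real \<mu> * F \<mu> x))"
    using SF(1)
  proof (induction S)
    case empty
    show ?case by (simp add: \<Delta>_zero W_lincomb lincomb_zero)
  next
    case (insert \<mu> S)
    have d: "twice_differentiable_T (F \<mu>)" "\<And>x. x \<in> generic \<Longrightarrow> \<Delta> (F \<mu>) x = complex_of_real \<mu> * F \<mu> x"
      using \<Delta>_E[OF SF(2)] by auto
    have dS: "twice_differentiable_T (\<lambda>x. \<Sum>\<mu>\<in>S. F \<mu> x)"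
      "\<And>x. x \<in> generic \<Longrightarrow> \<Delta> (\<lambda>x. \<Sum>\<mu>\<in>S. F \<mu> x) x = (\<Sum>\<mu>\<in>S. complex_of_real \<mu> * F \<mu> x)"
      using insert.IH by auto
    have "(\<lambda>x. F \<mu> x + (\<Sum>\<mu>\<in>S. F \<mu> x)) \<in> W"
      using insert.IH subsetD[OF E_subset_W SF(2)] unfolding W_lincomb by (intro lincomb_add) auto
    then show ?case
      using \<Delta>_add(1)[OF d(1) dS(1)] by (simp add: insert.hyps \<Delta>_add(2)[OF d(1) dS(1)] d(2) dS(2))
  qed
  then show "f \<in> W" "x \<in> generic \<Longrightarrow> \<Delta> f x = g x" by (simp_all add: fg)
qed

lemma eigenvalues_subset: "eigenvalues \<subseteq> {eigval l m | l m. True}"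
proof
  fix \<mu> assume "\<mu> \<in> eigenvalues"
  then obtain f where f: "f \<in> E \<mu>" "\<not> (AE x in M. f x = 0)" unfolding eigenvalues_def by blast
  show "\<mu> \<in> {eigval l m | l m. True}"
  proof (rule ccontr)
    assume "\<mu> \<notin> {eigval l m | l m. True}"
    then have none: "{\<Phi> l m p | l m p. p \<in> H m \<and> eigval l m = \<mu>} = {}" by blast
    obtain S c where "S \<subseteq> {}" "f = (\<lambda>x. \<Sum>\<phi>\<in>S. c \<phi> * \<phi> x)"
      using f(1) unfolding E_def none by (rule lincombE)
    then have "f = (\<lambda>x. 0)" by simp
    then show False using f(2) by simp
  qed
qed

text \<open>The eigenvalues are \<open>-(2 a l + 2 m + c)\<close> with \<open>c\<close> independent of \<open>l\<close> and \<open>m\<close>, so bounded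
  sets contain only finitely many of them.\<close>

lemma eigenvalues_discrete:
  "\<exists>d>0. \<forall>\<mu>\<in>eigenvalues. complex_of_real \<mu> \<noteq> z \<longrightarrow> d \<le> cmod (complex_of_real \<mu> - z)"
proof -
  define c where "c = 2 * \<gamma> + real CARD('n) - 2 + a"
  have ev: "eigval l m = - (2 * a * real l + 2 * real m + c)" for l m
  proof -
    have "eigval l m = - (2 * a * real l + a * lam m + a)" by (simp add: eigval_def algebra_simps)
    then show ?thesis unfolding a_lam by (simp add: c_def)
  qed
  define B where "B = cmod z + 1 + \<bar>c\<bar>"
  have near: "l \<le> nat \<lceil>B / (2 * a)\<rceil> \<and> m \<le> nat \<lceil>B / 2\<rceil>" if "cmod (complex_of_real (eigval l m) - z) < 1" for l m
  proof -
    have "\<bar>eigval l m\<bar> \<le> cmod (complex_of_real (eigval l m) - z) + cmod z"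
      using norm_triangle_ineq[of "complex_of_real (eigval l m) - z" z] by simp
    then have "2 * a * real l + 2 * real m < B" using that unfolding ev B_def by linarith
    moreover have "0 \<le> 2 * a * real l" using a_pos by simp
    ultimately have "2 * a * real l < B" "2 * real m < B" by linarith+
    then have "real l < B / (2 * a)" "real m < B / 2" using a_pos by (simp_all add: pos_less_divide_eq mult.commute)
    then show ?thesis by linarith
  qed
  define D where "D = (\<lambda>\<mu>. cmod (complex_of_real \<mu> - z)) `
    ((\<lambda>(l, m). eigval l m) ` ({..nat \<lceil>B / (2 * a)\<rceil>} \<times> {..nat \<lceil>B / 2\<rceil>}))"
  define d where "d = Min (insert 1 (D - {0}))"
  have fin: "finite (insert 1 (D - {0}))" unfolding D_def by simp
  have "d > 0" unfolding d_def using fin by (subst Min_gr_iff) (auto simp: D_def)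
  moreover have "d \<le> cmod (complex_of_real \<mu> - z)" if \<mu>: "\<mu> \<in> eigenvalues" "complex_of_real \<mu> \<noteq> z" for \<mu>
  proof (cases "cmod (complex_of_real \<mu> - z) < 1")
    case True
    obtain l m where lm: "\<mu> = eigval l m" using subsetD[OF eigenvalues_subset \<mu>(1)] by blast
    have "cmod (complex_of_real \<mu> - z) \<in> D"
      unfolding D_def using near[of l m] True lm by (intro imageI image_eqI[of _ _ "(l, m)"]) auto
    then show ?thesis unfolding d_def using fin \<mu>(2) by (intro Min_le) auto
  next
    case False
    have "d \<le> 1" unfolding d_def using fin by (intro Min_le) auto
    with False show ?thesis by linarith
  qed
  ultimately show ?thesis by blast
qed

lemma negative_eigenspaces_E: "negative_eigenspaces M E"
proof
  show "L2_dense M (Domain graph)"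
    unfolding L2_dense_def
  proof (intro conjI ballI allI impI)
    show "Domain graph \<subseteq> L2 M" using graph_L2 by (auto simp: Domain_iff)
    fix f and \<epsilon> :: real assume "f \<in> L2 M" and \<epsilon>: "\<epsilon> > 0"
    then have "approx f" by (intro approx_all)
    then obtain u where "u \<in> W" "L2_norm M (\<lambda>x. f x - u x) < \<epsilon>" using \<epsilon> by (rule approxE)
    moreover have "u \<in> Domain graph" using W_Domain_graph[OF \<open>u \<in> W\<close>] by (simp add: Domain_iff)
    ultimately show "\<exists>u\<in>Domain graph. L2_norm M (\<lambda>x. f x - u x) < \<epsilon>" by (intro bexI[of _ u])
  qed
  show "\<mu> < 0" if "\<mu> \<in> eigenvalues" for \<mu>
    using subsetD[OF eigenvalues_subset that] eigval_neg by auto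
  show "\<exists>d>0. \<forall>\<mu>\<in>eigenvalues. complex_of_real \<mu> \<noteq> z \<longrightarrow> d \<le> cmod (complex_of_real \<mu> - z)" for z
    by (rule eigenvalues_discrete)
qed

sublocale negative_eigenspaces M E
  by (rule negative_eigenspaces_E)

lemma borel_measurable_M_cong_generic:
  fixes f g :: "real ^ 'n \<Rightarrow> complex"
  assumes g: "g \<in> borel_measurable M" and eq: "\<And>x. x \<in> generic \<Longrightarrow> f x = g x"
  shows "f \<in> borel_measurable M"
proof (rule measurableI)
  fix A :: "complex set" assume A: "A \<in> sets borel"
  have "g -` A \<inter> space M \<in> sets M" by (rule measurable_sets[OF g A])
  moreover have "generic \<in> sets M" using open_generic by simp
  moreover have "negligible (f -` A \<inter> - generic)"
    by (rule negligible_subset[OF negligible_not_generic]) simp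
  then have "f -` A \<inter> - generic \<in> sets M" by (simp add: negligible_imp_sets)
  ultimately have "((g -` A \<inter> space M) \<inter> generic) \<union> (f -` A \<inter> - generic) \<in> sets M" by blast
  moreover have "f -` A \<inter> space M = ((g -` A \<inter> space M) \<inter> generic) \<union> (f -` A \<inter> - generic)"
    using eq by auto
  ultimately show "f -` A \<inter> space M \<in> sets M" by simp
qed simp

lemma graph_\<Delta>_AE: "(f, g) \<in> graph \<Longrightarrow> AE x in M. \<Delta> f x = g x"
  using AE_M_generic graph_\<Delta>(2) by (auto elim!: eventually_mono)

lemma self_adjoint_extension_closure_operator: "self_adjoint_extension R Rp k a closure_operator"
  unfolding self_adjoint_extension_def
proof (intro conjI ballI)
  show "self_adjoint M closure_operator" by (rule self_adjoint_closure_operator)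
  fix f assume "f \<in> W"
  then obtain g where fg: "(f, g) \<in> graph" using W_Domain_graph by blast
  have g: "g \<in> L2 M" and f: "f \<in> L2 M" using graph_L2[OF fg] by auto
  have \<Delta>L2: "\<Delta> f \<in> L2 M"
    by (rule L2_AE_cong[OF g borel_measurable_M_cong_generic[OF L2_measurable[OF g]] graph_\<Delta>_AE[OF fg]])
      (rule graph_\<Delta>(2)[OF fg])
  have "\<forall>f g f' g'. (f, g) \<in> closure_operator \<longrightarrow> f' \<in> L2 M \<longrightarrow> g' \<in> L2 M \<longrightarrow>
      (AE x in M. f' x = f x) \<longrightarrow> (AE x in M. g' x = g x) \<longrightarrow> (f', g') \<in> closure_operator"
    using L2_operator_closure_operator unfolding L2_operator_def by blast
  from this[rule_format, OF subsetD[OF graph_subset_closure_operator fg] f \<Delta>L2 _ graph_\<Delta>_AE[OF fg]]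
  show "(f, \<Delta> f) \<in> closure_operator" by simp
qed

text \<open>The operator is essentially self-adjoint, so that a statement about one self-adjoint extension
  is a statement about every one.\<close>

lemma self_adjoint_extension_eq_closure_operator:
  assumes "self_adjoint_extension R Rp k a A" shows "A = closure_operator"
proof (rule self_adjoint_extension_unique)
  show "self_adjoint M A" using assms by (simp add: self_adjoint_extension_def)
  fix f g assume fg: "(f, g) \<in> graph"
  have "(f, \<Delta> f) \<in> A" using assms graph_\<Delta>(1)[OF fg] by (simp add: self_adjoint_extension_def)
  with graph_\<Delta>_AE[OF fg] show "\<exists>g'. (f, g') \<in> A \<and> (AE x in M. g' x = g x)" by blast
qed

end

theorem theoremA:
  fixes R Rp :: "(real ^ 'n) set"
    and k :: "real ^ 'n \<Rightarrow> real"
    and a :: real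
  assumes "reduced_root_system R"
    and "positive_subsystem R Rp"
    and "multiplicity_function R k"
    and "\<forall>\<alpha>\<in>R. k \<alpha> \<ge> 0"
    and "a > 0"
    and "a + 2 * mult_index Rp k + real CARD('n) - 2 > 0"
  shows "(\<exists>A. self_adjoint_extension R Rp k a A) \<and>
         (\<forall>A. self_adjoint_extension R Rp k a A \<longrightarrow>
            continuous_spectrum (dunkl_measure R k a) A = {} \<and>
            (\<forall>z\<in>point_spectrum (dunkl_measure R k a) A. z \<in> \<real> \<and> Re z < 0))"
proof -
  interpret dunkl_a R Rp k a
    using assms by unfold_locales auto
  show ?thesis
    using self_adjoint_extension_closure_operator self_adjoint_extension_eq_closure_operator
      spectrum_closure_operator by blast
qed

end
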